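(* Over $\mathrm{ZFC}$, the Continuum Coding Axiom implies the Ground Axiom.
   Context: The Continuum Coding Axiom ($\mathrm{CCA}$) asserts: for every ordinal $\alpha$ and every $a\subseteq\alpha$ there is an ordinal $\theta$ such that for every $\beta<\alpha$, $\beta\in a$ if and only if $2^{\aleph_{\theta+\beta+1}}=(\aleph_{\theta+\beta+1})^+$. The Ground Axiom ($\mathrm{GA}$) asserts that the universe $V$ is not a forcing extension of any inner model $W$ by nontrivial set forcing $P\in W$. *)

theory Defs
  imports Main
begin

datatype fm = Mem nat nat | Eq nat nat | Neg fm | Conj fm fm | All nat fm

text \<open>
  A structure for this language is a domain \<open>M\<close> with a binary relation \<open>E\<close> on it; \<open>E\<close> need be neither
  well-founded nor real membership. Every notion below is the first-order one interpreted in
  \<open>(M, E)\<close>: quantifiers over sets are bounded by \<open>M\<close>, and \<open>elts x\<close> is the external set of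
  those elements of the domain that are related to \<open>x\<close>.
\<close>

locale set_structure =
  fixes M :: "'a set" and E :: "'a \<Rightarrow> 'a \<Rightarrow> bool"
begin

primrec sat :: "(nat \<Rightarrow> 'a) \<Rightarrow> fm \<Rightarrow> bool" where
  "sat s (Mem i j) \<longleftrightarrow> E (s i) (s j)"
| "sat s (Eq i j) \<longleftrightarrow> s i = s j"
| "sat s (Neg \<phi>) \<longleftrightarrow> \<not> sat s \<phi>"
| "sat s (Conj \<phi> \<psi>) \<longleftrightarrow> sat s \<phi> \<and> sat s \<psi>"
| "sat s (All i \<phi>) \<longleftrightarrow> (\<forall>x\<in>M. sat (s(i := x)) \<phi>)"

definition elts :: "'a \<Rightarrow> 'a set" where
  "elts x = {y \<in> M. E y x}"

definition is_succ :: "'a \<Rightarrow> 'a \<Rightarrow> bool" where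
  "is_succ x y \<longleftrightarrow> elts y = insert x (elts x)"

definition is_power :: "'a \<Rightarrow> 'a \<Rightarrow> bool" where
  "is_power x p \<longleftrightarrow> elts p = {y \<in> M. elts y \<subseteq> elts x}"

subsection \<open>The axioms of ZFC\<close>

definition extensionality :: bool where
  "extensionality \<longleftrightarrow> (\<forall>x\<in>M. \<forall>y\<in>M. elts x = elts y \<longrightarrow> x = y)"

definition foundation :: bool where
  "foundation \<longleftrightarrow> (\<forall>x\<in>M. elts x \<noteq> {} \<longrightarrow> (\<exists>y\<in>elts x. elts y \<inter> elts x = {}))"

definition pairing :: bool where
  "pairing \<longleftrightarrow> (\<forall>x\<in>M. \<forall>y\<in>M. \<exists>z\<in>M. elts z = {x, y})"

definition union :: bool where
  "union \<longleftrightarrow> (\<forall>x\<in>M. \<exists>u\<in>M. elts u = (\<Union>y\<in>elts x. elts y))"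

definition power_set :: bool where
  "power_set \<longleftrightarrow> (\<forall>x\<in>M. \<exists>p\<in>M. is_power x p)"

definition infinity :: bool where
  "infinity \<longleftrightarrow> (\<exists>x\<in>M. (\<exists>z\<in>elts x. elts z = {}) \<and> (\<forall>y\<in>elts x. \<exists>s\<in>elts x. is_succ y s))"

text \<open>In the two schemes the values of \<open>s\<close> at the remaining variables serve as parameters.\<close>

definition separation :: bool where
  "separation \<longleftrightarrow> (\<forall>\<phi> s. range s \<subseteq> M \<longrightarrow>
     (\<forall>a\<in>M. \<exists>b\<in>M. elts b = {x \<in> elts a. sat (s(0 := x)) \<phi>}))"

definition replacement :: bool where
  "replacement \<longleftrightarrow> (\<forall>\<phi> s. range s \<subseteq> M \<longrightarrow>
     (\<forall>a\<in>M. (\<forall>x\<in>elts a. \<exists>!y. y \<in> M \<and> sat (s(0 := x, 1 := y)) \<phi>) \<longrightarrow>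
       (\<exists>b\<in>M. elts b = {y \<in> M. \<exists>x\<in>elts a. sat (s(0 := x, 1 := y)) \<phi>})))"

definition choice :: bool where
  "choice \<longleftrightarrow> (\<forall>F\<in>M.
     (\<forall>x\<in>elts F. elts x \<noteq> {}) \<and>
     (\<forall>x\<in>elts F. \<forall>y\<in>elts F. x \<noteq> y \<longrightarrow> elts x \<inter> elts y = {}) \<longrightarrow>
     (\<exists>c\<in>M. \<forall>x\<in>elts F. \<exists>!z. z \<in> elts c \<inter> elts x))"

definition ZFC :: bool where
  "ZFC \<longleftrightarrow> extensionality \<and> foundation \<and> pairing \<and> union \<and> power_set \<and> infinity \<and>
     separation \<and> replacement \<and> choice"

subsection \<open>Relations and functions\<close>

definition is_pair :: "'a \<Rightarrow> 'a \<Rightarrow> 'a \<Rightarrow> bool" where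
  "is_pair x y z \<longleftrightarrow> (\<exists>u\<in>M. \<exists>v\<in>M. elts u = {x} \<and> elts v = {x, y} \<and> elts z = {u, v})"

definition rel :: "'a \<Rightarrow> 'a \<Rightarrow> 'a \<Rightarrow> bool" where
  "rel r x y \<longleftrightarrow> (\<exists>z\<in>elts r. is_pair x y z)"

definition func :: "'a \<Rightarrow> 'a \<Rightarrow> bool" where
  "func f d \<longleftrightarrow> (\<forall>z\<in>elts f. \<exists>x\<in>elts d. \<exists>y\<in>M. is_pair x y z) \<and>
     (\<forall>x\<in>elts d. \<exists>!y. y \<in> M \<and> rel f x y)"

definition bijection :: "'a \<Rightarrow> 'a \<Rightarrow> 'a \<Rightarrow> bool" where
  "bijection f d c \<longleftrightarrow> func f d \<and>
     (\<forall>x\<in>elts d. \<forall>y\<in>M. rel f x y \<longrightarrow> y \<in> elts c) \<and>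
     (\<forall>y\<in>elts c. \<exists>!x. x \<in> elts d \<and> rel f x y)"

definition equipotent :: "'a \<Rightarrow> 'a \<Rightarrow> bool" where
  "equipotent x y \<longleftrightarrow> (\<exists>f\<in>M. bijection f x y)"

subsection \<open>Ordinals and cardinals\<close>

definition ordinal :: "'a \<Rightarrow> bool" where
  "ordinal x \<longleftrightarrow> x \<in> M \<and>
     (\<forall>y\<in>elts x. elts y \<subseteq> elts x) \<and>
     (\<forall>y\<in>elts x. \<not> E y y) \<and>
     (\<forall>u\<in>elts x. \<forall>v\<in>elts x. \<forall>w\<in>elts x. E u v \<and> E v w \<longrightarrow> E u w) \<and>
     (\<forall>u\<in>elts x. \<forall>v\<in>elts x. E u v \<or> u = v \<or> E v u) \<and>
     (\<forall>s\<in>M. elts s \<subseteq> elts x \<and> elts s \<noteq> {} \<longrightarrow> (\<exists>m\<in>elts s. \<forall>y\<in>elts s. m = y \<or> E m y))"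

definition limit_ordinal :: "'a \<Rightarrow> bool" where
  "limit_ordinal x \<longleftrightarrow> ordinal x \<and> elts x \<noteq> {} \<and> \<not> (\<exists>y\<in>elts x. is_succ y x)"

definition is_omega :: "'a \<Rightarrow> bool" where
  "is_omega x \<longleftrightarrow> limit_ordinal x \<and> (\<forall>y\<in>elts x. \<not> limit_ordinal y)"

text \<open>
  \<open>ord_iter S z b v\<close>: the sequence defined by transfinite recursion with value \<open>z\<close> at 0, with step
  \<open>S\<close> (the graph of an operation) at successors and with unions at limits has value \<open>v\<close> at the
  ordinal \<open>b\<close>.
\<close>

definition ord_iter :: "('a \<Rightarrow> 'a \<Rightarrow> bool) \<Rightarrow> 'a \<Rightarrow> 'a \<Rightarrow> 'a \<Rightarrow> bool" where
  "ord_iter S z b v \<longleftrightarrow> ordinal b \<and> (\<exists>d\<in>M. \<exists>f\<in>M. is_succ b d \<and> func f d \<and>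
     (\<forall>x\<in>elts d. elts x = {} \<longrightarrow> rel f x z) \<and>
     (\<forall>x\<in>elts d. \<forall>y\<in>elts d. \<forall>u\<in>M. \<forall>w\<in>M. is_succ x y \<and> rel f x u \<and> rel f y w \<longrightarrow> S u w) \<and>
     (\<forall>x\<in>elts d. \<forall>u\<in>M. limit_ordinal x \<and> rel f x u \<longrightarrow>
        elts u = (\<Union>w\<in>{w \<in> M. \<exists>y\<in>elts x. rel f y w}. elts w)) \<and>
     rel f b v)"

definition is_ord_add :: "'a \<Rightarrow> 'a \<Rightarrow> 'a \<Rightarrow> bool" where
  "is_ord_add a b c \<longleftrightarrow> ord_iter is_succ a b c"

definition cardinal :: "'a \<Rightarrow> bool" where
  "cardinal k \<longleftrightarrow> ordinal k \<and> (\<forall>x\<in>elts k. \<not> equipotent x k)"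

definition is_cardinality :: "'a \<Rightarrow> 'a \<Rightarrow> bool" where
  "is_cardinality x k \<longleftrightarrow> cardinal k \<and> equipotent x k"

definition is_card_succ :: "'a \<Rightarrow> 'a \<Rightarrow> bool" where
  "is_card_succ k l \<longleftrightarrow> cardinal l \<and> E k l \<and> (\<forall>m\<in>M. cardinal m \<and> E k m \<longrightarrow> l = m \<or> E l m)"

definition is_aleph :: "'a \<Rightarrow> 'a \<Rightarrow> bool" where
  "is_aleph x k \<longleftrightarrow> (\<exists>w\<in>M. is_omega w \<and> ord_iter is_card_succ w x k)"

definition is_two_power :: "'a \<Rightarrow> 'a \<Rightarrow> bool" where
  "is_two_power k l \<longleftrightarrow> (\<exists>p\<in>M. is_power k p \<and> is_cardinality p l)"

subsection \<open>The Continuum Coding Axiom\<close>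

definition GCH_at :: "'a \<Rightarrow> bool" where
  "GCH_at x \<longleftrightarrow> (\<exists>k\<in>M. \<exists>l\<in>M. is_aleph x k \<and> is_two_power k l \<and> is_card_succ k l)"

definition CCA :: bool where
  "CCA \<longleftrightarrow> (\<forall>\<alpha>\<in>M. \<forall>a\<in>M. ordinal \<alpha> \<and> elts a \<subseteq> elts \<alpha> \<longrightarrow>
     (\<exists>\<theta>\<in>M. ordinal \<theta> \<and> (\<forall>\<beta>\<in>elts \<alpha>. \<beta> \<in> elts a \<longleftrightarrow>
        (\<exists>\<sigma>\<in>M. \<exists>\<xi>\<in>M. is_ord_add \<theta> \<beta> \<sigma> \<and> is_succ \<sigma> \<xi> \<and> GCH_at \<xi>))))"

subsection \<open>Forcing notions, names and their values\<close>

definition forcing_notion :: "'a \<Rightarrow> 'a \<Rightarrow> bool" where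
  "forcing_notion P L \<longleftrightarrow> P \<in> M \<and> L \<in> M \<and> elts P \<noteq> {} \<and>
     (\<forall>z\<in>elts L. \<exists>p\<in>elts P. \<exists>q\<in>elts P. is_pair p q z) \<and>
     (\<forall>p\<in>elts P. rel L p p) \<and>
     (\<forall>p\<in>elts P. \<forall>q\<in>elts P. \<forall>r\<in>elts P. rel L p q \<and> rel L q r \<longrightarrow> rel L p r)"

definition compatible :: "'a \<Rightarrow> 'a \<Rightarrow> 'a \<Rightarrow> 'a \<Rightarrow> bool" where
  "compatible P L p q \<longleftrightarrow> (\<exists>r\<in>elts P. rel L r p \<and> rel L r q)"

text \<open>
  Nontrivial means that every condition has two incompatible extensions. Having this below some
  condition only would not do: such a forcing may have an atom, and a generic filter containing
  an atom already lies in the ground model.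
\<close>

definition nontrivial :: "'a \<Rightarrow> 'a \<Rightarrow> bool" where
  "nontrivial P L \<longleftrightarrow> (\<forall>p\<in>elts P. \<exists>q\<in>elts P. \<exists>r\<in>elts P.
     rel L q p \<and> rel L r p \<and> \<not> compatible P L q r)"

definition dense :: "'a \<Rightarrow> 'a \<Rightarrow> 'a \<Rightarrow> bool" where
  "dense P L D \<longleftrightarrow> elts D \<subseteq> elts P \<and> (\<forall>p\<in>elts P. \<exists>d\<in>elts D. rel L d p)"

definition filter_on :: "'a \<Rightarrow> 'a \<Rightarrow> 'a \<Rightarrow> bool" where
  "filter_on P L G \<longleftrightarrow> elts G \<subseteq> elts P \<and> elts G \<noteq> {} \<and>
     (\<forall>p\<in>elts G. \<forall>q\<in>elts P. rel L p q \<longrightarrow> q \<in> elts G) \<and>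
     (\<forall>p\<in>elts G. \<forall>q\<in>elts G. \<exists>r\<in>elts G. rel L r p \<and> rel L r q)"

text \<open>
  A \<open>P\<close>-name is a set of pairs of a \<open>P\<close>-name and a condition. The recursion is
  resolved by a set \<open>D\<close> containing the name and all names occurring hereditarily in it.
\<close>

definition is_name :: "'a \<Rightarrow> 'a \<Rightarrow> bool" where
  "is_name P \<tau> \<longleftrightarrow> (\<exists>D\<in>M. \<tau> \<in> elts D \<and>
     (\<forall>\<sigma>\<in>elts D. \<forall>z\<in>elts \<sigma>. \<exists>\<pi>\<in>elts D. \<exists>p\<in>elts P. is_pair \<pi> p z))"

text \<open>
  The value of \<open>\<tau>\<close> under \<open>G\<close> is the set of the values of those \<open>\<pi>\<close> for which the pair of \<open>\<pi>\<close> and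
  some \<open>p\<close> in \<open>G\<close> belongs to \<open>\<tau>\<close>; \<open>f\<close> is the evaluation function on the hereditary
  constituents of \<open>\<tau>\<close>.
\<close>

definition is_val :: "'a \<Rightarrow> 'a \<Rightarrow> 'a \<Rightarrow> bool" where
  "is_val G \<tau> x \<longleftrightarrow> (\<exists>D\<in>M. \<exists>f\<in>M. \<tau> \<in> elts D \<and> func f D \<and>
     (\<forall>\<sigma>\<in>elts D. \<forall>\<pi>\<in>M. \<forall>p\<in>M. rel \<sigma> \<pi> p \<longrightarrow> \<pi> \<in> elts D) \<and>
     (\<forall>\<sigma>\<in>elts D. \<forall>u\<in>M. rel f \<sigma> u \<longrightarrow>
        elts u = {y \<in> M. \<exists>\<pi>\<in>elts D. \<exists>p\<in>elts G. rel \<sigma> \<pi> p \<and> rel f \<pi> y}) \<and>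
     rel f \<tau> x)"

definition definable_class :: "'a set \<Rightarrow> bool" where
  "definable_class W \<longleftrightarrow> (\<exists>\<phi> s. range s \<subseteq> M \<and> W = {x \<in> M. sat (s(0 := x)) \<phi>})"

end

subsection \<open>The Ground Axiom\<close>

text \<open>Classes are the definable ones, with parameters, as usual in ZFC.\<close>

definition inner_model :: "'a set \<Rightarrow> ('a \<Rightarrow> 'a \<Rightarrow> bool) \<Rightarrow> 'a set \<Rightarrow> bool" where
  "inner_model M E W \<longleftrightarrow> set_structure.definable_class M E W \<and>
     (\<forall>x\<in>W. set_structure.elts M E x \<subseteq> W) \<and>
     (\<forall>x. set_structure.ordinal M E x \<longrightarrow> x \<in> W) \<and>
     set_structure.ZFC W E"

definition generic_filter ::
    "'a set \<Rightarrow> ('a \<Rightarrow> 'a \<Rightarrow> bool) \<Rightarrow> 'a set \<Rightarrow> 'a \<Rightarrow> 'a \<Rightarrow> 'a \<Rightarrow> bool" where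
  "generic_filter M E W P L G \<longleftrightarrow> set_structure.filter_on M E P L G \<and>
     (\<forall>D\<in>W. set_structure.dense W E P L D \<longrightarrow>
        set_structure.elts M E D \<inter> set_structure.elts M E G \<noteq> {})"

definition generic_extension ::
    "'a set \<Rightarrow> ('a \<Rightarrow> 'a \<Rightarrow> bool) \<Rightarrow> 'a set \<Rightarrow> 'a \<Rightarrow> 'a \<Rightarrow> 'a set" where
  "generic_extension M E W P G =
     {x \<in> M. \<exists>\<tau>\<in>W. set_structure.is_name W E P \<tau> \<and> set_structure.is_val M E G \<tau> x}"

definition GA :: "'a set \<Rightarrow> ('a \<Rightarrow> 'a \<Rightarrow> bool) \<Rightarrow> bool" where
  "GA M E \<longleftrightarrow> \<not> (\<exists>W P L G. inner_model M E W \<and>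
     set_structure.forcing_notion W E P L \<and> set_structure.nontrivial W E P L \<and>
     G \<in> M \<and> generic_filter M E W P L G \<and> M = generic_extension M E W P G)"

end

theory Submission
  imports Defs
begin

text \<open>
  Suppose \<open>M = W[G]\<close> for a \<open>W\<close>-generic \<open>G \<subseteq> P\<close>. Every subset in \<open>M\<close> of a set of \<open>W\<close> has a nice name, so
  above an ordinal \<open>l\<close> that absorbs multiplication by \<open>P\<close> the models \<open>M\<close> and \<open>W\<close> have the same
  cardinals and the same cardinals satisfying GCH. Transport \<open>G\<close> along a well-ordering of \<open>P\<close> in \<open>W\<close>,
  shift it by \<open>l\<close>, and code it into the continuum function by CCA: the shift puts the
  coding cardinals above \<open>l\<close>, hence \<open>W\<close> can decode it. Thus \<open>G \<in> W\<close>, which contradicts genericity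
  when \<open>P\<close> is nontrivial.
\<close>

text \<open>\<open>(M, E)\<close> may be ill-founded when seen from outside, so induction has to be
  internal: it means Foundation applied to a set cut out by Separation. Hence every predicate and
  operation involved must be shown definable, which the calculus of \<open>dfn\<close> and
  \<open>dtm\<close> reduces to syntax-directed rules. No chain condition is available for
  \<open>P\<close>. Instead \<open>l\<close> satisfies |a x P| \<le> |a| in \<open>W\<close> for all
  ordinals a \<ge> l, so a name may use all of \<open>P\<close> at each place without affecting
  cardinals above \<open>l\<close>. The ordinal \<theta> supplied by CCA is beyond control and may
  be 0, while below \<open>l\<close> the two models may disagree on cardinals. Coding at the indices
  l + \<beta> answers this, because aleph(\<theta> + l) \<ge> l for every \<theta>. Moreover
  \<open>W\<close> may have another ordinal as its aleph of index \<theta> + l. It is handed the one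
  of \<open>M\<close> as a parameter z, which lies in \<open>W\<close> as an ordinal, and iterates
  its own cardinal successor from z on.\<close>

named_theorems dfn_intros

lemma bij_betw_iff_ball: "bij_betw F A B \<longleftrightarrow>
    (\<forall>x\<in>A. F x \<in> B) \<and> (\<forall>x\<in>A. \<forall>y\<in>A. F x = F y \<longrightarrow> x = y) \<and> (\<forall>y\<in>B. \<exists>x\<in>A. F x = y)"
proof -
  have *: "F ` A = B \<longleftrightarrow> (\<forall>x\<in>A. F x \<in> B) \<and> (\<forall>y\<in>B. \<exists>x\<in>A. F x = y)" by auto
  show ?thesis unfolding bij_betw_def inj_on_def * by (simp only: conj_ac)
qed

subsection \<open>Definability\<close>

primrec vars :: "fm \<Rightarrow> nat set" where
  "vars (Mem i j) = {i, j}"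
| "vars (Eq i j) = {i, j}"
| "vars (Neg \<phi>) = vars \<phi>"
| "vars (Conj \<phi> \<psi>) = vars \<phi> \<union> vars \<psi>"
| "vars (All i \<phi>) = insert i (vars \<phi>)"

primrec ren :: "(nat \<Rightarrow> nat) \<Rightarrow> fm \<Rightarrow> fm" where
  "ren r (Mem i j) = Mem (r i) (r j)"
| "ren r (Eq i j) = Eq (r i) (r j)"
| "ren r (Neg \<phi>) = Neg (ren r \<phi>)"
| "ren r (Conj \<phi> \<psi>) = Conj (ren r \<phi>) (ren r \<psi>)"
| "ren r (All i \<phi>) = All (r i) (ren r \<phi>)"

lemma finite_vars: "finite (vars \<phi>)"
  by (induction \<phi>) auto

text \<open>Interleaving leaves infinitely many slots for the environment and infinitely many for
  parameters, so formulas can be combined without counting the parameters of each.\<close>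

definition mix :: "(nat \<Rightarrow> 'a) \<Rightarrow> (nat \<Rightarrow> 'a) \<Rightarrow> nat \<Rightarrow> 'a" where
  "mix e p i = (if even i then e (i div 2) else p (i div 2))"

lemma range_case_nat: "range (case_nat x e) \<subseteq> M \<longleftrightarrow> x \<in> M \<and> range e \<subseteq> M"
proof
  assume a: "range (case_nat x e) \<subseteq> M"
  then have "case_nat x e 0 \<in> M" "case_nat x e (Suc n) \<in> M" for n by blast+
  then show "x \<in> M \<and> range e \<subseteq> M" by auto
next
  assume "x \<in> M \<and> range e \<subseteq> M"
  then have "case_nat x e n \<in> M" for n by (cases n) auto
  then show "range (case_nat x e) \<subseteq> M" by blast
qed

context set_structure
begin

lemma sat_cong: "(\<And>i. i \<in> vars \<phi> \<Longrightarrow> s i = s' i) \<Longrightarrow> sat s \<phi> \<longleftrightarrow> sat s' \<phi>"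
proof (induction \<phi> arbitrary: s s')
  case (All i \<phi>)
  have "sat (s(i := x)) \<phi> \<longleftrightarrow> sat (s'(i := x)) \<phi>" for x
    by (rule All.IH) (use All.prems in auto)
  then show ?case by simp
next
  case (Conj \<phi> \<psi>)
  have "sat s \<phi> \<longleftrightarrow> sat s' \<phi>" "sat s \<psi> \<longleftrightarrow> sat s' \<psi>"
    using Conj.IH[of s s'] Conj.prems by simp_all
  then show ?case by simp
next
  case (Neg \<phi>)
  have "sat s \<phi> \<longleftrightarrow> sat s' \<phi>"
    by (rule Neg.IH) (use Neg.prems in auto)
  then show ?case by simp
qed auto

text \<open>\<open>ren\<close> renames bound variables as well, so injectivity on all of
  \<open>vars \<phi>\<close> is what prevents capture.\<close>

lemma sat_ren: "inj_on r (vars \<phi>) \<Longrightarrow> sat s (ren r \<phi>) \<longleftrightarrow> sat (\<lambda>i. s (r i)) \<phi>"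
proof (induction \<phi> arbitrary: s)
  case (All i \<phi>)
  have "sat (s(r i := x)) (ren r \<phi>) \<longleftrightarrow> sat ((\<lambda>i. s (r i))(i := x)) \<phi>" for x
  proof -
    have "sat (s(r i := x)) (ren r \<phi>) \<longleftrightarrow> sat (\<lambda>j. (s(r i := x)) (r j)) \<phi>"
      by (rule All.IH) (use All.prems in auto)
    also have "\<dots> \<longleftrightarrow> sat ((\<lambda>i. s (r i))(i := x)) \<phi>"
      by (rule sat_cong) (use All.prems in \<open>auto simp: inj_on_def\<close>)
    finally show ?thesis .
  qed
  then show ?case by simp
next
  case (Conj \<phi> \<psi>)
  then show ?case by (simp add: inj_on_Un)
qed auto

text \<open>Even variables of the witnessing formula hold the environment, odd ones hold parameters.\<close>

definition dfn :: "((nat \<Rightarrow> 'a) \<Rightarrow> bool) \<Rightarrow> bool" where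
  "dfn Q \<longleftrightarrow> (\<exists>\<phi> p. range p \<subseteq> M \<and> (\<forall>e. range e \<subseteq> M \<longrightarrow> (Q e \<longleftrightarrow> sat (mix e p) \<phi>)))"

lemma dfn_cong: "dfn P \<Longrightarrow> (\<And>e. range e \<subseteq> M \<Longrightarrow> Q e \<longleftrightarrow> P e) \<Longrightarrow> dfn Q"
  unfolding dfn_def by (auto 4 3)

lemma dfn_not: "dfn Q \<Longrightarrow> dfn (\<lambda>e. \<not> Q e)"
  unfolding dfn_def by (metis sat.simps(3))

lemma dfn_conj:
  assumes "dfn P" "dfn Q"
  shows "dfn (\<lambda>e. P e \<and> Q e)"
proof -
  obtain \<phi> p where p: "range p \<subseteq> M" "\<And>e. range e \<subseteq> M \<Longrightarrow> P e \<longleftrightarrow> sat (mix e p) \<phi>"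
    using assms(1) unfolding dfn_def by blast
  obtain \<psi> q where q: "range q \<subseteq> M" "\<And>e. range e \<subseteq> M \<Longrightarrow> Q e \<longleftrightarrow> sat (mix e q) \<psi>"
    using assms(2) unfolding dfn_def by blast
  \<comment> \<open>The parameters of both formulas are interleaved once more: parameter k, which is
    variable 2k+1, moves to variable 4k+1 for \<open>\<phi>\<close> and to 4k+3 for
    \<open>\<psi>\<close>. Environment variables stay fixed.\<close>
  define r1 where "r1 i = (if even i then i else 2 * (i - 1) + 1)" for i :: nat
  define r2 where "r2 i = (if even i then i else 2 * i + 1)" for i :: nat
  have inj: "inj_on r1 (vars \<phi>)" "inj_on r2 (vars \<psi>)"
    by (auto simp: inj_on_def r1_def r2_def elim!: oddE split: if_splits)
  have 1: "(\<lambda>i. mix e (mix p q) (r1 i)) = mix e p" for e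
    by (rule ext) (auto simp: mix_def r1_def elim!: oddE)
  have 2: "(\<lambda>i. mix e (mix p q) (r2 i)) = mix e q" for e
    by (rule ext) (auto simp: mix_def r2_def elim!: oddE)
  have "sat (mix e (mix p q)) (Conj (ren r1 \<phi>) (ren r2 \<psi>)) \<longleftrightarrow> P e \<and> Q e" if "range e \<subseteq> M" for e
    using that p q by (simp add: sat_ren inj 1 2)
  moreover have "range (mix p q) \<subseteq> M"
    using p q by (auto simp: mix_def)
  ultimately show ?thesis unfolding dfn_def by blast
qed

lemma dfn_all:
  assumes "dfn (\<lambda>e. Q (e 0) (\<lambda>n. e (Suc n)))"
  shows "dfn (\<lambda>e. \<forall>x\<in>M. Q x e)"
proof -
  obtain \<phi> p where p: "range p \<subseteq> M"
    "\<And>e. range e \<subseteq> M \<Longrightarrow> Q (e 0) (\<lambda>n. e (Suc n)) \<longleftrightarrow> sat (mix e p) \<phi>"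
    using assms unfolding dfn_def by blast
  obtain N0 where N0: "vars \<phi> \<subseteq> {..<N0}"
    using bounded_nat_set_is_finite finite_vars finite_nat_set_iff_bounded by (metis lessThan_iff subsetI)
  \<comment> \<open>\<open>N\<close> becomes the bound variable. It is odd, hence distinct from the
    shifted environment variables, and exceeds all variables of \<open>\<phi>\<close>, hence is
    distinct from the parameters in use.\<close>
  define N where "N = 2 * N0 + 1"
  have N: "odd N" "\<And>i. i \<in> vars \<phi> \<Longrightarrow> i < N"
    using N0 by (auto simp: N_def)
  define r where "r i = (if odd i then i else if i = 0 then N else i - 2)" for i
  have r: "inj_on r (vars \<phi>)"
    using N by (auto simp: inj_on_def r_def split: if_splits dest!: N(2)) presburger+
  have "sat (mix e p) (All N (ren r \<phi>)) \<longleftrightarrow> (\<forall>x\<in>M. Q x e)" if e: "range e \<subseteq> M" for e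
  proof -
    have "sat ((mix e p)(N := x)) (ren r \<phi>) \<longleftrightarrow> Q x e" if x: "x \<in> M" for x
    proof -
      have "sat ((mix e p)(N := x)) (ren r \<phi>) \<longleftrightarrow> sat (\<lambda>i. ((mix e p)(N := x)) (r i)) \<phi>"
        by (rule sat_ren[OF r])
      also have "\<dots> \<longleftrightarrow> sat (mix (case_nat x e) p) \<phi>"
      proof (rule sat_cong)
        fix i assume "i \<in> vars \<phi>"
        then have "i < N" using N by blast
        then show "((mix e p)(N := x)) (r i) = mix (case_nat x e) p i"
          using N(1) by (cases "odd i"; cases i) (auto simp: mix_def r_def elim!: evenE oddE split: nat.splits)
      qed
      also have "\<dots> \<longleftrightarrow> Q x e"
        using p(2)[of "case_nat x e"] e x by (simp add: range_case_nat)
      finally show ?thesis .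
    qed
    then show ?thesis by simp
  qed
  then show ?thesis using p(1) unfolding dfn_def by blast
qed

lemma dfn_const: assumes "M \<noteq> {}" shows "dfn (\<lambda>e. b)"
proof -
  obtain c where c: "c \<in> M" using assms by blast
  have "dfn (\<lambda>e. True)"
    unfolding dfn_def by (rule exI[of _ "Eq 0 0"], rule exI[of _ "\<lambda>_. c"]) (use c in auto)
  then show ?thesis by (cases b) (auto dest: dfn_not)
qed

definition svar :: "((nat \<Rightarrow> 'a) \<Rightarrow> 'a) \<Rightarrow> bool" where
  "svar t \<longleftrightarrow> (\<exists>i. t = (\<lambda>e. e i)) \<or> (\<exists>c\<in>M. t = (\<lambda>e. c))"

lemma svar_var: "svar (\<lambda>e. e i)" and svar_const: "c \<in> M \<Longrightarrow> svar (\<lambda>e. c)"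
  by (auto simp: svar_def)

lemma svar_mix:
  assumes "svar t" "M \<noteq> {}"
  obtains i c where "c \<in> M" "\<And>e p. p k = c \<Longrightarrow> t e = mix e p i"
proof -
  obtain c where c: "c \<in> M" using assms by blast
  from assms(1) consider j where "t = (\<lambda>e. e j)" | d where "d \<in> M" "t = (\<lambda>e. d)"
    unfolding svar_def by blast
  then show ?thesis
  proof cases
    case (1 j)
    then show ?thesis by (intro that[of c "2 * j"]) (auto simp: mix_def c)
  next
    case (2 d)
    then show ?thesis by (intro that[of d "2 * k + 1"]) (auto simp: mix_def)
  qed
qed

lemma dfn_svar:
  assumes "svar t" "svar u" "M \<noteq> {}"
  shows "dfn (\<lambda>e. E (t e) (u e))" "dfn (\<lambda>e. t e = u e)"
proof -
  obtain i c where i: "c \<in> M" "\<And>e p. p 0 = c \<Longrightarrow> t e = mix e p i"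
    using svar_mix[OF assms(1,3), of 0] by metis
  obtain j d where j: "d \<in> M" "\<And>e p. p (Suc 0) = d \<Longrightarrow> u e = mix e p j"
    using svar_mix[OF assms(2,3), of "Suc 0"] by metis
  define p where "p = (case_nat c (\<lambda>_. d))"
  have p: "range p \<subseteq> M" "\<And>e. t e = mix e p i" "\<And>e. u e = mix e p j"
    using i(1) j(1) i(2)[of p] j(2)[of p] by (auto simp: p_def range_case_nat)
  show "dfn (\<lambda>e. E (t e) (u e))"
    unfolding dfn_def by (rule exI[of _ "Mem i j"], rule exI[of _ p]) (simp add: p)
  show "dfn (\<lambda>e. t e = u e)"
    unfolding dfn_def by (rule exI[of _ "Eq i j"], rule exI[of _ p]) (simp add: p)
qed

text \<open>Closure under simultaneous substitution of variables and constants: constants turn into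
  parameters, and under a quantifier the substituted terms are shifted by one slot to make room for
  the bound value.\<close>

lemma dfn_sat:
  assumes "M \<noteq> {}" "\<And>i. svar (\<tau> i)"
  shows "dfn (\<lambda>e. sat (\<lambda>i. \<tau> i e) \<phi>)"
  using assms(2)
proof (induction \<phi> arbitrary: \<tau>)
  case (All i \<phi>)
  have "dfn (\<lambda>e. sat ((\<lambda>j. \<tau> j (\<lambda>n. e (Suc n)))(i := e 0)) \<phi>)"
  proof -
    define \<tau>' where "\<tau>' j = (if j = i then (\<lambda>e. e 0) else (\<lambda>e. \<tau> j (\<lambda>n. e (Suc n))))" for j
    have "svar (\<tau>' j)" for j
      using All.prems[of j] by (auto simp: svar_def \<tau>'_def)
    moreover have "(\<lambda>j. \<tau>' j e) = (\<lambda>j. \<tau> j (\<lambda>n. e (Suc n)))(i := e 0)" for e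
      by (auto simp: \<tau>'_def)
    ultimately show ?thesis using All.IH[of \<tau>'] by simp
  qed
  then show ?case by (simp add: dfn_all)
next
  case (Conj \<phi> \<psi>)
  then show ?case by (simp add: dfn_conj)
qed (simp_all add: dfn_svar assms(1) dfn_not)

lemma dfn_subst:
  assumes "M \<noteq> {}" "dfn Q" "\<And>i. svar (\<sigma> i)"
  shows "dfn (\<lambda>e. Q (\<lambda>i. \<sigma> i e))"
proof -
  obtain \<phi> p where p: "range p \<subseteq> M" "\<And>e. range e \<subseteq> M \<Longrightarrow> Q e \<longleftrightarrow> sat (mix e p) \<phi>"
    using assms(2) unfolding dfn_def by blast
  define \<tau> where "\<tau> i = (if even i then \<sigma> (i div 2) else (\<lambda>e. p (i div 2)))" for i
  have "svar (\<tau> i)" for i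
    using assms(3) p by (auto simp: \<tau>_def intro!: svar_const)
  then have d: "dfn (\<lambda>e. sat (\<lambda>i. \<tau> i e) \<phi>)"
    by (rule dfn_sat[OF assms(1)])
  have eq: "(\<lambda>i. \<tau> i e) = mix (\<lambda>i. \<sigma> i e) p" for e
    by (auto simp: \<tau>_def mix_def)
  show ?thesis
  proof (rule dfn_cong[OF d])
    fix e :: "nat \<Rightarrow> 'a" assume e: "range e \<subseteq> M"
    have "\<sigma> i e \<in> M" for i
      using assms(3)[of i] e by (auto simp: svar_def)
    then show "Q (\<lambda>i. \<sigma> i e) \<longleftrightarrow> sat (\<lambda>i. \<tau> i e) \<phi>"
      using p(2)[of "\<lambda>i. \<sigma> i e"] by (auto simp: eq)
  qed
qed

end

section \<open>Definable operations and comprehension terms in a model of ZFC\<close>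

locale zfc_model = set_structure +
  assumes ZFC: ZFC
begin

lemma nonempty: "M \<noteq> {}"
  using ZFC unfolding ZFC_def infinity_def by blast

text \<open>Environments play the role of de Bruijn contexts, so that all the closure rules below can be
  applied by higher-order pattern unification.\<close>

definition dtm :: "((nat \<Rightarrow> 'a) \<Rightarrow> 'a) \<Rightarrow> bool" where
  "dtm t \<longleftrightarrow> (\<forall>e. range e \<subseteq> M \<longrightarrow> t e \<in> M) \<and> dfn (\<lambda>e. e 0 = t (\<lambda>n. e (Suc n)))"

lemma dtm_in: "dtm t \<Longrightarrow> range e \<subseteq> M \<Longrightarrow> t e \<in> M"
  unfolding dtm_def by blast

lemma dtm_in1: "dtm (\<lambda>e. F (e 0)) \<Longrightarrow> x \<in> M \<Longrightarrow> F x \<in> M"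
  using dtm_in[of "\<lambda>e. F (e 0)" "\<lambda>_. x"] by auto

lemma dtm_in2: "dtm (\<lambda>e. F (e 0) (e 1)) \<Longrightarrow> x \<in> M \<Longrightarrow> y \<in> M \<Longrightarrow> F x y \<in> M"
  using dtm_in[of "\<lambda>e. F (e 0) (e 1)" "case_nat x (\<lambda>_. y)"] by (auto simp: range_case_nat)

lemma dtm_svar: "svar t \<Longrightarrow> dtm t"
proof -
  assume t: "svar t"
  then have "svar (\<lambda>e. t (\<lambda>n. e (Suc n)))" "svar (\<lambda>e. e 0)"
    unfolding svar_def by auto
  then have "dfn (\<lambda>e. e 0 = t (\<lambda>n. e (Suc n)))"
    using dfn_svar(2) nonempty by blast
  with t show ?thesis unfolding dtm_def svar_def by auto
qed

lemma dtm_var: "dtm (\<lambda>e. e i)" and dtm_const: "c \<in> M \<Longrightarrow> dtm (\<lambda>e. c)"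
  by (auto intro!: dtm_svar simp: svar_def)

lemma dfn_ex: "dfn (\<lambda>e. Q (e 0) (\<lambda>n. e (Suc n))) \<Longrightarrow> dfn (\<lambda>e. \<exists>x\<in>M. Q x e)"
  using dfn_not[OF dfn_all[of "\<lambda>x e. \<not> Q x e"]] dfn_not[of "\<lambda>e. Q (e 0) (\<lambda>n. e (Suc n))"] by simp

lemma dfn_disj: "dfn P \<Longrightarrow> dfn Q \<Longrightarrow> dfn (\<lambda>e. P e \<or> Q e)"
  by (rule dfn_cong[OF dfn_not[OF dfn_conj[OF dfn_not dfn_not]]]) auto

lemma dfn_imp: "dfn P \<Longrightarrow> dfn Q \<Longrightarrow> dfn (\<lambda>e. P e \<longrightarrow> Q e)"
  by (rule dfn_cong[OF dfn_disj[OF dfn_not]]) auto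

lemma dfn_iff: "dfn P \<Longrightarrow> dfn Q \<Longrightarrow> dfn (\<lambda>e. P e \<longleftrightarrow> Q e)"
  by (rule dfn_cong[OF dfn_conj[OF dfn_imp[of P Q] dfn_imp[of Q P]]]) auto

lemma dfn_shift: "dfn Q \<Longrightarrow> dfn (\<lambda>e. Q (\<lambda>n. e (Suc n)))"
  by (rule dfn_subst[OF nonempty]) (auto simp: svar_def)

text \<open>Weakening just below the top slot: \<open>Q\<close> is reused where one more variable
  has been bound between its argument and its context, as in statements of uniqueness.\<close>

lemma dfn_shift1:
  assumes "dfn (\<lambda>e. Q (e 0) (\<lambda>n. e (Suc n)))"
  shows "dfn (\<lambda>e. Q (e 0) (\<lambda>n. e (Suc (Suc n))))"
proof -
  define \<sigma> where "\<sigma> i = (\<lambda>e::nat\<Rightarrow>'a. if i = 0 then e 0 else e (Suc i))" for i :: nat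
  have "svar (\<sigma> i)" for i
    by (cases "i = 0") (auto simp: svar_def \<sigma>_def)
  then have "dfn (\<lambda>e. Q (\<sigma> 0 e) (\<lambda>n. \<sigma> (Suc n) e))"
    using dfn_subst[OF nonempty assms, of \<sigma>] by blast
  then show ?thesis by (simp add: \<sigma>_def)
qed

lemma dtm_shift: "dtm t \<Longrightarrow> dtm (\<lambda>e. t (\<lambda>n. e (Suc n)))"
proof -
  assume t: "dtm t"
  define \<sigma> where "\<sigma> i = (\<lambda>e::nat\<Rightarrow>'a. if i = 0 then e 0 else e (Suc i))" for i :: nat
  have "svar (\<sigma> i)" for i
    by (cases "i = 0") (auto simp: svar_def \<sigma>_def)
  then have "dfn (\<lambda>e. \<sigma> 0 e = t (\<lambda>n. \<sigma> (Suc n) e))"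
    using dfn_subst[OF nonempty, of "\<lambda>e. e 0 = t (\<lambda>n. e (Suc n))" \<sigma>] t unfolding dtm_def by blast
  then have "dfn (\<lambda>e. e 0 = t (\<lambda>n. e (Suc (Suc n))))"
    by (simp add: \<sigma>_def)
  moreover have "t (\<lambda>n. e (Suc n)) \<in> M" if "range e \<subseteq> M" for e
    using that by (intro dtm_in[OF t]) auto
  ultimately show ?thesis unfolding dtm_def by simp
qed

text \<open>The language has no function symbols. A term is eliminated by quantifying over its
  value, which \<open>dtm\<close> places in \<open>M\<close> and whose graph it makes
  definable.\<close>

lemma dfn_let:
  assumes "dtm t" "dfn (\<lambda>e. Q (e 0) (\<lambda>n. e (Suc n)))"
  shows "dfn (\<lambda>e. Q (t e) e)"
proof -
  have "dfn (\<lambda>e. \<exists>x\<in>M. x = t e \<and> Q x e)"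
    by (rule dfn_ex, rule dfn_conj) (use assms in \<open>auto simp: dtm_def\<close>)
  then show ?thesis
    by (rule dfn_cong) (use assms in \<open>auto dest: dtm_in\<close>)
qed

lemma dfn_comp1:
  assumes "dfn (\<lambda>e. R (e 0))" "dtm t"
  shows "dfn (\<lambda>e. R (t e))"
proof (rule dfn_let[OF assms(2)])
  have "dfn (\<lambda>e. R ((\<lambda>i. e 0) (0::nat)))"
    by (rule dfn_subst[OF nonempty assms(1), of "\<lambda>i e. e 0"]) (auto simp: svar_def)
  then show "dfn (\<lambda>e. R (e 0))" by simp
qed

lemma dfn_comp2:
  assumes "dfn (\<lambda>e. R (e 0) (e 1))" "dtm t" "dtm u"
  shows "dfn (\<lambda>e. R (t e) (u e))"
proof (rule dfn_let[OF assms(2)], rule dfn_let[OF dtm_shift[OF assms(3)]])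
  \<comment> \<open>The value bound last sits in slot 0, so the arguments appear in reverse
    order.\<close>
  have "dfn (\<lambda>e. R ((\<lambda>i. e (1 - i)) 0) ((\<lambda>i. e (1 - i)) (1::nat)))"
    by (rule dfn_subst[OF nonempty assms(1), of "\<lambda>i e. e (1 - i)"]) (rule svar_var)
  then show "dfn (\<lambda>e. R (e (Suc 0)) (e 0))" by simp
qed

lemma dfn_comp3:
  assumes "dfn (\<lambda>e. R (e 0) (e 1) (e 2))" "dtm t" "dtm u" "dtm v"
  shows "dfn (\<lambda>e. R (t e) (u e) (v e))"
proof (rule dfn_let[OF assms(2)], rule dfn_let[OF dtm_shift[OF assms(3)]],
    rule dfn_let[OF dtm_shift[OF dtm_shift[OF assms(4)]]])
  have "dfn (\<lambda>e. R ((\<lambda>i. e (2 - i)) 0) ((\<lambda>i. e (2 - i)) 1) ((\<lambda>i. e (2 - i)) (2::nat)))"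
    by (rule dfn_subst[OF nonempty assms(1), of "\<lambda>i e. e (2 - i)"]) (rule svar_var)
  then show "dfn (\<lambda>e. R (e (Suc (Suc 0))) (e (Suc 0)) (e 0))" by (simp add: numeral_2_eq_2)
qed

lemma dfn_eq: "dtm t \<Longrightarrow> dtm u \<Longrightarrow> dfn (\<lambda>e. t e = u e)"
  by (rule dfn_comp2) (auto intro!: dfn_svar nonempty simp: svar_def)

lemma dfn_E: "dtm t \<Longrightarrow> dtm u \<Longrightarrow> dfn (\<lambda>e. E (t e) (u e))"
  by (rule dfn_comp2) (auto intro!: dfn_svar nonempty simp: svar_def)

lemma dfn_elts: "dtm t \<Longrightarrow> dtm u \<Longrightarrow> dfn (\<lambda>e. t e \<in> elts (u e))"
  by (rule dfn_cong[OF dfn_E[of t u]]) (auto simp: elts_def dtm_in)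

lemma elts_M: "x \<in> elts y \<Longrightarrow> x \<in> M"
  by (simp add: elts_def)

lemma dfn_M: "dtm t \<Longrightarrow> dfn (\<lambda>e. t e \<in> M)"
  by (rule dfn_cong[OF dfn_const[OF nonempty, of True]]) (auto dest: dtm_in)

lemma dfn_ball:
  assumes "dtm t" "dfn (\<lambda>e. Q (e 0) (\<lambda>n. e (Suc n)))"
  shows "dfn (\<lambda>e. \<forall>x\<in>elts (t e). Q x e)"
proof -
  have "dfn (\<lambda>e. \<forall>x\<in>M. x \<in> elts (t e) \<longrightarrow> Q x e)"
    by (rule dfn_all, rule dfn_imp, rule dfn_elts)
      (use assms in \<open>auto intro: dtm_var dtm_shift\<close>)
  then show ?thesis by (rule dfn_cong) (auto dest: elts_M)
qed

lemma dfn_bex: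
  assumes "dtm t" "dfn (\<lambda>e. Q (e 0) (\<lambda>n. e (Suc n)))"
  shows "dfn (\<lambda>e. \<exists>x\<in>elts (t e). Q x e)"
  using dfn_not[OF dfn_ball[OF assms(1), of "\<lambda>x e. \<not> Q x e"]] dfn_not[OF assms(2)] by simp

lemma empty_ex: "\<exists>c. c \<in> M \<and> elts c = {}"
  using ZFC elts_M unfolding ZFC_def infinity_def by blast

text \<open>The default value is the empty set, so that it is the same in transitive submodels.\<close>

definition the1 :: "('a \<Rightarrow> bool) \<Rightarrow> 'a" where
  "the1 Q = (if \<exists>!y. y \<in> M \<and> Q y then THE y. y \<in> M \<and> Q y else SOME c. c \<in> M \<and> elts c = {})"

lemma the1_in: "the1 Q \<in> M"
proof (cases "\<exists>!y. y \<in> M \<and> Q y")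
  case True
  then show ?thesis using theI'[OF True] by (simp add: the1_def)
next
  case False
  then show ?thesis unfolding the1_def if_not_P[OF False] using someI_ex[OF empty_ex] by blast
qed

lemma the1_eq: "y \<in> M \<Longrightarrow> Q y \<Longrightarrow> (\<And>z. z \<in> M \<Longrightarrow> Q z \<Longrightarrow> z = y) \<Longrightarrow> the1 Q = y"
proof -
  assume a: "y \<in> M" "Q y" "\<And>z. z \<in> M \<Longrightarrow> Q z \<Longrightarrow> z = y"
  then have "\<exists>!y. y \<in> M \<and> Q y" by blast
  moreover have "(THE y. y \<in> M \<and> Q y) = y" using a by blast
  ultimately show ?thesis by (simp add: the1_def)
qed

lemma dtm_the1:
  assumes "dfn (\<lambda>e. Q (e 0) (\<lambda>n. e (Suc n)))"
  shows "dtm (\<lambda>e. the1 (\<lambda>y. Q y e))"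
proof -
  define c where "c = (SOME c. c \<in> M \<and> elts c = {})"
  then have c: "c = (SOME c. c \<in> M \<and> elts c = {})" "c \<in> M" using someI_ex[OF empty_ex] by blast+
  define U where "U e = (\<exists>y\<in>M. Q y e \<and> (\<forall>z\<in>M. Q z e \<longrightarrow> z = y))" for e
  have Q1: "dfn (\<lambda>e. Q (e 0) (\<lambda>n. e (Suc (Suc n))))"
    by (rule dfn_shift1[OF assms])
  have U: "dfn U" unfolding U_def
    by (intro dfn_ex dfn_conj dfn_all dfn_imp dfn_eq dtm_var assms Q1)
  have "dfn (\<lambda>e. (U (\<lambda>n. e (Suc n)) \<and> Q (e 0) (\<lambda>n. e (Suc n))) \<or> (\<not> U (\<lambda>n. e (Suc n)) \<and> e 0 = c))"
    by (intro dfn_disj dfn_conj dfn_not dfn_eq dfn_shift[OF U] dtm_var dtm_const c assms)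
  then have "dfn (\<lambda>e. e 0 = the1 (\<lambda>y. Q y (\<lambda>n. e (Suc n))))"
  proof (rule dfn_cong)
    fix e :: "nat \<Rightarrow> 'a" assume e: "range e \<subseteq> M"
    let ?e = "\<lambda>n. e (Suc n)"
    show "(e 0 = the1 (\<lambda>y. Q y ?e)) = ((U ?e \<and> Q (e 0) ?e) \<or> (\<not> U ?e \<and> e 0 = c))"
    proof (cases "U ?e")
      case True
      then obtain y where y: "y \<in> M" "Q y ?e" "\<And>z. z \<in> M \<Longrightarrow> Q z ?e \<Longrightarrow> z = y"
        unfolding U_def by blast
      then have t: "the1 (\<lambda>y. Q y ?e) = y" by (intro the1_eq)
      have "e 0 \<in> M" using e by blast
      then have "e 0 = y \<longleftrightarrow> Q (e 0) ?e" using y by metis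
      then show ?thesis unfolding t using True by blast
    next
      case False
      then have "\<not> (\<exists>!y. y \<in> M \<and> Q y ?e)" unfolding U_def by blast
      then show ?thesis using False c unfolding the1_def by simp
    qed
  qed
  then show ?thesis by (simp add: dtm_def the1_in)
qed

text \<open>A total operation: if no element of the model has exactly these elements, the value is
  the default of \<open>the1\<close>, the empty set. Terms built with \<open>mk\<close> are thus
  definable before anything is known about set existence; smallness enters only through
  \<open>elts_mk\<close>.\<close>

definition mk :: "'a set \<Rightarrow> 'a" where
  "mk X = the1 (\<lambda>b. elts b = X \<inter> M)"

definition small :: "'a set \<Rightarrow> bool" where
  "small X \<longleftrightarrow> (\<exists>b\<in>M. elts b = X)"

lemma elts_ext: "x \<in> M \<Longrightarrow> y \<in> M \<Longrightarrow> elts x = elts y \<Longrightarrow> x = y"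
  using ZFC unfolding ZFC_def extensionality_def by blast

lemma mk_in [simp]: "mk X \<in> M"
  unfolding mk_def by (rule the1_in)

lemma mk_eq: "x \<in> M \<Longrightarrow> elts x = X \<Longrightarrow> mk X = x"
  unfolding mk_def by (rule the1_eq) (auto intro: elts_ext dest: elts_M)

lemma mk_elts [simp]: "x \<in> M \<Longrightarrow> mk (elts x) = x"
  by (simp add: mk_eq)

lemma elts_mk: "small X \<Longrightarrow> elts (mk X) = X"
  by (auto simp: small_def)

lemma small_elts [simp]: "x \<in> M \<Longrightarrow> small (elts x)"
  unfolding small_def by blast

lemma small_M: "small X \<Longrightarrow> X \<subseteq> M"
  unfolding small_def elts_def by blast

lemma dtm_mk:
  assumes "dfn (\<lambda>e. e 0 \<in> X (\<lambda>n. e (Suc n)))"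
  shows "dtm (\<lambda>e. mk (X e))"
proof -
  have "dfn (\<lambda>e. elts (e 0) = X (\<lambda>n. e (Suc n)) \<inter> M)"
  proof (rule dfn_cong)
    have "dfn (\<lambda>e. e 0 \<in> X (\<lambda>n. e (Suc (Suc n))))"
      by (rule dfn_shift1[where Q = "\<lambda>x e. x \<in> X e", OF assms])
    then show "dfn (\<lambda>e. \<forall>x\<in>M. x \<in> elts (e 0) \<longleftrightarrow> x \<in> X (\<lambda>n. e (Suc n)))"
      by (intro dfn_all dfn_iff dfn_elts dtm_var)
  qed (auto dest: elts_M)
  then show ?thesis unfolding mk_def by (rule dtm_the1)
qed

lemma dtm_comp1:
  assumes "dtm (\<lambda>e. f (e 0))" "dtm t"
  shows "dtm (\<lambda>e. f (t e))"
proof -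
  have "dfn (\<lambda>e. e 0 = f (e 1))"
    using assms(1) by (simp add: dtm_def)
  then have "dfn (\<lambda>e. e 0 = f (t (\<lambda>n. e (Suc n))))"
    by (rule dfn_comp2[where R = "\<lambda>x y. x = f y"]) (auto intro: dtm_var dtm_shift assms)
  then show ?thesis using dtm_in1[OF assms(1)] dtm_in[OF assms(2)] unfolding dtm_def by blast
qed

lemma dtm_comp2:
  assumes "dtm (\<lambda>e. f (e 0) (e 1))" "dtm t" "dtm u"
  shows "dtm (\<lambda>e. f (t e) (u e))"
proof -
  have "dfn (\<lambda>e. e 0 = f (e 1) (e 2))"
    using assms(1) by (simp add: dtm_def numeral_2_eq_2)
  then have "dfn (\<lambda>e. e 0 = f (t (\<lambda>n. e (Suc n))) (u (\<lambda>n. e (Suc n))))"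
    by (rule dfn_comp3[where R = "\<lambda>x y z. x = f y z"]) (auto intro: dtm_var dtm_shift assms)
  then show ?thesis using dtm_in2[OF assms(1)] dtm_in[OF assms(2)] dtm_in[OF assms(3)]
    unfolding dtm_def by blast
qed

lemma dtm_if:
  assumes "dfn P" "dtm t" "dtm u"
  shows "dtm (\<lambda>e. if P e then t e else u e)"
proof -
  have "dfn (\<lambda>e. (P (\<lambda>n. e (Suc n)) \<and> e 0 = t (\<lambda>n. e (Suc n))) \<or>
      (\<not> P (\<lambda>n. e (Suc n)) \<and> e 0 = u (\<lambda>n. e (Suc n))))"
    by (intro dfn_disj dfn_conj dfn_not dfn_eq dtm_var dtm_shift dfn_shift assms)
  then have "dfn (\<lambda>e. e 0 = (if P (\<lambda>n. e (Suc n)) then t (\<lambda>n. e (Suc n)) else u (\<lambda>n. e (Suc n))))"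
    by (rule dfn_cong) auto
  then show ?thesis using assms(2,3) unfolding dtm_def by auto
qed

lemma small_sep:
  assumes "small X" "dfn (\<lambda>e. Q (e 0))"
  shows "small {x \<in> X. Q x}"
proof -
  obtain \<phi> p where p: "range p \<subseteq> M" "\<And>e. range e \<subseteq> M \<Longrightarrow> Q (e 0) \<longleftrightarrow> sat (mix e p) \<phi>"
    using assms(2) unfolding dfn_def by blast
  obtain c where c: "c \<in> M" using nonempty by blast
  obtain a where a: "a \<in> M" "elts a = X" using assms unfolding small_def by blast
  define s where "s = mix (\<lambda>_. c) p"
  have "range s \<subseteq> M" using p c by (auto simp: s_def mix_def)
  then obtain b where b: "b \<in> M" "elts b = {x \<in> elts a. sat (s(0 := x)) \<phi>}"
    using ZFC a(1) unfolding ZFC_def separation_def by blast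
  have "sat (s(0 := x)) \<phi> \<longleftrightarrow> Q x" if "x \<in> M" for x
  proof -
    have "s(0 := x) = mix (case_nat x (\<lambda>_. c)) p"
      by (rule ext) (auto simp: s_def mix_def split: nat.splits elim!: evenE)
    then show ?thesis using p(2)[of "case_nat x (\<lambda>_. c)"] that c by (auto simp: range_case_nat)
  qed
  then show ?thesis using a b unfolding small_def by (auto dest: elts_M intro!: bexI[of _ b])
qed

lemma small_image:
  assumes "small X" "dtm (\<lambda>e. F (e 0))"
  shows "small (F ` X)"
proof -
  have "dfn (\<lambda>e. e 1 = F (e 0))"
    by (intro dfn_eq dtm_var assms(2))
  then obtain \<phi> p where p: "range p \<subseteq> M" "\<And>e. range e \<subseteq> M \<Longrightarrow> e 1 = F (e 0) \<longleftrightarrow> sat (mix e p) \<phi>"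
    unfolding dfn_def by blast
  obtain c where c: "c \<in> M" using nonempty by blast
  obtain a where a: "a \<in> M" "elts a = X" using assms unfolding small_def by blast
  \<comment> \<open>Replacement reads the result from variable 1, which \<open>mix\<close> reserves
    for a parameter. The swap puts there environment slot 1, that is variable 2.\<close>
  define r :: "nat \<Rightarrow> nat" where "r = id(1 := 2, 2 := 1)"
  define s where "s = (\<lambda>i. mix (\<lambda>_. c) p (r i))"
  have r: "inj_on r (vars \<phi>)" by (auto simp: r_def inj_on_def)
  have "range s \<subseteq> M" using p c by (auto simp: s_def mix_def)
  moreover have sat: "sat (s(0 := x, 1 := y)) (ren r \<phi>) \<longleftrightarrow> y = F x" if "x \<in> M" "y \<in> M" for x y
  proof -
    let ?e = "case_nat x (case_nat y (\<lambda>_. c))"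
    have "(\<lambda>i. (s(0 := x, 1 := y)) (r i)) = mix ?e p"
      by (rule ext) (auto simp: s_def mix_def r_def split: nat.splits elim!: evenE)
    then show ?thesis using p(2)[of ?e] that c by (auto simp: sat_ren[OF r] range_case_nat)
  qed
  moreover have "\<forall>x\<in>elts a. \<exists>!y. y \<in> M \<and> sat (s(0 := x, 1 := y)) (ren r \<phi>)"
  proof
    fix x assume "x \<in> elts a"
    then have x: "x \<in> M" by (rule elts_M)
    show "\<exists>!y. y \<in> M \<and> sat (s(0 := x, 1 := y)) (ren r \<phi>)"
      using sat[OF x] dtm_in1[OF assms(2) x] by (intro ex1I[of _ "F x"]) auto
  qed
  moreover have replacement using ZFC unfolding ZFC_def by blast
  ultimately have "\<exists>b\<in>M. elts b = {y \<in> M. \<exists>x\<in>elts a. sat (s(0 := x, 1 := y)) (ren r \<phi>)}"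
    using a(1) unfolding replacement_def by simp
  then obtain b where b: "b \<in> M"
    "elts b = {y \<in> M. \<exists>x\<in>elts a. sat (s(0 := x, 1 := y)) (ren r \<phi>)}"
    by blast
  note b(2)
  also have "\<dots> = F ` X"
  proof -
    have "sat (s(0 := x, 1 := y)) (ren r \<phi>) \<longleftrightarrow> y = F x" if "x \<in> X" "y \<in> M" for x y
      using sat that a by (blast dest: elts_M)
    then have "{y \<in> M. \<exists>x\<in>elts a. sat (s(0 := x, 1 := y)) (ren r \<phi>)} = {y \<in> M. \<exists>x\<in>X. y = F x}"
      using a(2) by (intro Collect_cong) blast
    also have "\<dots> = F ` X" using a dtm_in1[OF assms(2)] by (auto dest: elts_M)
    finally show ?thesis .
  qed
  finally show ?thesis using b(1) unfolding small_def by blast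
qed

lemmas [dfn_intros] = dfn_not dfn_conj dfn_disj dfn_imp dfn_iff dfn_all dfn_ex dfn_ball dfn_bex
  dfn_eq dfn_elts dfn_M dfn_const[OF nonempty] dtm_var dtm_const dtm_if dtm_the1 dtm_mk

lemma dfn_Collect [dfn_intros]: "dfn (\<lambda>e. P (t e) e) \<Longrightarrow> dfn (\<lambda>e. t e \<in> {x. P x e})"
  by simp

lemma dfn_Un [dfn_intros]: "dfn (\<lambda>e. t e \<in> A e) \<Longrightarrow> dfn (\<lambda>e. t e \<in> B e) \<Longrightarrow> dfn (\<lambda>e. t e \<in> A e \<union> B e)"
  by (simp add: dfn_disj)

lemma dfn_insert [dfn_intros]: "dfn (\<lambda>e. t e = u e) \<Longrightarrow> dfn (\<lambda>e. t e \<in> B e) \<Longrightarrow> dfn (\<lambda>e. t e \<in> insert (u e) (B e))"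
  by (simp add: dfn_disj)

lemma dfn_empty [dfn_intros]: "dfn (\<lambda>e. t e \<in> {})"
  by (simp add: dfn_const[OF nonempty])

lemma dfn_UN [dfn_intros]:
  "dfn (\<lambda>e. \<exists>x\<in>elts (u e). t e \<in> F x e) \<Longrightarrow> dfn (\<lambda>e. t e \<in> (\<Union>x\<in>elts (u e). F x e))"
  by simp

lemma dfn_image [dfn_intros]:
  "dfn (\<lambda>e. \<exists>x\<in>elts (u e). t e = F x e) \<Longrightarrow> dfn (\<lambda>e. t e \<in> (\<lambda>x. F x e) ` elts (u e))"
  by (simp add: image_iff)

lemma dfn_subset [dfn_intros]:
  assumes "dtm t" "dtm u"
  shows "dfn (\<lambda>e. elts (t e) \<subseteq> elts (u e))"
proof (rule dfn_cong)
  show "dfn (\<lambda>e. \<forall>x\<in>elts (t e). x \<in> elts (u e))"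
    by (intro dfn_intros dtm_shift assms)
qed auto

lemma dfn_eq_empty [dfn_intros]:
  assumes "dtm t"
  shows "dfn (\<lambda>e. elts (t e) = {})"
proof (rule dfn_cong)
  show "dfn (\<lambda>e. \<forall>x\<in>elts (t e). False)"
    by (intro dfn_intros dtm_shift assms)
qed auto

subsection \<open>Small classes\<close>

lemma small_empty [simp]: "small {}"
proof -
  obtain c where "c \<in> M" using nonempty by blast
  then have "small {x \<in> elts c. False}"
    by (intro small_sep dfn_intros) auto
  then show ?thesis by simp
qed

lemma small_pair: "x \<in> M \<Longrightarrow> y \<in> M \<Longrightarrow> small {x, y}"
  using ZFC unfolding ZFC_def pairing_def small_def by blast

lemma small_single: "x \<in> M \<Longrightarrow> small {x}"
  using small_pair[of x x] by simp

lemma small_Union_elts: "small X \<Longrightarrow> small (\<Union>y\<in>X. elts y)"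
  using ZFC unfolding ZFC_def union_def small_def by blast

lemma small_UN: "small X \<Longrightarrow> dtm (\<lambda>e. F (e 0)) \<Longrightarrow> small (\<Union>x\<in>X. elts (F x))"
  using small_Union_elts[OF small_image] by simp

lemma small_Un: assumes "small X" "small Y" shows "small (X \<union> Y)"
proof -
  obtain x y where "x \<in> M" "y \<in> M" "elts x = X" "elts y = Y"
    using assms unfolding small_def by blast
  then show ?thesis using small_Union_elts[OF small_pair, of x y] by simp
qed

lemma small_insert: "x \<in> M \<Longrightarrow> small X \<Longrightarrow> small (insert x X)"
  using small_Un[OF small_single] by fastforce

lemma small_Pow: "x \<in> M \<Longrightarrow> small {y \<in> M. elts y \<subseteq> elts x}"
  using ZFC unfolding ZFC_def power_set_def is_power_def small_def by blast

lemma small_foundation: "small X \<Longrightarrow> X \<noteq> {} \<Longrightarrow> \<exists>y\<in>X. elts y \<inter> X = {}"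
  using ZFC unfolding ZFC_def foundation_def small_def by blast

lemma mem_irrefl: "\<not> x \<in> elts x"
proof
  assume x: "x \<in> elts x"
  then show False using small_foundation[OF small_single[OF elts_M[OF x]]] by auto
qed

lemma mem_asym: "x \<in> elts y \<Longrightarrow> \<not> y \<in> elts x"
proof
  assume a: "x \<in> elts y" "y \<in> elts x"
  then show False using small_foundation[OF small_pair[of x y]] by (auto dest: elts_M)
qed

lemma mem_no_cycle3: "x \<in> elts y \<Longrightarrow> y \<in> elts z \<Longrightarrow> \<not> z \<in> elts x"
proof
  assume a: "x \<in> elts y" "y \<in> elts z" "z \<in> elts x"
  then have "small {x, y, z}"
    by (intro small_insert small_empty) (auto dest: elts_M)
  then show False using a small_foundation[of "{x, y, z}"] by auto
qed

subsection \<open>Pairs and functions\<close>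

definition pr :: "'a \<Rightarrow> 'a \<Rightarrow> 'a" where
  "pr x y = mk {mk {x}, mk {x, y}}"

text \<open>Application of an arbitrary set, with the empty set as value where there is no unique
  \<open>y\<close>. Recursion equations can therefore be stated without saying that \<open>f\<close>
  is a function.\<close>

definition app :: "'a \<Rightarrow> 'a \<Rightarrow> 'a" where
  "app f x = the1 (\<lambda>y. pr x y \<in> elts f)"

lemma pr_in [simp]: "pr x y \<in> M"
  by (simp add: pr_def)

lemma app_in [simp]: "app f x \<in> M"
  unfolding app_def by (rule the1_in)

lemma dtm_pr0: "dtm (\<lambda>e. pr (e 0) (e 1))"
  unfolding pr_def by (intro dfn_intros)

lemmas dtm_pr [dfn_intros] = dtm_comp2[OF dtm_pr0]

lemma dtm_app0: "dtm (\<lambda>e. app (e 0) (e 1))"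
  unfolding app_def by (intro dfn_intros)

lemmas dtm_app [dfn_intros] = dtm_comp2[OF dtm_app0]

lemma elts_pr: "x \<in> M \<Longrightarrow> y \<in> M \<Longrightarrow> elts (pr x y) = {mk {x}, mk {x, y}}"
  unfolding pr_def by (intro elts_mk small_pair) auto

lemma pr_eq_iff:
  assumes "x \<in> M" "y \<in> M" "x' \<in> M" "y' \<in> M"
  shows "pr x y = pr x' y' \<longleftrightarrow> x = x' \<and> y = y'"
proof
  assume "pr x y = pr x' y'"
  then have "{mk {x}, mk {x, y}} = {mk {x'}, mk {x', y'}}"
    using assms elts_pr by metis
  then have "elts ` {mk {x}, mk {x, y}} = elts ` {mk {x'}, mk {x', y'}}" by simp
  then have "{{x}, {x, y}} = {{x'}, {x', y'}}"
    using assms by (simp add: elts_mk small_single small_pair)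
  then show "x = x' \<and> y = y'" by (auto simp: doubleton_eq_iff)
qed simp

lemma is_pair_iff: "x \<in> M \<Longrightarrow> y \<in> M \<Longrightarrow> z \<in> M \<Longrightarrow> is_pair x y z \<longleftrightarrow> z = pr x y"
proof -
  assume a: "x \<in> M" "y \<in> M" "z \<in> M"
  have "is_pair x y z \<longleftrightarrow> elts z = {mk {x}, mk {x, y}}"
    using a unfolding is_pair_def
    by (metis (no_types, opaque_lifting) elts_mk mk_eq mk_in small_pair small_single)
  then show ?thesis using a elts_pr elts_ext by (metis pr_in)
qed

lemma rel_iff: "x \<in> M \<Longrightarrow> y \<in> M \<Longrightarrow> rel r x y \<longleftrightarrow> pr x y \<in> elts r"
  unfolding rel_def using is_pair_iff elts_M by (metis)

lemma small_times:
  assumes "small X" "small Y"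
  shows "small {z. \<exists>x\<in>X. \<exists>y\<in>Y. z = pr x y}"
proof -
  obtain y where y: "y \<in> M" "elts y = Y" using assms unfolding small_def by blast
  have *: "small (pr x ` Y)" if "x \<in> M" for x
    by (rule small_image[OF assms(2)]) (intro dfn_intros that)
  have "dtm (\<lambda>e. mk (pr (e 0) ` elts y))"
    by (intro dfn_intros y)
  then have "small (\<Union>x\<in>X. elts (mk (pr x ` Y)))"
    using small_UN[OF assms(1), of "\<lambda>x. mk (pr x ` Y)"] y by simp
  moreover have "(\<Union>x\<in>X. elts (mk (pr x ` Y))) = {z. \<exists>x\<in>X. \<exists>y\<in>Y. z = pr x y}"
  proof -
    have "elts (mk (pr x ` Y)) = pr x ` Y" if "x \<in> X" for x
      using small_M[OF assms(1)] that by (intro elts_mk *) blast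
    then show ?thesis by auto
  qed
  ultimately show ?thesis by simp
qed

lemma ex_fun:
  assumes "small X" "dtm (\<lambda>e. F (e 0))"
  shows "\<exists>f\<in>M. \<forall>x\<in>X. app f x = F x"
proof -
  let ?X = "(\<lambda>x. pr x (F x)) ` X"
  have s: "small ?X"
    by (rule small_image[OF assms(1)]) (intro dfn_intros assms(2))
  have "app (mk ?X) x = F x" if x: "x \<in> X" for x
  proof -
    have M: "x \<in> M" using x small_M[OF assms(1)] by blast
    show ?thesis unfolding app_def elts_mk[OF s]
    proof (rule the1_eq)
      fix z assume z: "z \<in> M" "pr x z \<in> ?X"
      then obtain x' where x': "x' \<in> X" "pr x z = pr x' (F x')" by blast
      then have "x' \<in> M" using small_M[OF assms(1)] by blast
      then show "z = F x" using x' z M pr_eq_iff dtm_in1[OF assms(2)] by metis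
    qed (use x M dtm_in1[OF assms(2)] in auto)
  qed
  then show ?thesis by (intro bexI[of _ "mk ?X"]) auto
qed

subsection \<open>Well-founded recursion\<close>

text \<open>The relation is arbitrary, since it has to serve membership, the orders of
  \<open>collapse\<close> and the constituents of names; only sets of the model are required to have
  minimal elements. \<open>att X g\<close> says that \<open>g\<close> solves the equation on a part
  \<open>X\<close> closed under predecessors. Such partial solutions agree where both are defined,
  so they glue to one solution \<open>G\<close>.\<close>

theorem wf_rec:
  assumes A: "A \<in> M" and R: "dfn (\<lambda>e. R (e 0) (e 1))"
    and wf: "\<And>S. small S \<Longrightarrow> S \<subseteq> elts A \<Longrightarrow> S \<noteq> {} \<Longrightarrow> \<exists>m\<in>S. \<forall>y\<in>S. \<not> R y m"
    and K: "dtm (\<lambda>e. K (e 0) (app (e 1)))"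
    and loc: "\<And>x f g. x \<in> elts A \<Longrightarrow> (\<And>y. y \<in> elts A \<Longrightarrow> R y x \<Longrightarrow> f y = g y) \<Longrightarrow> K x f = K x g"
  shows "\<exists>g\<in>M. \<forall>x\<in>elts A. app g x = K x (app g)"
proof -
  note [dfn_intros] = dfn_comp2[where R = R, OF R] dtm_comp2[where f = "\<lambda>x g. K x (app g)", OF K]
  define att where "att X g \<longleftrightarrow> elts X \<subseteq> elts A \<and> (\<forall>x\<in>elts X. \<forall>y\<in>elts A. R y x \<longrightarrow> y \<in> elts X) \<and>
    (\<forall>x\<in>elts X. app g x = K x (app g))" for X g
  have att0: "dfn (\<lambda>e. att (e 0) (e 1))"
    unfolding att_def by (intro dfn_intros A)
  note [dfn_intros] = dfn_comp2[where R = att, OF att0]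
  have uniq: "app g x = app g' x"
    if M: "X \<in> M" "g \<in> M" "X' \<in> M" "g' \<in> M" and att: "att X g" "att X' g'" and x: "x \<in> elts X" "x \<in> elts X'"
    for X g X' g' x
  proof (rule ccontr)
    assume ne: "app g x \<noteq> app g' x"
    let ?S = "{x \<in> elts X. x \<in> elts X' \<and> app g x \<noteq> app g' x}"
    have "small ?S" by (intro small_sep small_elts dfn_intros M)
    moreover have "?S \<subseteq> elts A" "?S \<noteq> {}" using att ne x unfolding att_def by auto
    ultimately obtain m where m: "m \<in> ?S" "\<forall>y\<in>?S. \<not> R y m" using wf by blast
    have "K m (app g) = K m (app g')"
    proof (rule loc)
      show "m \<in> elts A" using m att unfolding att_def by blast
      fix y assume "y \<in> elts A" "R y m"
      then show "app g y = app g' y" using m att unfolding att_def by blast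
    qed
    moreover have "app g m = K m (app g)" "app g' m = K m (app g')"
      using m att unfolding att_def by blast+
    ultimately show False using m by simp
  qed
  define dom where "dom = {x \<in> elts A. \<exists>X\<in>M. \<exists>g\<in>M. att X g \<and> x \<in> elts X}"
  define V where "V x = the1 (\<lambda>v. \<exists>X\<in>M. \<exists>g\<in>M. att X g \<and> x \<in> elts X \<and> v = app g x)" for x
  have sd: "small dom" unfolding dom_def
    by (intro small_sep small_elts dfn_intros A)
  have V: "V x = app g x" if "X \<in> M" "g \<in> M" "att X g" "x \<in> elts X" for X g x
    unfolding V_def
  proof (rule the1_eq)
    fix z assume "z \<in> M" "\<exists>X\<in>M. \<exists>g\<in>M. att X g \<and> x \<in> elts X \<and> z = app g x"
    then show "z = app g x" using uniq that by blast
  qed (use that in auto)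
  have "dtm (\<lambda>e. V (e 0))" unfolding V_def by (intro dfn_intros)
  then obtain G where G: "G \<in> M" "\<And>x. x \<in> dom \<Longrightarrow> app G x = V x"
    using ex_fun[OF sd] by blast
  have attG: "app G x = K x (app G)" "\<And>y. y \<in> elts A \<Longrightarrow> R y x \<Longrightarrow> y \<in> dom" if x: "x \<in> dom" for x
  proof -
    obtain X g where X: "X \<in> M" "g \<in> M" "att X g" "x \<in> elts X" "x \<in> elts A"
      using x unfolding dom_def by blast
    then have sub: "elts X \<subseteq> dom" unfolding dom_def att_def by blast
    show "y \<in> dom" if "y \<in> elts A" "R y x" for y
      using X that sub unfolding att_def by blast
    have "app g x = K x (app g)" using X unfolding att_def by blast
    with G(2)[OF x] V[OF X(1-4)] have "app G x = K x (app g)" by metis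
    also have "\<dots> = K x (app G)"
    proof (rule loc[OF X(5)])
      fix y assume "y \<in> elts A" "R y x"
      then have y: "y \<in> elts X" using X unfolding att_def by blast
      then show "app g y = app G y" using G(2) V[OF X(1-3)] sub by auto
    qed
    finally show "app G x = K x (app G)" .
  qed
  have "elts A \<subseteq> dom"
  proof (rule ccontr)
    assume "\<not> elts A \<subseteq> dom"
    then have ne: "{x \<in> elts A. \<not> x \<in> dom} \<noteq> {}" by blast
    have mkd: "elts (mk dom) = dom" by (rule elts_mk[OF sd])
    have "small {x \<in> elts A. \<not> x \<in> elts (mk dom)}" by (intro small_sep small_elts dfn_intros A mk_in)
    then obtain m where m: "m \<in> elts A" "m \<notin> dom" "\<And>y. y \<in> elts A \<Longrightarrow> R y m \<Longrightarrow> y \<in> dom"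
      using wf[OF _ _ ne] mkd by auto
    \<comment> \<open>All predecessors of the minimal missing \<open>m\<close> lie in
      \<open>dom\<close>, so adding \<open>m\<close> keeps the domain closed and extends
      \<open>G\<close> by one value to a larger partial solution.\<close>
    define F where "F x = (if x = m then K m (app G) else app G x)" for x
    have mM: "m \<in> M" by (rule elts_M[OF m(1)])
    have sd': "small (insert m dom)" by (rule small_insert[OF mM sd])
    have "dtm (\<lambda>e. F (e 0))" unfolding F_def by (intro dfn_intros mM G(1))
    then obtain g where g: "g \<in> M" "\<And>x. x \<in> insert m dom \<Longrightarrow> app g x = F x"
      using ex_fun[OF sd'] by blast
    have gG: "app g x = app G x" if "x \<in> dom" for x
      using g(2)[of x] m(2) that by (auto simp: F_def)
    have "att (mk (insert m dom)) g"
      unfolding att_def elts_mk[OF sd']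
    proof (intro conjI ballI impI)
      show "insert m dom \<subseteq> elts A" using m(1) unfolding dom_def by blast
      fix x assume x: "x \<in> insert m dom"
      have preds: "y \<in> dom" if "y \<in> elts A" "R y x" for y
        using attG(2) x m(3) that by blast
      then show "y \<in> insert m dom" if "y \<in> elts A" "R y x" for y using that by blast
      have xA: "x \<in> elts A" using x m(1) unfolding dom_def by blast
      have "app g x = K x (app G)"
        using g(2)[OF x] attG(1) x by (auto simp: F_def)
      also have "\<dots> = K x (app g)"
        by (rule loc[OF xA]) (simp add: gG preds)
      finally show "app g x = K x (app g)" .
    qed
    then have "\<exists>X\<in>M. \<exists>g\<in>M. att X g \<and> m \<in> elts X"
      using g(1) elts_mk[OF sd'] by (intro bexI[of _ "mk (insert m dom)"] bexI[of _ g]) auto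
    then have "m \<in> dom" unfolding dom_def using m(1) by blast
    with m(2) show False by blast
  qed
  then show ?thesis using attG(1) G(1) by blast
qed

subsection \<open>Ordinals\<close>

lemma E_iff: "u \<in> M \<Longrightarrow> E u v \<longleftrightarrow> u \<in> elts v"
  by (simp add: elts_def)

text \<open>Foundation excludes membership cycles of length up to three, which yields irreflexivity
  and transitivity of \<open>E\<close> on \<open>x\<close>. It also gives membership-minimal
  elements, which are least because the order is linear.\<close>

lemma ordinal_iff: "ordinal x \<longleftrightarrow> x \<in> M \<and> (\<forall>y\<in>elts x. elts y \<subseteq> elts x) \<and>
    (\<forall>u\<in>elts x. \<forall>v\<in>elts x. u \<in> elts v \<or> u = v \<or> v \<in> elts u)" (is "_ \<longleftrightarrow> ?R")
proof
  assume x: "ordinal x"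
  show ?R
  proof (intro conjI ballI)
    fix u v assume uv: "u \<in> elts x" "v \<in> elts x"
    then have "E u v \<or> u = v \<or> E v u" using x unfolding ordinal_def by blast
    then show "u \<in> elts v \<or> u = v \<or> v \<in> elts u" using uv by (simp add: elts_def)
  qed (use x in \<open>auto simp: ordinal_def\<close>)
next
  assume R: ?R
  then have tr: "\<And>y. y \<in> elts x \<Longrightarrow> elts y \<subseteq> elts x"
    and lin: "\<And>u v. u \<in> elts x \<Longrightarrow> v \<in> elts x \<Longrightarrow> u \<in> elts v \<or> u = v \<or> v \<in> elts u"
    by blast+
  have E: "E u v \<longleftrightarrow> u \<in> elts v" if "u \<in> elts x" for u v
    using that E_iff elts_M by blast
  show "ordinal x" unfolding ordinal_def
  proof (intro conjI ballI impI)
    show "\<not> E y y" if "y \<in> elts x" for y using that E mem_irrefl by blast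
    show "E u v \<or> u = v \<or> E v u" if "u \<in> elts x" "v \<in> elts x" for u v
      using lin[OF that] E that by blast
    show "E u w" if "u \<in> elts x" "v \<in> elts x" "w \<in> elts x" "E u v \<and> E v w" for u v w
      using lin[OF that(1,3)] E that mem_asym mem_no_cycle3 by blast
    show "\<exists>m\<in>elts s. \<forall>y\<in>elts s. m = y \<or> E m y"
      if s: "s \<in> M" "elts s \<subseteq> elts x \<and> elts s \<noteq> {}" for s
    proof -
      obtain m where m: "m \<in> elts s" "elts m \<inter> elts s = {}"
        using small_foundation[OF small_elts[OF s(1)]] s by blast
      have "m = y \<or> E m y" if "y \<in> elts s" for y
        using lin[of m y] m that s E by blast
      then show ?thesis using m by blast
    qed
  qed (use R tr in auto)
qed

lemma ordinal_M: "ordinal x \<Longrightarrow> x \<in> M"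
  by (simp add: ordinal_iff)

lemma ordinal_trans: "ordinal x \<Longrightarrow> y \<in> elts x \<Longrightarrow> z \<in> elts y \<Longrightarrow> z \<in> elts x"
  unfolding ordinal_iff by blast

lemma ordinal_mem: "ordinal x \<Longrightarrow> y \<in> elts x \<Longrightarrow> ordinal y"
proof -
  assume x: "ordinal x" and y: "y \<in> elts x"
  have "w \<in> elts y" if "z \<in> elts y" "w \<in> elts z" for z w
  proof -
    have "w \<in> elts x" using x y that ordinal_trans by blast
    then consider "w \<in> elts y" | "w = y" | "y \<in> elts w" using x y unfolding ordinal_iff by blast
    then show ?thesis using that mem_asym mem_no_cycle3 by cases blast+
  qed
  then show "ordinal y" using x y unfolding ordinal_iff by (blast intro: elts_M)
qed

text \<open>A membership-minimal element of \<open>x\<close> outside \<open>y\<close> turns out to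
  equal \<open>y\<close>.\<close>

lemma ordinal_psubset:
  assumes "ordinal x" "ordinal y" "elts y \<subset> elts x"
  shows "y \<in> elts x"
proof -
  have M: "x \<in> M" "y \<in> M" using assms ordinal_M by auto
  have "small {z \<in> elts x. z \<notin> elts y}" by (intro small_sep small_elts dfn_intros M)
  then obtain m where m: "m \<in> elts x" "m \<notin> elts y" "elts m \<inter> {z \<in> elts x. z \<notin> elts y} = {}"
    using small_foundation[of "{z \<in> elts x. z \<notin> elts y}"] assms(3) by blast
  have "elts m \<subseteq> elts y" using m assms(1) ordinal_trans by blast
  moreover have "z \<in> elts m" if "z \<in> elts y" for z
  proof -
    have "z \<in> elts x" using that assms(3) by blast
    then consider "z \<in> elts m" | "z = m" | "m \<in> elts z" using assms(1) m unfolding ordinal_iff by blast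
    then show ?thesis using that m(2) assms(2) ordinal_trans by cases blast+
  qed
  ultimately have "m = y" using m M by (intro elts_ext) (auto intro: elts_M)
  with m show ?thesis by simp
qed

lemma ordinal_linear:
  assumes "ordinal x" "ordinal y"
  shows "x \<in> elts y \<or> x = y \<or> y \<in> elts x"
proof -
  have M: "x \<in> M" "y \<in> M" using assms ordinal_M by auto
  define i where "i = mk {z \<in> elts x. z \<in> elts y}"
  have "small {z \<in> elts x. z \<in> elts y}" by (intro small_sep small_elts dfn_intros M)
  then have i: "elts i = elts x \<inter> elts y" "i \<in> M" unfolding i_def by (auto simp: elts_mk)
  have oi: "ordinal i" using assms i unfolding ordinal_iff by blast
  have "i = x \<or> i \<in> elts x" using ordinal_psubset[OF assms(1) oi] i M elts_ext by blast
  moreover have "i = y \<or> i \<in> elts y" using ordinal_psubset[OF assms(2) oi] i M elts_ext by blast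
  ultimately show ?thesis using i mem_irrefl by blast
qed

lemma ordinal_subset_iff:
  assumes "ordinal x" "ordinal y"
  shows "elts x \<subseteq> elts y \<longleftrightarrow> x = y \<or> x \<in> elts y"
  using ordinal_linear[OF assms] assms mem_irrefl ordinal_trans by blast

lemma ordinal_not_mem: "ordinal x \<Longrightarrow> ordinal y \<Longrightarrow> x \<notin> elts y \<longleftrightarrow> elts y \<subseteq> elts x"
  using ordinal_linear[of x y] ordinal_subset_iff[of y x] mem_irrefl mem_asym by blast

lemma dfn_ordinal0: "dfn (\<lambda>e. ordinal (e 0))"
proof (rule dfn_cong)
  show "dfn (\<lambda>e. (\<forall>y\<in>elts (e 0). elts y \<subseteq> elts (e 0)) \<and>
    (\<forall>u\<in>elts (e 0). \<forall>v\<in>elts (e 0). u \<in> elts v \<or> u = v \<or> v \<in> elts u))"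
    by (intro dfn_intros)
qed (auto simp: ordinal_iff)

lemmas dfn_ordinal [dfn_intros] = dfn_comp1[OF dfn_ordinal0]

definition succ :: "'a \<Rightarrow> 'a" where
  "succ x = mk (insert x (elts x))"

lemma succ_in [simp]: "succ x \<in> M"
  by (simp add: succ_def)

lemma elts_succ: "x \<in> M \<Longrightarrow> elts (succ x) = insert x (elts x)"
  unfolding succ_def by (intro elts_mk small_insert small_elts)

lemma dtm_succ0: "dtm (\<lambda>e. succ (e 0))"
  unfolding succ_def by (intro dfn_intros)

lemmas dtm_succ [dfn_intros] = dtm_comp1[OF dtm_succ0]

lemma is_succ_iff: "x \<in> M \<Longrightarrow> y \<in> M \<Longrightarrow> is_succ x y \<longleftrightarrow> y = succ x"
  unfolding is_succ_def using elts_succ elts_ext succ_in by metis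

lemma ordinal_succ: "ordinal x \<Longrightarrow> ordinal (succ x)"
  by (frule ordinal_M) (auto simp: ordinal_iff elts_succ)

lemma succ_inj: "x \<in> M \<Longrightarrow> y \<in> M \<Longrightarrow> succ x = succ y \<Longrightarrow> x = y"
  by (metis elts_succ insertE insertI1 mem_asym)

lemma ordinal_succ_cases: "ordinal x \<Longrightarrow> y \<in> elts x \<Longrightarrow> succ y = x \<or> succ y \<in> elts x"
proof -
  assume x: "ordinal x" "y \<in> elts x"
  then have y: "ordinal y" "y \<in> M" by (auto intro: ordinal_mem elts_M)
  have "elts (succ y) \<subseteq> elts x" using x ordinal_trans by (auto simp: elts_succ y)
  then show ?thesis using ordinal_subset_iff ordinal_succ x y by blast
qed

lemma ordinal_Union:
  assumes "small X" "\<And>x. x \<in> X \<Longrightarrow> ordinal x"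
  shows "ordinal (mk (\<Union>x\<in>X. elts x))"
proof -
  have e: "elts (mk (\<Union>x\<in>X. elts x)) = (\<Union>x\<in>X. elts x)"
    by (rule elts_mk[OF small_Union_elts[OF assms(1)]])
  show ?thesis unfolding ordinal_iff e
  proof (intro conjI ballI)
    fix y assume "y \<in> (\<Union>x\<in>X. elts x)"
    then show "elts y \<subseteq> (\<Union>x\<in>X. elts x)" using assms(2) ordinal_trans by blast
  next
    fix u v assume "u \<in> (\<Union>x\<in>X. elts x)" "v \<in> (\<Union>x\<in>X. elts x)"
    then have "ordinal u" "ordinal v" using assms(2) ordinal_mem by auto
    then show "u \<in> elts v \<or> u = v \<or> v \<in> elts u" by (rule ordinal_linear)
  qed simp
qed

text \<open>Definability of \<open>P\<close> is essential: an external collection of ordinals of an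
  ill-founded model need not have a least element.\<close>

lemma ord_least:
  assumes "dfn (\<lambda>e. P (e 0))" "ordinal x" "P x"
  obtains m where "ordinal m" "P m" "\<And>y. y \<in> elts m \<Longrightarrow> \<not> P y" "m = x \<or> m \<in> elts x"
proof -
  have M: "x \<in> M" by (rule ordinal_M[OF assms(2)])
  have "small {y \<in> elts (succ x). P y}" by (intro small_sep small_elts assms(1) succ_in)
  moreover have "x \<in> {y \<in> elts (succ x). P y}" using assms M by (simp add: elts_succ)
  ultimately obtain m where m: "m \<in> elts (succ x)" "P m" "elts m \<inter> {y \<in> elts (succ x). P y} = {}"
    using small_foundation[of "{y \<in> elts (succ x). P y}"] by blast
  have o: "ordinal (succ x)" by (rule ordinal_succ[OF assms(2)])
  then have "ordinal m" using m(1) ordinal_mem by blast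
  moreover have "\<not> P y" if "y \<in> elts m" for y using m that o ordinal_trans by blast
  ultimately show ?thesis using that m M by (auto simp: elts_succ)
qed

lemma ord_induct:
  assumes "dfn (\<lambda>e. P (e 0))" "\<And>x. ordinal x \<Longrightarrow> (\<And>y. y \<in> elts x \<Longrightarrow> P y) \<Longrightarrow> P x" "ordinal x"
  shows "P x"
proof (rule ccontr)
  assume "\<not> P x"
  then obtain m where "ordinal m" "\<not> P m" "\<And>y. y \<in> elts m \<Longrightarrow> \<not> \<not> P y"
    using ord_least[of "\<lambda>x. \<not> P x" x, OF dfn_not[OF assms(1)] assms(3)] by blast
  then show False using assms(2) by blast
qed

text \<open>Burali-Forti: the supremum \<open>u\<close> of the ordinals in \<open>X\<close> would
  satisfy \<open>succ u \<in> X\<close> and hence \<open>u \<in> elts u\<close>.\<close>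

lemma ordinals_not_small: assumes "small X" shows "\<exists>x. ordinal x \<and> x \<notin> X"
proof (rule ccontr)
  assume a: "\<not> (\<exists>x. ordinal x \<and> x \<notin> X)"
  define u where "u = mk (\<Union>x\<in>{x \<in> X. ordinal x}. elts x)"
  have s: "small {x \<in> X. ordinal x}" by (intro small_sep assms dfn_intros)
  then have "ordinal u" unfolding u_def by (rule ordinal_Union) auto
  then have "succ u \<in> {x \<in> X. ordinal x}" "u \<in> M" using a ordinal_succ ordinal_M by blast+
  then have "u \<in> elts u" unfolding u_def elts_mk[OF small_Union_elts[OF s]]
    by (auto simp: elts_succ)
  then show False using mem_irrefl by blast
qed

lemma limit_ordinal_iff: "limit_ordinal x \<longleftrightarrow> ordinal x \<and> elts x \<noteq> {} \<and> \<not> (\<exists>y\<in>elts x. x = succ y)"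
  unfolding limit_ordinal_def using is_succ_iff ordinal_M elts_M by blast

lemma dfn_limit0: "dfn (\<lambda>e. limit_ordinal (e 0))"
  unfolding limit_ordinal_iff by (intro dfn_intros)

lemmas dfn_limit [dfn_intros] = dfn_comp1[OF dfn_limit0]

lemma limit_succ: "limit_ordinal x \<Longrightarrow> y \<in> elts x \<Longrightarrow> succ y \<in> elts x"
  unfolding limit_ordinal_iff using ordinal_succ_cases by blast

lemma limitI:
  assumes "ordinal x" "elts x \<noteq> {}" "\<And>y. y \<in> elts x \<Longrightarrow> succ y \<in> elts x"
  shows "limit_ordinal x"
  unfolding limit_ordinal_iff using assms mem_irrefl by metis

lemma ord_cases:
  assumes "ordinal x"
  obtains "elts x = {}" | y where "y \<in> elts x" "ordinal y" "x = succ y" | "limit_ordinal x"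
  using assms limit_ordinal_iff ordinal_mem by blast

text \<open>The set provided by Infinity may contain more than natural numbers. The ordinals in it
  are closed under successor, so their union is a limit, and \<omega> is found as the least limit
  ordinal.\<close>

lemma omega_ex: "\<exists>w\<in>M. is_omega w"
proof -
  obtain X z where X: "X \<in> M" "z \<in> elts X" "elts z = {}" "\<And>y. y \<in> elts X \<Longrightarrow> \<exists>s\<in>elts X. is_succ y s"
    using ZFC unfolding ZFC_def infinity_def by blast
  have S: "succ y \<in> elts X" if "y \<in> elts X" for y
    using X(4)[OF that] that is_succ_iff elts_M by blast
  define O' where "O' = {x \<in> elts X. ordinal x}"
  define u where "u = mk (\<Union>x\<in>O'. elts x)"
  have s: "small O'" unfolding O'_def by (intro small_sep small_elts X(1) dfn_intros)
  have e: "elts u = (\<Union>x\<in>O'. elts x)" unfolding u_def by (rule elts_mk[OF small_Union_elts[OF s]])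
  have SO: "succ x \<in> O'" if "x \<in> O'" for x using that S ordinal_succ unfolding O'_def by blast
  have OM: "x \<in> M" if "x \<in> O'" for x using that ordinal_M unfolding O'_def by blast
  have lim: "limit_ordinal u"
  proof (rule limitI)
    show "ordinal u" unfolding u_def by (rule ordinal_Union[OF s]) (auto simp: O'_def)
    have "z \<in> O'" using X elts_M[OF X(2)] unfolding O'_def ordinal_iff by auto
    then have "z \<in> elts u" unfolding e using SO OM elts_succ by (intro UN_I[of "succ z"]) auto
    then show "elts u \<noteq> {}" by blast
    fix y assume "y \<in> elts u"
    then obtain x where x: "x \<in> O'" "y \<in> elts x" unfolding e by blast
    then have "succ y = x \<or> succ y \<in> elts x" using ordinal_succ_cases unfolding O'_def by blast
    then have "succ y \<in> elts (succ x)" using elts_succ OM x by auto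
    then show "succ y \<in> elts u" unfolding e using SO x by blast
  qed
  have "ordinal u" using lim limit_ordinal_iff by blast
  then obtain m where "limit_ordinal m" "\<And>y. y \<in> elts m \<Longrightarrow> \<not> limit_ordinal y" "ordinal m"
    using ord_least[of limit_ordinal u, OF dfn_limit0 _ lim] by metis
  then show ?thesis unfolding is_omega_def using ordinal_M by blast
qed

lemma omega_unique: "is_omega w \<Longrightarrow> is_omega v \<Longrightarrow> w = v"
  unfolding is_omega_def using ordinal_linear[of w v] limit_ordinal_iff by blast

definition \<omega> :: 'a where "\<omega> = (SOME w. is_omega w)"

lemma omega: "is_omega \<omega>"
  unfolding \<omega>_def using omega_ex by (blast intro: someI)

lemma is_omega_iff: "is_omega w \<longleftrightarrow> w = \<omega>"
  using omega omega_unique by blast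

lemma omega_limit: "limit_ordinal \<omega>" and omega_ordinal: "ordinal \<omega>"
  using omega unfolding is_omega_def limit_ordinal_def by auto

text \<open>The recursion runs over all ordinals, so its solution is a definable operation rather
  than a set. The value at \<open>a\<close> is read off any solution on \<open>succ a\<close>; one
  exists by \<open>wf_rec\<close>, and two of them agree by induction.\<close>

theorem ord_rec:
  assumes K: "dtm (\<lambda>e. K (e 0) (app (e 1)))"
    and loc: "\<And>x f g. ordinal x \<Longrightarrow> (\<And>y. y \<in> elts x \<Longrightarrow> f y = g y) \<Longrightarrow> K x f = K x g"
  shows "\<exists>F. dtm (\<lambda>e. F (e 0)) \<and> (\<forall>x. ordinal x \<longrightarrow> F x = K x F)"
proof -
  note [dfn_intros] = dtm_comp2[where f = "\<lambda>x g. K x (app g)", OF K]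
  define att where "att a g \<longleftrightarrow> (\<forall>x\<in>elts (succ a). app g x = K x (app g))" for a g
  have att0: "dfn (\<lambda>e. att (e 0) (e 1))"
    unfolding att_def by (intro dfn_intros)
  note [dfn_intros] = dfn_comp2[where R = att, OF att0]
  have uniq: "app g c = app g' c"
    if a: "ordinal a" "ordinal b" "g \<in> M" "g' \<in> M" "att a g" "att b g'" "c \<in> elts (succ a)" "c \<in> elts (succ b)"
    for a b g g' c
  proof -
    have "c \<in> elts (succ a) \<longrightarrow> c \<in> elts (succ b) \<longrightarrow> app g c = app g' c"
    proof (rule ord_induct[where P = "\<lambda>c. c \<in> elts (succ a) \<longrightarrow> c \<in> elts (succ b) \<longrightarrow> app g c = app g' c"])
      show "ordinal c" using a ordinal_succ ordinal_mem by blast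
      fix x assume x: "ordinal x"
        "\<And>y. y \<in> elts x \<Longrightarrow> y \<in> elts (succ a) \<longrightarrow> y \<in> elts (succ b) \<longrightarrow> app g y = app g' y"
      show "x \<in> elts (succ a) \<longrightarrow> x \<in> elts (succ b) \<longrightarrow> app g x = app g' x"
      proof (intro impI)
        assume xs: "x \<in> elts (succ a)" "x \<in> elts (succ b)"
        have "K x (app g) = K x (app g')"
        proof (rule loc[OF x(1)])
          fix y assume y: "y \<in> elts x"
          then have "y \<in> elts (succ a)" "y \<in> elts (succ b)"
            using xs a ordinal_succ ordinal_trans by blast+
          then show "app g y = app g' y" using x(2) y by blast
        qed
        moreover have "app g x = K x (app g)" "app g' x = K x (app g')"
          using a xs unfolding att_def by blast+
        ultimately show "app g x = app g' x" by metis
      qed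
    qed (intro dfn_intros succ_in a)
    then show ?thesis using a by blast
  qed
  define F where "F a = the1 (\<lambda>v. \<exists>g\<in>M. att a g \<and> v = app g a)" for a
  have F0: "dtm (\<lambda>e. F (e 0))" unfolding F_def by (intro dfn_intros)
  have FV: "F x = app g x" if "ordinal a" "att a g" "g \<in> M" "x \<in> elts (succ a)" for a g x
  proof -
    have ox: "ordinal x" "x \<in> M" using that ordinal_succ ordinal_mem elts_M by blast+
    have xx: "x \<in> elts (succ x)" using ox by (simp add: elts_succ)
    have "elts (succ x) \<subseteq> elts (succ a)"
      using that ordinal_trans[OF ordinal_succ[OF that(1)]] ox by (auto simp: elts_succ)
    then have ax: "att x g" using that unfolding att_def by blast
    show ?thesis unfolding F_def
    proof (rule the1_eq)
      fix z assume "z \<in> M" "\<exists>g\<in>M. att x g \<and> z = app g x"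
      then show "z = app g x" using uniq[OF ox(1) ox(1) _ that(3) _ ax xx xx] by blast
    qed (use that ax in auto)
  qed
  have "F a = K a F" if a: "ordinal a" for a
  proof -
    have "\<exists>g\<in>M. \<forall>x\<in>elts (succ a). app g x = K x (app g)"
    proof (rule wf_rec[where R = "\<lambda>x y. x \<in> elts y"])
      fix S assume "small S" "S \<subseteq> elts (succ a)" "S \<noteq> {}"
      then show "\<exists>m\<in>S. \<forall>y\<in>S. y \<notin> elts m" using small_foundation by blast
    next
      fix x f g assume x: "x \<in> elts (succ a)" and
        h: "\<And>y. y \<in> elts (succ a) \<Longrightarrow> y \<in> elts x \<Longrightarrow> (f y :: 'a) = g y"
      show "K x f = K x g"
      proof (rule loc)
        show "ordinal x" using x a ordinal_succ ordinal_mem by blast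
        show "f y = g y" if "y \<in> elts x" for y
          using h that x ordinal_trans[OF ordinal_succ[OF a]] by blast
      qed
    qed (auto intro!: dfn_intros K)
    then obtain g where g: "g \<in> M" "att a g" unfolding att_def by blast
    have aa: "a \<in> elts (succ a)" using a ordinal_M by (simp add: elts_succ)
    have "F a = app g a" by (rule FV[OF a g(2,1) aa])
    also have "\<dots> = K a (app g)" using g(2) aa unfolding att_def by blast
    also have "\<dots> = K a F"
    proof (rule loc[OF a])
      fix y assume "y \<in> elts a"
      then show "app g y = F y" using FV[OF a g(2,1)] a ordinal_M by (simp add: elts_succ)
    qed
    finally show ?thesis .
  qed
  then show ?thesis using F0 by blast
qed

subsection \<open>Transfinite iteration\<close>

definition it_step :: "('a \<Rightarrow> 'a) \<Rightarrow> 'a \<Rightarrow> 'a \<Rightarrow> ('a \<Rightarrow> 'a) \<Rightarrow> 'a" where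
  "it_step s z x F = (if elts x = {} then z
     else if \<exists>y\<in>elts x. x = succ y then s (F (the1 (\<lambda>y. y \<in> elts x \<and> x = succ y)))
     else mk (\<Union>y\<in>elts x. elts (F y)))"

text \<open>The equation determines the values at ordinals. Choosing among definable solutions fixes
  the remaining values and keeps \<open>it s z\<close> a definable operation.\<close>

definition it :: "('a \<Rightarrow> 'a) \<Rightarrow> 'a \<Rightarrow> 'a \<Rightarrow> 'a" where
  "it s z = (SOME F. dtm (\<lambda>e. F (e 0)) \<and> (\<forall>x. ordinal x \<longrightarrow> F x = it_step s z x F))"

context
  fixes s z
  assumes s: "dtm (\<lambda>e. s (e 0))" and z: "z \<in> M"
begin

lemma it_spec: "dtm (\<lambda>e. it s z (e 0)) \<and> (\<forall>x. ordinal x \<longrightarrow> it s z x = it_step s z x (it s z))"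
proof -
  have "\<exists>F. dtm (\<lambda>e. F (e 0)) \<and> (\<forall>x. ordinal x \<longrightarrow> F x = it_step s z x F)"
  proof (rule ord_rec)
    show "dtm (\<lambda>e. it_step s z (e 0) (app (e 1)))"
      unfolding it_step_def by (intro dfn_intros dtm_comp1[OF s] z)
    fix x f g assume x: "ordinal x" and fg: "\<And>y. y \<in> elts x \<Longrightarrow> (f y :: 'a) = g y"
    have "the1 (\<lambda>y. y \<in> elts x \<and> x = succ y) \<in> elts x" if "\<exists>y\<in>elts x. x = succ y"
    proof -
      from that obtain y where y: "y \<in> elts x" "x = succ y" by blast
      then have "the1 (\<lambda>y. y \<in> elts x \<and> x = succ y) = y"
        by (intro the1_eq) (auto intro: elts_M dest: succ_inj[OF elts_M elts_M])
      then show ?thesis using y by simp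
    qed
    then show "it_step s z x f = it_step s z x g"
      unfolding it_step_def using fg by auto
  qed
  then show ?thesis
    unfolding it_def by (rule someI_ex[of "\<lambda>F. dtm (\<lambda>e. F (e 0)) \<and> (\<forall>x. ordinal x \<longrightarrow> F x = it_step s z x F)"])
qed

lemma dtm_it0: "dtm (\<lambda>e. it s z (e 0))"
  using it_spec by blast

lemma it_M: "x \<in> M \<Longrightarrow> it s z x \<in> M"
  by (rule dtm_in1[OF dtm_it0])

lemma it_0: "ordinal x \<Longrightarrow> elts x = {} \<Longrightarrow> it s z x = z"
  using it_spec by (simp add: it_step_def)

lemma it_succ: assumes "ordinal x" shows "it s z (succ x) = s (it s z x)"
proof -
  have M: "x \<in> M" by (rule ordinal_M[OF assms])
  have "the1 (\<lambda>y. y \<in> elts (succ x) \<and> succ x = succ y) = x"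
    using M by (intro the1_eq) (auto simp: elts_succ dest: succ_inj)
  moreover have "\<exists>y\<in>elts (succ x). succ x = succ y" "elts (succ x) \<noteq> {}" using M by (auto simp: elts_succ)
  ultimately have "it_step s z (succ x) (it s z) = s (it s z x)"
    by (simp add: it_step_def)
  then show ?thesis using it_spec ordinal_succ[OF assms] by simp
qed

lemma it_limit:
  assumes "limit_ordinal x"
  shows "elts (it s z x) = (\<Union>y\<in>elts x. elts (it s z y))"
proof -
  have x: "ordinal x" "elts x \<noteq> {}" "\<not> (\<exists>y\<in>elts x. x = succ y)" using assms limit_ordinal_iff by auto
  then have "it s z x = mk (\<Union>y\<in>elts x. elts (it s z y))"
    using it_spec by (simp add: it_step_def)
  then show ?thesis using elts_mk[OF small_UN[OF small_elts dtm_it0]] x ordinal_M by simp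
qed

lemma it_mono:
  assumes incr: "\<And>x. ordinal x \<Longrightarrow> elts (it s z x) \<subseteq> elts (s (it s z x))"
    and "ordinal b" "a \<in> elts b"
  shows "elts (it s z a) \<subseteq> elts (it s z b)"
proof -
  have aM: "a \<in> M" using assms elts_M by blast
  have "a \<in> elts b \<longrightarrow> elts (it s z a) \<subseteq> elts (it s z b)"
  proof (rule ord_induct[where x = b and P = "\<lambda>b. a \<in> elts b \<longrightarrow> elts (it s z a) \<subseteq> elts (it s z b)"])
    fix x assume x: "ordinal x" "\<And>y. y \<in> elts x \<Longrightarrow> a \<in> elts y \<longrightarrow> elts (it s z a) \<subseteq> elts (it s z y)"
    show "a \<in> elts x \<longrightarrow> elts (it s z a) \<subseteq> elts (it s z x)"
    proof
      assume a: "a \<in> elts x"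
      from x(1) show "elts (it s z a) \<subseteq> elts (it s z x)"
      proof (cases rule: ord_cases)
        case (2 y)
        then have "a = y \<or> a \<in> elts y" using a ordinal_M by (simp add: elts_succ)
        then have "elts (it s z a) \<subseteq> elts (it s z y)" using x(2) 2 by blast
        then show ?thesis using incr[OF 2(2)] it_succ[OF 2(2)] 2(3) by simp
      next
        case 3
        then show ?thesis using it_limit a by blast
      qed (use a in simp)
    qed
  qed (intro dfn_intros dtm_comp1[OF dtm_it0] aM assms(2))+
  with assms(3) show ?thesis by blast
qed

lemma it_ordinal:
  assumes "ordinal z" "\<And>u. ordinal u \<Longrightarrow> ordinal (s u)" "ordinal b"
  shows "ordinal (it s z b)"
proof (rule ord_induct[where x = b and P = "\<lambda>b. ordinal (it s z b)"])
  fix x assume x: "ordinal x" "\<And>y. y \<in> elts x \<Longrightarrow> ordinal (it s z y)"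
  from x(1) show "ordinal (it s z x)"
  proof (cases rule: ord_cases)
    case 1
    then show ?thesis using it_0 x assms by simp
  next
    case (2 y)
    then show ?thesis using it_succ x assms by simp
  next
    case 3
    have "small (it s z ` elts x)" using x ordinal_M by (intro small_image small_elts dtm_it0)
    then have "ordinal (mk (\<Union>u\<in>it s z ` elts x. elts u))" using x by (intro ordinal_Union) auto
    moreover have "it s z x = mk (\<Union>u\<in>it s z ` elts x. elts u)"
      using mk_eq[OF it_M[OF ordinal_M[OF x(1)]] it_limit[OF 3]] by simp
    ultimately show ?thesis by simp
  qed
qed (intro dfn_intros dtm_comp1[OF dtm_it0] assms)+

end

lemma func_graph:
  assumes "d \<in> M" "dtm (\<lambda>e. F (e 0))"
  obtains f where "f \<in> M" "func f d" "\<And>x y. x \<in> elts d \<Longrightarrow> y \<in> M \<Longrightarrow> rel f x y \<longleftrightarrow> y = F x"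
proof
  let ?X = "(\<lambda>x. pr x (F x)) ` elts d"
  let ?f = "mk ?X"
  have s: "small ?X"
    by (rule small_image[OF small_elts[OF assms(1)]]) (intro dfn_intros assms(2))
  have e: "elts ?f = ?X" by (rule elts_mk[OF s])
  show M: "?f \<in> M" by simp
  have FM: "F x \<in> M" if "x \<in> elts d" for x using dtm_in1[OF assms(2)] that elts_M by blast
  show r: "rel ?f x y \<longleftrightarrow> y = F x" if "x \<in> elts d" "y \<in> M" for x y
  proof -
    have "rel ?f x y \<longleftrightarrow> (\<exists>x'\<in>elts d. pr x y = pr x' (F x'))"
      using that elts_M e by (subst rel_iff) auto
    also have "\<dots> \<longleftrightarrow> y = F x"
      using that elts_M FM pr_eq_iff by metis
    finally show ?thesis .
  qed
  show "func ?f d"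
    unfolding func_def e
  proof (intro conjI ballI)
    fix z assume "z \<in> ?X"
    then obtain x where x: "x \<in> elts d" "z = pr x (F x)" by blast
    then have "is_pair x (F x) z" using FM elts_M by (simp add: is_pair_iff)
    then show "\<exists>x\<in>elts d. \<exists>y\<in>M. is_pair x y z" using x FM by blast
  next
    fix x assume x: "x \<in> elts d"
    show "\<exists>!y. y \<in> M \<and> rel ?f x y" using r[OF x] FM[OF x] by (intro ex1I[of _ "F x"]) auto
  qed
qed

text \<open>Connects the relational recursion of the axioms' vocabulary with the operation
  \<open>it\<close>: any witnessing function agrees with \<open>it s z\<close> by induction, and the
  graph of \<open>it s z\<close> is such a function. \<open>S\<close> is assumed functional at
  ordinals only, because \<open>is_card_succ\<close> is shown to be functional only there; this is
  why ordinals are preserved along the iteration.\<close>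

lemma ord_iter_iff:
  assumes s: "dtm (\<lambda>e. s (e 0))" and z: "ordinal z" and so: "\<And>u. ordinal u \<Longrightarrow> ordinal (s u)"
    and S: "\<And>u w. ordinal u \<Longrightarrow> w \<in> M \<Longrightarrow> S u w \<longleftrightarrow> w = s u" and v: "v \<in> M"
  shows "ord_iter S z b v \<longleftrightarrow> ordinal b \<and> v = it s z b"
proof
  have zM: "z \<in> M" by (rule ordinal_M[OF z])
  note it = it_0[OF s zM] it_succ[OF s zM] it_limit[OF s zM] it_M[OF s zM]
  note d0 = dtm_comp1[OF dtm_it0[OF s zM]]
  have io: "ordinal (it s z x)" if "ordinal x" for x
    by (rule it_ordinal[OF s zM z _ that]) (rule so)
  { assume "ord_iter S z b v"
    then obtain d f where b: "ordinal b" and M: "d \<in> M" "f \<in> M" and d: "is_succ b d" and f: "func f d"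
      and f0: "\<forall>x\<in>elts d. elts x = {} \<longrightarrow> rel f x z"
      and fs: "\<forall>x\<in>elts d. \<forall>y\<in>elts d. \<forall>u\<in>M. \<forall>w\<in>M. is_succ x y \<and> rel f x u \<and> rel f y w \<longrightarrow> S u w"
      and fl: "\<forall>x\<in>elts d. \<forall>u\<in>M. limit_ordinal x \<and> rel f x u \<longrightarrow>
        elts u = (\<Union>w\<in>{w \<in> M. \<exists>y\<in>elts x. rel f y w}. elts w)"
      and fb: "rel f b v"
      unfolding ord_iter_def by (elim conjE bexE) (rule that)
    have bM: "b \<in> M" by (rule ordinal_M[OF b])
    have dd: "d = succ b" "ordinal d" using d is_succ_iff M bM ordinal_succ b by auto
    have ex: "\<exists>!y. y \<in> M \<and> rel f x y" if "x \<in> elts d" for x using f that unfolding func_def by blast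
    have "b \<in> elts d \<longrightarrow> (\<forall>u\<in>M. pr b u \<in> elts f \<longrightarrow> u = it s z b)"
    proof (rule ord_induct[where x = b and P = "\<lambda>b. b \<in> elts d \<longrightarrow> (\<forall>u\<in>M. pr b u \<in> elts f \<longrightarrow> u = it s z b)"])
      show "dfn (\<lambda>e. e 0 \<in> elts d \<longrightarrow> (\<forall>u\<in>M. pr (e 0) u \<in> elts f \<longrightarrow> u = it s z (e 0)))"
        by (intro dfn_intros d0 M)
      fix x assume x: "ordinal x"
        "\<And>y. y \<in> elts x \<Longrightarrow> y \<in> elts d \<longrightarrow> (\<forall>u\<in>M. pr y u \<in> elts f \<longrightarrow> u = it s z y)"
      show "x \<in> elts d \<longrightarrow> (\<forall>u\<in>M. pr x u \<in> elts f \<longrightarrow> u = it s z x)"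
      proof (intro impI ballI)
        fix u assume xd: "x \<in> elts d" and u: "u \<in> M" "pr x u \<in> elts f"
        have xM: "x \<in> M" by (rule ordinal_M[OF x(1)])
        have r: "rel f x u" using u xM by (simp add: rel_iff)
        have IH: "rel f y w \<longleftrightarrow> w = it s z y" if y: "y \<in> elts x" "w \<in> M" for y w
        proof -
          have yd: "y \<in> elts d" "y \<in> M" using y xd dd ordinal_trans elts_M by blast+
          then show ?thesis using x(2)[OF y(1)] ex[OF yd(1)] y(2) rel_iff by metis
        qed
        from x(1) show "u = it s z x"
        proof (cases rule: ord_cases)
          case 1
          then show ?thesis using bspec[OF f0 xd] 1 r ex[OF xd] u zM it(1)[OF x(1)] by metis
        next
          case (2 y)
          have yM: "y \<in> M" "y \<in> elts d" using 2 ordinal_M xd dd ordinal_trans by blast+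
          have "S (it s z y) u"
            using bspec[OF bspec[OF bspec[OF bspec[OF fs yM(2)] xd] it(4)[OF yM(1)]] u(1)] r
              IH[OF 2(1) it(4)[OF yM(1)]] 2(3) is_succ_iff[OF yM(1) xM] by blast
          then show ?thesis using S[OF io[OF 2(2)] u(1)] it(2)[OF 2(2)] 2 by simp
        next
          case 3
          have "{w \<in> M. \<exists>y\<in>elts x. rel f y w} = {w \<in> M. \<exists>y\<in>elts x. w = it s z y}"
            using IH by blast
          also have "\<dots> = it s z ` elts x" using it(4)[OF elts_M] by blast
          finally have "elts u = elts (it s z x)"
            using bspec[OF bspec[OF fl xd] u(1)] 3 r it(3)[OF 3] by simp
          then show ?thesis using u it(4) xM by (intro elts_ext) auto
        qed
      qed
    qed (rule b)
    then show "ordinal b \<and> v = it s z b" using fb v b bM dd by (auto simp: rel_iff elts_succ) }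
  { assume bv: "ordinal b \<and> v = it s z b"
    then have b: "ordinal b" "b \<in> M" using ordinal_M by auto
    have os: "ordinal (succ b)" by (rule ordinal_succ[OF b(1)])
    obtain f where f: "f \<in> M" "func f (succ b)"
      "\<And>x y. x \<in> elts (succ b) \<Longrightarrow> y \<in> M \<Longrightarrow> rel f x y \<longleftrightarrow> y = it s z x"
      using func_graph[OF succ_in dtm_it0[OF s zM]] by metis
    have o: "ordinal x" "x \<in> M" if "x \<in> elts (succ b)" for x using that os ordinal_mem elts_M by blast+
    show "ord_iter S z b v"
      unfolding ord_iter_def
    proof (rule conjI[OF b(1)], rule bexI[OF _ succ_in[of b]], rule bexI[OF _ f(1)], intro conjI ballI impI)
      show "is_succ b (succ b)" using b by (simp add: is_succ_iff)
      show "rel f x z" if "x \<in> elts (succ b)" "elts x = {}" for x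
        using that f(3) it(1) o zM by simp
      show "S u w" if "x \<in> elts (succ b)" "y \<in> elts (succ b)" "u \<in> M" "w \<in> M"
        "is_succ x y \<and> rel f x u \<and> rel f y w" for x y u w
        using that f(3) S io it(2) o is_succ_iff by metis
      show "elts u = (\<Union>w\<in>{w \<in> M. \<exists>y\<in>elts x. rel f y w}. elts w)"
        if x: "x \<in> elts (succ b)" and u: "u \<in> M" "limit_ordinal x \<and> rel f x u" for x u
      proof -
        have "rel f y w \<longleftrightarrow> w = it s z y" if "y \<in> elts x" "w \<in> M" for y w
          using f(3)[OF ordinal_trans[OF os x that(1)] that(2)] .
        then have "{w \<in> M. \<exists>y\<in>elts x. rel f y w} = {w \<in> M. \<exists>y\<in>elts x. w = it s z y}" by blast
        also have "\<dots> = it s z ` elts x" using it(4)[OF elts_M] by blast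
        finally show ?thesis using it(3) u f(3)[OF x u(1)] by simp
      qed
      show "rel f b v" using b bv f(3)[OF _ v] by (simp add: elts_succ)
    qed (use b f in auto) }
qed

section \<open>Ordinal addition as iterated successor\<close>

abbreviation oadd :: "'a \<Rightarrow> 'a \<Rightarrow> 'a" where
  "oadd \<equiv> it succ"

lemma oadd_ordinal: "ordinal a \<Longrightarrow> ordinal b \<Longrightarrow> ordinal (oadd a b)"
  by (rule it_ordinal[OF dtm_succ0 ordinal_M]) (auto intro: ordinal_succ)

lemma oadd_strict_mono:
  assumes "ordinal a" "ordinal b" "c \<in> elts b"
  shows "oadd a c \<in> elts (oadd a b)"
proof -
  have aM: "a \<in> M" by (rule ordinal_M[OF assms(1)])
  have c: "ordinal c" using assms ordinal_mem by blast
  have oc: "oadd a c \<in> M" using oadd_ordinal[OF assms(1) c] ordinal_M by blast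
  have incr: "elts (oadd a x) \<subseteq> elts (succ (oadd a x))" if "ordinal x" for x
    using oadd_ordinal[OF assms(1) that] ordinal_M by (auto simp: elts_succ)
  have "succ c = b \<or> succ c \<in> elts b" by (rule ordinal_succ_cases[OF assms(2,3)])
  then have "elts (oadd a (succ c)) \<subseteq> elts (oadd a b)"
    using it_mono[OF dtm_succ0 aM incr assms(2)] by blast
  moreover have "oadd a (succ c) = succ (oadd a c)" by (rule it_succ[OF dtm_succ0 aM c])
  ultimately show ?thesis using oc by (auto simp: elts_succ)
qed

lemma oadd_inj:
  assumes "ordinal a" "ordinal b" "ordinal c" "oadd a b = oadd a c"
  shows "b = c"
  using ordinal_linear[OF assms(2,3)] oadd_strict_mono[of a b c] oadd_strict_mono[of a c b] assms mem_irrefl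
  by metis

lemma limit_oadd: assumes "ordinal a" "limit_ordinal b" shows "limit_ordinal (oadd a b)"
proof -
  have aM: "a \<in> M" by (rule ordinal_M[OF assms(1)])
  have b: "ordinal b" "elts b \<noteq> {}" using assms(2) limit_ordinal_iff by auto
  note e = it_limit[OF dtm_succ0 aM assms(2)]
  note o = oadd_ordinal[OF assms(1) b(1)]
  show ?thesis
  proof (rule limitI[OF o])
    show "elts (oadd a b) \<noteq> {}" using oadd_strict_mono[OF assms(1) b(1)] b(2) by blast
    fix y assume "y \<in> elts (oadd a b)"
    then obtain c where c: "c \<in> elts b" "y \<in> elts (oadd a c)" unfolding e by blast
    then have "succ y = oadd a c \<or> succ y \<in> elts (oadd a c)"
      using oadd_ordinal[OF assms(1) ordinal_mem[OF b(1) c(1)]] ordinal_succ_cases by blast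
    then show "succ y \<in> elts (oadd a b)"
      using oadd_strict_mono[OF assms(1) b(1) c(1)] ordinal_trans[OF o] by metis
  qed
qed

text \<open>Splits an aleph with a sum as index into two successive iterations of the cardinal
  successor. At a limit x the ordinals a + y with y < x are cofinal in a + x, and monotonicity,
  supplied by \<open>incr\<close>, makes the two unions equal.\<close>

lemma it_oadd:
  assumes s: "dtm (\<lambda>e. s (e 0))" and z: "z \<in> M" and a: "ordinal a" and b: "ordinal b"
    and incr: "\<And>x. ordinal x \<Longrightarrow> elts (it s z x) \<subseteq> elts (s (it s z x))"
  shows "it s z (oadd a b) = it s (it s z a) b"
proof -
  have aM: "a \<in> M" by (rule ordinal_M[OF a])
  have zM: "it s z a \<in> M" by (rule it_M[OF s z aM])
  note it1 = it_succ[OF s z] it_limit[OF s z] it_M[OF s z]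
  note it2 = it_0[OF s zM] it_succ[OF s zM] it_limit[OF s zM] it_M[OF s zM]
  note oa = it_0[OF dtm_succ0 aM] it_succ[OF dtm_succ0 aM] it_limit[OF dtm_succ0 aM]
  show ?thesis
  proof (rule ord_induct[where x = b and P = "\<lambda>b. it s z (oadd a b) = it s (it s z a) b"])
    show "dfn (\<lambda>e. it s z (oadd a (e 0)) = it s (it s z a) (e 0))"
      by (intro dfn_intros dtm_comp1[OF dtm_it0[OF s z]] dtm_it0[OF dtm_succ0 aM] dtm_it0[OF s zM])
    fix x assume x: "ordinal x" "\<And>y. y \<in> elts x \<Longrightarrow> it s z (oadd a y) = it s (it s z a) y"
    from x(1) show "it s z (oadd a x) = it s (it s z a) x"
    proof (cases rule: ord_cases)
      case 1
      then show ?thesis using oa(1) it2(1) x by simp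
    next
      case (2 y)
      then show ?thesis using oa(2)[OF 2(2)] it1(1)[OF oadd_ordinal[OF a 2(2)]] it2(2)[OF 2(2)] x(2)[OF 2(1)]
        by simp
    next
      case 3
      have o: "ordinal (oadd a x)" "oadd a x \<in> M" using oadd_ordinal[OF a x(1)] ordinal_M by auto
      have "elts (it s z (oadd a x)) = (\<Union>y\<in>elts (oadd a x). elts (it s z y))"
        by (rule it1(2)[OF limit_oadd[OF a 3]])
      also have "\<dots> = (\<Union>y\<in>elts x. elts (it s z (oadd a y)))"
      proof (intro equalityI subsetI)
        fix u assume "u \<in> (\<Union>y\<in>elts (oadd a x). elts (it s z y))"
        then obtain y c where c: "c \<in> elts x" "y \<in> elts (oadd a c)" "u \<in> elts (it s z y)"
          unfolding oa(3)[OF 3] by blast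
        then have "u \<in> elts (it s z (oadd a c))"
          using it_mono[OF s z incr oadd_ordinal[OF a ordinal_mem[OF x(1) c(1)]] c(2)] by blast
        then show "u \<in> (\<Union>y\<in>elts x. elts (it s z (oadd a y)))" using c by blast
      next
        fix u assume "u \<in> (\<Union>y\<in>elts x. elts (it s z (oadd a y)))"
        then show "u \<in> (\<Union>y\<in>elts (oadd a x). elts (it s z y))"
          using oadd_strict_mono[OF a x(1)] by blast
      qed
      also have "\<dots> = elts (it s (it s z a) x)" unfolding it2(3)[OF 3] using x(2) by simp
      finally show ?thesis using it1(3)[OF o(2)] it2(4)[OF ordinal_M[OF x(1)]] by (intro elts_ext)
    qed
  qed (rule b)
qed

definition zero :: 'a where "zero = mk {}"

lemma zero_in [simp]: "zero \<in> M" and elts_zero [simp]: "elts zero = {}"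
  unfolding zero_def by (auto simp: elts_mk)

lemma ordinal_zero: "ordinal zero"
  by (simp add: ordinal_iff)

lemma zero_mem: "ordinal x \<Longrightarrow> elts x \<noteq> {} \<Longrightarrow> zero \<in> elts x"
  using ordinal_linear[OF ordinal_zero] by fastforce

text \<open>The union of \<omega> many iterates of \<open>s\<close> starting from \<open>X\<close>;
  any two elements occur together at some finite stage. The form with two elements serves closure
  under pairing, and with one element closure under taking elements.\<close>

lemma closure_ex:
  assumes s: "dtm (\<lambda>e. s (e 0))" and X: "X \<in> M" and incr: "\<And>u. u \<in> M \<Longrightarrow> elts u \<subseteq> elts (s u)"
  shows "\<exists>Z\<in>M. elts X \<subseteq> elts Z \<and> (\<forall>a\<in>elts Z. \<forall>b\<in>elts Z. \<exists>u\<in>M. a \<in> elts u \<and> b \<in> elts u \<and> elts (s u) \<subseteq> elts Z)"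
proof (rule bexI, intro conjI ballI)
  let ?Z = "it s X \<omega>"
  note it = it_0[OF s X] it_succ[OF s X] it_limit[OF s X omega_limit] it_M[OF s X]
  show "?Z \<in> M" by (rule it(4)[OF ordinal_M[OF omega_ordinal]])
  have "zero \<in> elts \<omega>" using zero_mem omega_limit unfolding limit_ordinal_iff by blast
  then show "elts X \<subseteq> elts ?Z" using it(1)[OF ordinal_zero] it(3) by auto
  have incr': "elts (it s X x) \<subseteq> elts (s (it s X x))" if "ordinal x" for x
    by (rule incr[OF it(4)[OF ordinal_M[OF that]]])
  have mono: "elts (it s X m) \<subseteq> elts (it s X n)" if "ordinal n" "m \<in> elts n" for m n
    by (rule it_mono[OF s X _ that]) (rule incr')
  fix a b assume "a \<in> elts ?Z" "b \<in> elts ?Z"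
  then obtain m n where mn: "m \<in> elts \<omega>" "n \<in> elts \<omega>" "a \<in> elts (it s X m)" "b \<in> elts (it s X n)"
    unfolding it(3) by blast
  have o: "ordinal m" "ordinal n" using mn ordinal_mem[OF omega_ordinal] by auto
  obtain k where k: "k \<in> elts \<omega>" "ordinal k" "a \<in> elts (it s X k)" "b \<in> elts (it s X k)"
    using ordinal_linear[OF o] mono[OF o(1)] mono[OF o(2)] mn o by blast
  have "elts (it s X (succ k)) \<subseteq> elts ?Z" using it(3) limit_succ[OF omega_limit k(1)] by blast
  then show "\<exists>u\<in>M. a \<in> elts u \<and> b \<in> elts u \<and> elts (s u) \<subseteq> elts ?Z"
    using k it(2)[OF k(2)] it(4)[OF ordinal_M[OF k(2)]] by auto
qed

subsection \<open>The well-ordering theorem\<close>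

definition pow :: "'a \<Rightarrow> 'a" where
  "pow x = mk {y. elts y \<subseteq> elts x}"

lemma pow_eq: "pow x = mk {y \<in> M. elts y \<subseteq> elts x}"
proof -
  have "{y. elts y \<subseteq> elts x} \<inter> M = {y \<in> M. elts y \<subseteq> elts x} \<inter> M" by blast
  then show ?thesis by (simp add: pow_def mk_def)
qed

lemma pow_in [simp]: "pow x \<in> M"
  by (simp add: pow_def)

lemma elts_pow: "x \<in> M \<Longrightarrow> elts (pow x) = {y \<in> M. elts y \<subseteq> elts x}"
  unfolding pow_eq by (rule elts_mk[OF small_Pow])

lemma dtm_pow0: "dtm (\<lambda>e. pow (e 0))"
  unfolding pow_def by (intro dfn_intros)

lemmas dtm_pow [dfn_intros] = dtm_comp1[OF dtm_pow0]

lemma is_power_iff: "x \<in> M \<Longrightarrow> p \<in> M \<Longrightarrow> is_power x p \<longleftrightarrow> p = pow x"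
  unfolding is_power_def using elts_pow elts_ext pow_in by metis

text \<open>The axiom selects from disjoint families only, so each nonempty subset \<open>S\<close>
  is replaced by {S} x S, which is \<open>T S\<close>.\<close>

lemma choice_fun:
  assumes X: "X \<in> M"
  shows "\<exists>c\<in>M. \<forall>S\<in>M. elts S \<subseteq> elts X \<longrightarrow> elts S \<noteq> {} \<longrightarrow> app c S \<in> elts S"
proof -
  define T where "T S = mk (pr S ` elts S)" for S
  have T0: "dtm (\<lambda>e. T (e 0))" unfolding T_def by (intro dfn_intros)
  have eT: "elts (T S) = pr S ` elts S" if "S \<in> M" for S
    unfolding T_def by (rule elts_mk, rule small_image[OF small_elts[OF that]]) (intro dfn_intros that)
  define N where "N = {S \<in> elts (pow X). \<not> elts S = {}}"
  have sN: "small N" unfolding N_def by (intro small_sep small_elts dfn_intros pow_in)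
  have NM: "S \<in> M" "elts S \<noteq> {}" if "S \<in> N" for S using that elts_M unfolding N_def by auto
  define F where "F = mk (T ` N)"
  have F: "F \<in> M" "elts F = T ` N" unfolding F_def by (rule mk_in, rule elts_mk[OF small_image[OF sN T0]])
  have ne: "\<forall>x\<in>elts F. elts x \<noteq> {}" unfolding F(2) using eT NM by auto
  have dj: "\<forall>x\<in>elts F. \<forall>y\<in>elts F. x \<noteq> y \<longrightarrow> elts x \<inter> elts y = {}"
  proof (intro ballI impI)
    fix x y assume "x \<in> elts F" "y \<in> elts F" "x \<noteq> y"
    then obtain S S' where S: "S \<in> N" "S' \<in> N" "x = T S" "y = T S'" "S \<noteq> S'" unfolding F(2) by blast
    have "pr S u \<noteq> pr S' u'" if "u \<in> elts S" "u' \<in> elts S'" for u u'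
      using pr_eq_iff[OF NM(1)[OF S(1)] elts_M[OF that(1)] NM(1)[OF S(2)] elts_M[OF that(2)]] S(5) by blast
    then show "elts x \<inter> elts y = {}" using S eT[OF NM(1)] by auto
  qed
  have ch: choice using ZFC unfolding ZFC_def by blast
  obtain C where C: "C \<in> M" "\<forall>x\<in>elts F. \<exists>!z. z \<in> elts C \<inter> elts x"
    using bspec[OF ch[unfolded choice_def] F(1), THEN mp, OF conjI[OF ne dj]] by (rule bexE)
  define f where "f S = the1 (\<lambda>x. x \<in> elts S \<and> pr S x \<in> elts C)" for S
  have "dtm (\<lambda>e. f (e 0))" unfolding f_def by (intro dfn_intros C)
  then obtain c where c: "c \<in> M" "\<And>S. S \<in> N \<Longrightarrow> app c S = f S" using ex_fun[OF sN] by metis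
  have "f S \<in> elts S" if S: "S \<in> N" for S
  proof -
    have "T S \<in> elts F" using S F(2) by blast
    from bspec[OF C(2) this] obtain z0 where
      "z0 \<in> elts C \<inter> elts (T S)" "\<forall>w. w \<in> elts C \<inter> elts (T S) \<longrightarrow> w = z0" by (rule ex1E)
    then obtain z where z: "z \<in> elts C" "z \<in> pr S ` elts S" "\<And>w. w \<in> elts C \<Longrightarrow> w \<in> pr S ` elts S \<Longrightarrow> w = z"
      unfolding eT[OF NM(1)[OF S]] by blast
    then obtain u where u: "u \<in> elts S" "z = pr S u" by blast
    have "f S = u" unfolding f_def
    proof (rule the1_eq)
      fix w assume w: "w \<in> M" "w \<in> elts S \<and> pr S w \<in> elts C"
      then have "pr S w = pr S u" using z(3) u by blast
      then show "w = u" using pr_eq_iff NM(1)[OF S] w u elts_M by metis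
    qed (use u z(1) elts_M[OF u(1)] in simp_all)
    then show ?thesis using u by simp
  qed
  moreover have "S \<in> N" if "S \<in> M" "elts S \<subseteq> elts X" "elts S \<noteq> {}" for S
    using that elts_pow[OF X] unfolding N_def by simp
  ultimately show ?thesis using c by metis
qed

text \<open>Zermelo's argument: \<open>F a\<close> is chosen from what the earlier values leave
  over, so \<open>F\<close> is injective as long as \<open>X\<close> is not exhausted. The ordinal
  sought is the least one whose image under \<open>F\<close> covers \<open>X\<close>.\<close>

theorem well_ordering:
  assumes X: "X \<in> M"
  obtains \<alpha> h where "ordinal \<alpha>" "h \<in> M" "bij_betw (app h) (elts \<alpha>) (elts X)"
proof -
  obtain c where c: "c \<in> M" "\<And>S. S \<in> M \<Longrightarrow> elts S \<subseteq> elts X \<Longrightarrow> elts S \<noteq> {} \<Longrightarrow> app c S \<in> elts S"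
    using choice_fun[OF X] by blast
  define K where "K a F = app c (mk {y. y \<in> elts X \<and> (\<forall>b\<in>elts a. F b \<noteq> y)})" for a :: 'a and F :: "'a \<Rightarrow> 'a"
  have "\<exists>F. dtm (\<lambda>e. F (e 0)) \<and> (\<forall>x. ordinal x \<longrightarrow> F x = K x F)"
  proof (rule ord_rec)
    show "dtm (\<lambda>e. K (e 0) (app (e 1)))" unfolding K_def by (intro dfn_intros X c(1))
    show "K x f = K x g" if "\<And>y. y \<in> elts x \<Longrightarrow> f y = g y" for x f g
      unfolding K_def using that by simp
  qed
  then obtain F where F: "dtm (\<lambda>e. F (e 0))" "\<And>x. ordinal x \<Longrightarrow> F x = K x F" by blast
  note [dfn_intros] = dtm_comp1[where f = F, OF F(1)]
  have Fx: "F a \<in> elts X" "\<And>b. b \<in> elts a \<Longrightarrow> F b \<noteq> F a" if a: "ordinal a" "\<not> elts X \<subseteq> F ` elts a" for a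
  proof -
    let ?S = "{y. y \<in> elts X \<and> (\<forall>b\<in>elts a. F b \<noteq> y)}"
    have "small ?S" by (rule small_sep) (intro small_elts dfn_intros X ordinal_M[OF a(1)])+
    then have e: "elts (mk ?S) = ?S" by (rule elts_mk)
    have "app c (mk ?S) \<in> elts (mk ?S)"
      by (rule c(2)) (use e a in auto)
    then have "F a \<in> ?S" unfolding e using F(2)[OF a(1)] K_def by simp
    then show "F a \<in> elts X" "\<And>b. b \<in> elts a \<Longrightarrow> F b \<noteq> F a" by auto
  qed
  have ex: "\<exists>a. ordinal a \<and> elts X \<subseteq> F ` elts a"
  proof (rule ccontr)
    assume no: "\<not> ?thesis"
    have inj: "a = b" if "ordinal a" "ordinal b" "F a = F b" for a b
      using ordinal_linear[OF that(1,2)] Fx(2)[OF that(1)] Fx(2)[OF that(2)] no that by metis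
    \<comment> \<open>If \<open>X\<close> were never exhausted, \<open>F\<close> would be injective
      on all ordinals, and the image of \<open>X\<close> under its inverse \<open>g\<close> would be
      a set containing every ordinal.\<close>
    define g where "g x = the1 (\<lambda>a. ordinal a \<and> F a = x)" for x
    have "dtm (\<lambda>e. g (e 0))" unfolding g_def by (intro dfn_intros)
    then have "small (g ` elts X)" by (intro small_image small_elts X)
    then obtain a where a: "ordinal a" "a \<notin> g ` elts X" using ordinals_not_small by blast
    have "g (F a) = a" unfolding g_def
      by (rule the1_eq) (use a ordinal_M inj in auto)
    moreover have "F a \<in> elts X" using Fx(1) a no by blast
    ultimately show False using a(2) by (metis imageI)
  qed
  from ex obtain a0 where a0: "ordinal a0" "\<forall>y\<in>elts X. \<exists>b\<in>elts a0. y = F b" by blast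
  have d0: "dfn (\<lambda>e. \<forall>y\<in>elts X. \<exists>b\<in>elts (e 0). y = F b)" by (intro dfn_intros X)
  obtain a where a: "ordinal a" "\<forall>y\<in>elts X. \<exists>b\<in>elts a. y = F b"
    "\<And>b. b \<in> elts a \<Longrightarrow> \<not> (\<forall>y\<in>elts X. \<exists>c\<in>elts b. y = F c)"
    by (rule ord_least[where P = "\<lambda>a. \<forall>y\<in>elts X. \<exists>b\<in>elts a. y = F b", OF d0 a0]) (rule that)
  have ob: "ordinal b" "\<not> elts X \<subseteq> F ` elts b" if "b \<in> elts a" for b
    using that a(1) ordinal_mem a(3)[OF that] by blast+
  obtain h where h: "h \<in> M" "\<And>x. x \<in> elts a \<Longrightarrow> app h x = F x"
    using ex_fun[OF small_elts[OF ordinal_M[OF a(1)]] F(1)] by blast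
  have "inj_on F (elts a)"
  proof (rule inj_onI)
    fix x y assume xy: "x \<in> elts a" "y \<in> elts a" "F x = F y"
    then show "x = y"
      using ordinal_linear[OF ob(1)[OF xy(1)] ob(1)[OF xy(2)]] Fx(2)[OF ob[OF xy(1)]] Fx(2)[OF ob[OF xy(2)]]
      by metis
  qed
  moreover have "F ` elts a = elts X" using Fx(1)[OF ob] a(2) by blast
  ultimately have "bij_betw F (elts a) (elts X)" by (simp add: bij_betw_def)
  then have "bij_betw (app h) (elts a) (elts X)" using bij_betw_cong[of "elts a" "app h" F] h(2) by blast
  then show ?thesis using that a(1) h(1) by blast
qed

subsection \<open>Injections and bijections\<close>

definition lep :: "'a \<Rightarrow> 'a \<Rightarrow> bool" where
  "lep X Y \<longleftrightarrow> (\<exists>f\<in>M. (\<forall>x\<in>elts X. app f x \<in> elts Y) \<and>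
     (\<forall>x\<in>elts X. \<forall>y\<in>elts X. app f x = app f y \<longrightarrow> x = y))"

definition eqp :: "'a \<Rightarrow> 'a \<Rightarrow> bool" where
  "eqp X Y \<longleftrightarrow> (\<exists>f\<in>M. (\<forall>x\<in>elts X. app f x \<in> elts Y) \<and>
     (\<forall>x\<in>elts X. \<forall>y\<in>elts X. app f x = app f y \<longrightarrow> x = y) \<and> (\<forall>y\<in>elts Y. \<exists>x\<in>elts X. app f x = y))"

lemma dfn_lep0: "dfn (\<lambda>e. lep (e 0) (e 1))"
  unfolding lep_def by (intro dfn_intros)

lemmas dfn_lep [dfn_intros] = dfn_comp2[OF dfn_lep0]

lemma dfn_eqp0: "dfn (\<lambda>e. eqp (e 0) (e 1))"
  unfolding eqp_def by (intro dfn_intros)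

lemmas dfn_eqp [dfn_intros] = dfn_comp2[OF dfn_eqp0]

lemma lepI:
  assumes "X \<in> M" "dtm (\<lambda>e. F (e 0))" "\<And>x. x \<in> elts X \<Longrightarrow> F x \<in> elts Y" "inj_on F (elts X)"
  shows "lep X Y"
proof -
  obtain f where "f \<in> M" "\<And>x. x \<in> elts X \<Longrightarrow> app f x = F x"
    using ex_fun[OF small_elts[OF assms(1)] assms(2)] by blast
  then show ?thesis unfolding lep_def using assms(3,4)
    by (intro bexI[of _ f]) (auto simp: inj_on_def)
qed

lemma eqp_iff_bij: "eqp X Y \<longleftrightarrow> (\<exists>f\<in>M. bij_betw (app f) (elts X) (elts Y))"
  unfolding eqp_def bij_betw_iff_ball by blast

lemma eqpI:
  assumes "X \<in> M" "dtm (\<lambda>e. F (e 0))" "bij_betw F (elts X) (elts Y)"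
  shows "eqp X Y"
proof -
  obtain f where f: "f \<in> M" "\<And>x. x \<in> elts X \<Longrightarrow> app f x = F x"
    using ex_fun[OF small_elts[OF assms(1)] assms(2)] by blast
  then have "bij_betw (app f) (elts X) (elts Y)" using bij_betw_cong[of "elts X" "app f" F] assms(3) by blast
  then show ?thesis unfolding eqp_iff_bij using f(1) by blast
qed

lemma eqp_lep: "eqp X Y \<Longrightarrow> lep X Y"
  unfolding eqp_def lep_def by blast

lemma lep_subset: "X \<in> M \<Longrightarrow> elts X \<subseteq> elts Y \<Longrightarrow> lep X Y"
  by (rule lepI[where F = "\<lambda>x. x"]) (auto intro: dtm_var)

lemma lep_trans:
  assumes "X \<in> M" "lep X Y" "lep Y Z"
  shows "lep X Z"
proof -
  obtain f where f: "f \<in> M" "\<forall>x\<in>elts X. app f x \<in> elts Y"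
    "\<forall>x\<in>elts X. \<forall>y\<in>elts X. app f x = app f y \<longrightarrow> x = y" using assms(2) unfolding lep_def by blast
  obtain g where g: "g \<in> M" "\<forall>x\<in>elts Y. app g x \<in> elts Z"
    "\<forall>x\<in>elts Y. \<forall>y\<in>elts Y. app g x = app g y \<longrightarrow> x = y" using assms(3) unfolding lep_def by blast
  show ?thesis
  proof (rule lepI[where F = "\<lambda>x. app g (app f x)"])
    show "dtm (\<lambda>e. app g (app f (e 0)))" by (intro dfn_intros f g)
    show "inj_on (\<lambda>x. app g (app f x)) (elts X)" using f g by (simp add: inj_on_def)
  qed (use assms f g in auto)
qed

lemma eqp_sym:
  assumes "Y \<in> M" "X \<in> M" "eqp X Y"
  shows "eqp Y X"
proof -
  obtain f where f: "f \<in> M" "bij_betw (app f) (elts X) (elts Y)" using assms(3) unfolding eqp_iff_bij by blast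
  define g where "g y = the1 (\<lambda>x. x \<in> elts X \<and> app f x = y)" for y
  have "dtm (\<lambda>e. g (e 0))" unfolding g_def by (intro dfn_intros f assms)
  moreover have gf: "g (app f x) = x" if "x \<in> elts X" for x
    unfolding g_def using that f(2) by (intro the1_eq) (auto simp: bij_betw_def inj_on_def intro: elts_M)
  have "elts Y = app f ` elts X" using f(2) by (simp add: bij_betw_def)
  then have "bij_betw g (elts Y) (elts X)"
    using gf by (intro bij_betw_byWitness[of "elts Y" "app f" g "elts X"]) auto
  ultimately show ?thesis using eqpI assms by blast
qed

lemma eqp_trans:
  assumes "X \<in> M" "eqp X Y" "eqp Y Z"
  shows "eqp X Z"
proof -
  obtain f where f: "f \<in> M" "bij_betw (app f) (elts X) (elts Y)" using assms(2) unfolding eqp_iff_bij by blast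
  obtain g where g: "g \<in> M" "bij_betw (app g) (elts Y) (elts Z)" using assms(3) unfolding eqp_iff_bij by blast
  have "bij_betw (app g \<circ> app f) (elts X) (elts Z)" by (rule bij_betw_trans[OF f(2) g(2)])
  moreover have "dtm (\<lambda>e. (app g \<circ> app f) (e 0))" unfolding o_def by (intro dfn_intros f g)
  ultimately show ?thesis using eqpI assms(1) by blast
qed

lemma func_app:
  assumes f: "func f d" and that: "x \<in> elts d" "y \<in> M"
  shows "rel f x y \<longleftrightarrow> y = app f x"
proof -
  have "\<exists>!y. y \<in> M \<and> rel f x y" using f that unfolding func_def by blast
  then obtain w where w: "w \<in> M" "rel f x w" "\<And>v. v \<in> M \<Longrightarrow> rel f x v \<Longrightarrow> v = w" by blast
  note rx = rel_iff[OF elts_M[OF that(1)]]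
  have "app f x = w" unfolding app_def
  proof (rule the1_eq[OF w(1)])
    show "pr x w \<in> elts f" using w(1,2) rx by blast
    show "v = w" if "v \<in> M" "pr x v \<in> elts f" for v using that w(3) rx by blast
  qed
  then show ?thesis using w that by blast
qed

lemma equipotent_iff:
  assumes "X \<in> M" "Y \<in> M"
  shows "equipotent X Y \<longleftrightarrow> eqp X Y"
proof
  assume "equipotent X Y"
  then obtain f where f: "f \<in> M" "func f X" "\<And>x y. x \<in> elts X \<Longrightarrow> y \<in> M \<Longrightarrow> rel f x y \<Longrightarrow> y \<in> elts Y"
    "\<And>y. y \<in> elts Y \<Longrightarrow> \<exists>!x. x \<in> elts X \<and> rel f x y"
    unfolding equipotent_def bijection_def by blast
  note r = func_app[OF f(2)]
  have "bij_betw (app f) (elts X) (elts Y)"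
    unfolding bij_betw_def
  proof
    have Y: "app f x \<in> elts Y" if "x \<in> elts X" for x using f(3)[OF that app_in] r[OF that app_in] by blast
    show "inj_on (app f) (elts X)"
    proof (rule inj_onI)
      fix x y assume "x \<in> elts X" "y \<in> elts X" "app f x = app f y"
      then show "x = y" using f(4)[OF Y] r[OF _ app_in] by metis
    qed
    have "y \<in> app f ` elts X" if y: "y \<in> elts Y" for y
      using f(4)[OF y] r elts_M[OF y] by blast
    then show "app f ` elts X = elts Y" using Y by blast
  qed
  then show "eqp X Y" unfolding eqp_iff_bij using f(1) by blast
next
  assume "eqp X Y"
  then obtain g where g: "g \<in> M" "bij_betw (app g) (elts X) (elts Y)" unfolding eqp_iff_bij by blast
  have "dtm (\<lambda>e. app g (e 0))" by (intro dfn_intros g)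
  then obtain f where f: "f \<in> M" "func f X" "\<And>x y. x \<in> elts X \<Longrightarrow> y \<in> M \<Longrightarrow> rel f x y \<longleftrightarrow> y = app g x"
    using func_graph[OF assms(1), of "app g"] by metis
  have "bijection f X Y"
    unfolding bijection_def
  proof (intro conjI ballI impI)
    show "y \<in> elts Y" if "x \<in> elts X" "y \<in> M" "rel f x y" for x y
      using f(3)[OF that(1,2)] that g(2) bij_betwE by blast
    show "\<exists>!x. x \<in> elts X \<and> rel f x y" if y: "y \<in> elts Y" for y
    proof -
      obtain x where x: "x \<in> elts X" "app g x = y" using g(2) y unfolding bij_betw_iff_ball by metis
      show ?thesis
      proof (rule ex1I[of _ x])
        show "x \<in> elts X \<and> rel f x y" using x f(3) elts_M[OF y] by blast
        fix x' assume "x' \<in> elts X \<and> rel f x' y"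
        then show "x' = x" using x f(3)[OF _ elts_M[OF y]] g(2) unfolding bij_betw_iff_ball by metis
      qed
    qed
  qed (rule f(2))
  then show "equipotent X Y" unfolding equipotent_def using f(1) by blast
qed

text \<open>Choice picks a preimage of each element. The counting arguments with names produce
  coverings rather than injections, and this converts them.\<close>

lemma surj_lep:
  assumes X: "X \<in> M" and Y: "Y \<in> M" and F: "dtm (\<lambda>e. F (e 0))" and onto: "elts Y \<subseteq> F ` elts X"
  shows "lep Y X"
proof -
  obtain c where c: "c \<in> M" "\<And>S. S \<in> M \<Longrightarrow> elts S \<subseteq> elts X \<Longrightarrow> elts S \<noteq> {} \<Longrightarrow> app c S \<in> elts S"
    using choice_fun[OF X] by blast
  note [dfn_intros] = dtm_comp1[where f = F, OF F]
  define G where "G y = app c (mk {x. x \<in> elts X \<and> F x = y})" for y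
  have G: "G y \<in> elts X" "F (G y) = y" if y: "y \<in> elts Y" for y
  proof -
    let ?S = "{x. x \<in> elts X \<and> F x = y}"
    have "small ?S" by (rule small_sep) (intro small_elts dfn_intros X elts_M[OF y])+
    then have e: "elts (mk ?S) = ?S" by (rule elts_mk)
    have "app c (mk ?S) \<in> elts (mk ?S)"
      by (rule c(2)) (use e onto y in auto)
    then have "G y \<in> ?S" unfolding e G_def .
    then show "G y \<in> elts X" "F (G y) = y" by auto
  qed
  show ?thesis
  proof (rule lepI[OF Y, of G])
    show "dtm (\<lambda>e. G (e 0))" unfolding G_def by (intro dfn_intros X c(1))
    show "inj_on G (elts Y)" using G(2) by (metis inj_onI)
  qed (rule G(1))
qed

text \<open>Mostowski collapse. The image is transitive by the recursion equation and linearly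
  ordered by membership because \<open>R\<close> is total, hence it is an ordinal, the order type of
  \<open>R\<close> on \<open>X\<close>.\<close>

lemma collapse:
  assumes X: "X \<in> M" and R: "dfn (\<lambda>e. R (e 0) (e 1))"
    and wf: "\<And>S. small S \<Longrightarrow> S \<subseteq> elts X \<Longrightarrow> S \<noteq> {} \<Longrightarrow> \<exists>m\<in>S. \<forall>y\<in>S. \<not> R y m"
    and lin: "\<And>x y. x \<in> elts X \<Longrightarrow> y \<in> elts X \<Longrightarrow> R x y \<or> x = y \<or> R y x"
  obtains \<gamma> c where "ordinal \<gamma>" "c \<in> M" "bij_betw (app c) (elts X) (elts \<gamma>)"
    "\<And>x. x \<in> elts X \<Longrightarrow> elts (app c x) = app c ` {y \<in> elts X. R y x}"
proof -
  note [dfn_intros] = dfn_comp2[where R = R, OF R]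
  define K where "K x f = mk {v. \<exists>y\<in>elts X. R y x \<and> v = f y}" for x :: 'a and f :: "'a \<Rightarrow> 'a"
  have "\<exists>g\<in>M. \<forall>x\<in>elts X. app g x = K x (app g)"
  proof (rule wf_rec[OF X R wf])
    show "dtm (\<lambda>e. K (e 0) (app (e 1)))" unfolding K_def by (intro dfn_intros X)
    fix x f g assume "\<And>y. y \<in> elts X \<Longrightarrow> R y x \<Longrightarrow> (f y :: 'a) = g y"
    then have "{v. \<exists>y\<in>elts X. R y x \<and> v = f y} = {v. \<exists>y\<in>elts X. R y x \<and> v = g y}" by auto
    then show "K x f = K x g" unfolding K_def by simp
  qed
  then obtain c where c: "c \<in> M" "\<And>x. x \<in> elts X \<Longrightarrow> app c x = K x (app c)" by blast
  have e: "elts (app c x) = app c ` {y \<in> elts X. R y x}" if x: "x \<in> elts X" for x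
  proof -
    have "small {y \<in> elts X. R y x}" by (intro small_sep small_elts dfn_intros X elts_M[OF x])
    then have s: "small (app c ` {y \<in> elts X. R y x})" by (rule small_image) (intro dfn_intros c)
    have eq: "{v. \<exists>y\<in>elts X. R y x \<and> v = app c y} = app c ` {y \<in> elts X. R y x}" by blast
    have "app c x = mk (app c ` {y \<in> elts X. R y x})" using c(2)[OF x] unfolding K_def eq .
    then show ?thesis using elts_mk[OF s] by simp
  qed
  define \<gamma> where "\<gamma> = mk (app c ` elts X)"
  have "small (app c ` elts X)" by (rule small_image[OF small_elts[OF X]]) (intro dfn_intros c)
  then have g: "elts \<gamma> = app c ` elts X" unfolding \<gamma>_def by (rule elts_mk)
  have mem: "app c x \<in> elts (app c y)" if "x \<in> elts X" "y \<in> elts X" "R x y" for x y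
    unfolding e[OF that(2)] using that by blast
  have "ordinal \<gamma>" unfolding ordinal_iff g
  proof (intro conjI ballI)
    show "elts y \<subseteq> app c ` elts X" if "y \<in> app c ` elts X" for y using that e by blast
    show "u \<in> elts v \<or> u = v \<or> v \<in> elts u" if "u \<in> app c ` elts X" "v \<in> app c ` elts X" for u v
      using that lin mem by blast
  qed (simp add: \<gamma>_def)
  moreover have "inj_on (app c) (elts X)"
  proof (rule inj_onI)
    fix x y assume "x \<in> elts X" "y \<in> elts X" "app c x = app c y"
    then show "x = y" using lin mem mem_irrefl by metis
  qed
  ultimately show ?thesis using that[of \<gamma> c] c(1) e g unfolding bij_betw_def by blast
qed

subsection \<open>Cardinals\<close>

lemma cardinal_iff: "cardinal k \<longleftrightarrow> ordinal k \<and> (\<forall>x\<in>elts k. \<not> eqp x k)"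
  unfolding cardinal_def using equipotent_iff ordinal_M elts_M by blast

lemma dfn_cardinal0: "dfn (\<lambda>e. cardinal (e 0))"
  unfolding cardinal_iff by (intro dfn_intros)

lemmas dfn_cardinal [dfn_intros] = dfn_comp1[OF dfn_cardinal0]

text \<open>Cardinals are defined through bijections, whereas the estimates below give injections.
  An injection \<open>f\<close> of \<open>k\<close> into a smaller \<open>x\<close> orders
  \<open>k\<close> by the values of \<open>f\<close>. The order type \<gamma> of this order is at
  most \<open>x\<close>, and it is in bijection with \<open>k\<close>, against the definition of a
  cardinal.\<close>

lemma cardinal_not_lep:
  assumes k: "cardinal k" and x: "x \<in> elts k"
  shows "\<not> lep k x"
proof
  assume "lep k x"
  then obtain f where f: "f \<in> M" "\<And>y. y \<in> elts k \<Longrightarrow> app f y \<in> elts x"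
    "\<And>y z. y \<in> elts k \<Longrightarrow> z \<in> elts k \<Longrightarrow> app f y = app f z \<Longrightarrow> y = z"
    unfolding lep_def by blast
  have ok: "ordinal k" "k \<in> M" using k ordinal_M unfolding cardinal_def by auto
  have ox: "ordinal x" by (rule ordinal_mem[OF ok(1) x])
  have of: "ordinal (app f y)" if "y \<in> elts k" for y using f(2)[OF that] ordinal_mem[OF ox] by blast
  have fwf: "\<exists>m\<in>S. \<forall>y\<in>S. app f y \<notin> elts (app f m)" if S: "small S" "S \<subseteq> elts k" "S \<noteq> {}" for S
  proof -
    have "small (app f ` S)" by (rule small_image[OF S(1)]) (intro dfn_intros f)
    then have "\<exists>y\<in>app f ` S. elts y \<inter> app f ` S = {}" by (rule small_foundation) (use S in auto)
    then show ?thesis by blast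
  qed
  have fdfn: "dfn (\<lambda>e. app f (e 0) \<in> elts (app f (e 1)))" by (intro dfn_intros f(1))
  have flin: "app f y \<in> elts (app f z) \<or> y = z \<or> app f z \<in> elts (app f y)"
    if "y \<in> elts k" "z \<in> elts k" for y z
    using ordinal_linear[OF of[OF that(1)] of[OF that(2)]] f(3)[OF that] by blast
  obtain \<gamma> c where c: "ordinal \<gamma>" "c \<in> M" "bij_betw (app c) (elts k) (elts \<gamma>)"
    "\<And>y. y \<in> elts k \<Longrightarrow> elts (app c y) = app c ` {z \<in> elts k. app f z \<in> elts (app f y)}"
    by (rule collapse[where R = "\<lambda>y z. app f y \<in> elts (app f z)", OF ok(2) fdfn])
      (rule fwf, assumption+, rule flin, assumption+, rule that)
  have oc: "ordinal (app c y)" if "y \<in> elts k" for y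
    using c(1,3) that ordinal_mem bij_betwE by metis
  \<comment> \<open>The collapse of a set of ordinals lies pointwise below the identity; the
    induction is on the value of \<open>f\<close>.\<close>
  have le: "elts (app c y) \<subseteq> elts (app f y)" if "y \<in> elts k" for y
  proof -
    have "\<forall>y\<in>elts k. app f y = app f y' \<longrightarrow> elts (app c y) \<subseteq> elts (app f y')" if y': "y' \<in> elts k" for y'
    proof (rule ord_induct[where x = "app f y'" and P = "\<lambda>v. \<forall>y\<in>elts k. app f y = v \<longrightarrow> elts (app c y) \<subseteq> elts v"])
      show "dfn (\<lambda>e. \<forall>y\<in>elts k. app f y = e 0 \<longrightarrow> elts (app c y) \<subseteq> elts (e 0))"
        by (intro dfn_intros ok f c)
      fix v assume v: "ordinal v"
        "\<And>w. w \<in> elts v \<Longrightarrow> \<forall>y\<in>elts k. app f y = w \<longrightarrow> elts (app c y) \<subseteq> elts w"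
      show "\<forall>y\<in>elts k. app f y = v \<longrightarrow> elts (app c y) \<subseteq> elts v"
      proof (intro ballI impI subsetI)
        fix y u assume y: "y \<in> elts k" "app f y = v" "u \<in> elts (app c y)"
        then obtain z where z: "z \<in> elts k" "app f z \<in> elts v" "u = app c z" using c(4) by auto
        have "elts u \<subseteq> elts (app f z)" using v(2)[OF z(2)] z by blast
        then have "u = app f z \<or> u \<in> elts (app f z)"
          using ordinal_subset_iff[OF oc[OF z(1)] of[OF z(1)]] z(3) by blast
        then show "u \<in> elts v" using z(2) ordinal_trans[OF v(1) z(2)] by blast
      qed
    qed (rule of[OF y'])
    then show ?thesis using that by blast
  qed
  have "elts \<gamma> \<subseteq> elts x"
  proof
    fix u assume "u \<in> elts \<gamma>"
    then obtain y where y: "y \<in> elts k" "u = app c y" using c(3) unfolding bij_betw_iff_ball by metis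
    then have "u = app f y \<or> u \<in> elts (app f y)"
      using ordinal_subset_iff[OF oc[OF y(1)] of[OF y(1)]] le by blast
    then show "u \<in> elts x" using f(2)[OF y(1)] ordinal_trans[OF ox] by blast
  qed
  then have "\<gamma> = x \<or> \<gamma> \<in> elts x" using ordinal_subset_iff[OF c(1) ox] by blast
  then have "\<gamma> \<in> elts k" using x ordinal_trans[OF ok(1) x] by blast
  moreover have "eqp k \<gamma>" unfolding eqp_iff_bij using c by blast
  then have "eqp \<gamma> k" using eqp_sym ok ordinal_M[OF c(1)] by blast
  ultimately show False using k unfolding cardinal_iff by blast
qed

lemma cardinal_ex:
  assumes "X \<in> M"
  obtains k where "cardinal k" "eqp X k"
proof -
  obtain \<alpha> h where h: "ordinal \<alpha>" "h \<in> M" "bij_betw (app h) (elts \<alpha>) (elts X)"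
    by (rule well_ordering[OF assms])
  then have "eqp \<alpha> X" unfolding eqp_iff_bij by blast
  then have e: "eqp X \<alpha>" using eqp_sym assms ordinal_M[OF h(1)] by blast
  have d: "dfn (\<lambda>e. eqp X (e 0))" by (intro dfn_intros assms)
  obtain k where k: "ordinal k" "eqp X k" "\<And>y. y \<in> elts k \<Longrightarrow> \<not> eqp X y"
    by (rule ord_least[where P = "eqp X", OF d h(1) e]) (rule that)
  have "\<not> eqp x k" if x: "x \<in> elts k" for x
  proof
    assume "eqp x k"
    then have "eqp k x" using eqp_sym k(1) ordinal_M elts_M[OF x] by blast
    then show False using eqp_trans[OF assms k(2)] k(3)[OF x] by blast
  qed
  then have "cardinal k" using k unfolding cardinal_iff by blast
  then show ?thesis using that k by blast
qed

lemma cardinal_le: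
  assumes "cardinal k" "ordinal m" "lep k m"
  shows "elts k \<subseteq> elts m"
  using cardinal_not_lep[OF assms(1)] assms ordinal_not_mem[OF assms(2)] cardinal_iff by blast

text \<open>The diagonal set adapted to injections: it collects the images of those subsets of
  \<open>k\<close> that do not contain their own image.\<close>

lemma cantor:
  assumes k: "k \<in> M"
  shows "\<not> lep (pow k) k"
proof
  assume "lep (pow k) k"
  then obtain f where f: "f \<in> M" "\<forall>x\<in>elts (pow k). app f x \<in> elts k"
    "\<forall>x\<in>elts (pow k). \<forall>y\<in>elts (pow k). app f x = app f y \<longrightarrow> x = y" unfolding lep_def by blast
  define D where "D = {x \<in> elts k. \<exists>S\<in>elts (pow k). app f S = x \<and> x \<notin> elts S}"
  have "small D" unfolding D_def by (intro small_sep small_elts dfn_intros k f pow_in)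
  then have e: "elts (mk D) = D" by (rule elts_mk)
  have D: "mk D \<in> elts (pow k)" using e unfolding elts_pow[OF k] by (auto simp: D_def)
  have "app f (mk D) \<in> D \<longleftrightarrow> app f (mk D) \<notin> D"
  proof -
    have "app f (mk D) \<in> D \<longleftrightarrow> (\<exists>S\<in>elts (pow k). app f S = app f (mk D) \<and> app f (mk D) \<notin> elts S)"
      using f(2) D unfolding D_def by blast
    also have "\<dots> \<longleftrightarrow> app f (mk D) \<notin> elts (mk D)" using f(3) D by metis
    finally show ?thesis unfolding e .
  qed
  then show False by blast
qed

lemma mem_cardinal_of_pow:
  assumes k: "ordinal k" and m: "cardinal m" "eqp (pow k) m"
  shows "k \<in> elts m"
proof (rule ccontr)
  assume "k \<notin> elts m"
  moreover have om: "ordinal m" "m \<in> M" using m(1) ordinal_M unfolding cardinal_def by auto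
  ultimately have "elts m \<subseteq> elts k" using ordinal_not_mem[OF k] by blast
  then have "lep (pow k) k" using lep_trans[OF pow_in eqp_lep[OF m(2)] lep_subset[OF om(2)]] by blast
  then show False using cantor[OF ordinal_M[OF k]] by blast
qed

text \<open>Meaningful at every ordinal, where it is the least cardinal above \<open>k\<close>, so
  iterations may start at an ordinal not known to be a cardinal.\<close>

definition cs :: "'a \<Rightarrow> 'a" where
  "cs k = the1 (\<lambda>l. is_card_succ k l)"

lemma is_card_succ_iff: "k \<in> M \<Longrightarrow> l \<in> M \<Longrightarrow> is_card_succ k l \<longleftrightarrow>
    cardinal l \<and> k \<in> elts l \<and> (\<forall>m\<in>M. cardinal m \<and> k \<in> elts m \<longrightarrow> l = m \<or> l \<in> elts m)"
  unfolding is_card_succ_def by (simp add: E_iff)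

lemma dfn_card_succ0: "dfn (\<lambda>e. is_card_succ (e 0) (e 1))"
proof (rule dfn_cong)
  show "dfn (\<lambda>e. cardinal (e 1) \<and> e 0 \<in> elts (e 1) \<and>
    (\<forall>m\<in>M. cardinal m \<and> e 0 \<in> elts m \<longrightarrow> e 1 = m \<or> e 1 \<in> elts m))"
    by (intro dfn_intros)
  fix e :: "nat \<Rightarrow> 'a" assume "range e \<subseteq> M"
  then have "e 0 \<in> M" "e 1 \<in> M" by auto
  then show "is_card_succ (e 0) (e 1) \<longleftrightarrow> cardinal (e 1) \<and> e 0 \<in> elts (e 1) \<and>
    (\<forall>m\<in>M. cardinal m \<and> e 0 \<in> elts m \<longrightarrow> e 1 = m \<or> e 1 \<in> elts m)"
    by (rule is_card_succ_iff)
qed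

lemmas dfn_card_succ [dfn_intros] = dfn_comp2[OF dfn_card_succ0]

lemma dtm_cs0: "dtm (\<lambda>e. cs (e 0))"
  unfolding cs_def by (intro dfn_intros)

lemmas dtm_cs [dfn_intros] = dtm_comp1[OF dtm_cs0]

lemma cs_in [simp]: "cs k \<in> M"
  unfolding cs_def by (rule the1_in)

lemma larger_cardinal_ex:
  assumes k: "ordinal k"
  shows "\<exists>m. cardinal m \<and> k \<in> elts m"
proof -
  obtain m where "cardinal m" "eqp (pow k) m" by (rule cardinal_ex[OF pow_in])
  then show ?thesis using mem_cardinal_of_pow[OF k] by blast
qed

lemma card_succ_cs:
  assumes k: "ordinal k"
  shows "is_card_succ k (cs k)" "l \<in> M \<Longrightarrow> is_card_succ k l \<longleftrightarrow> l = cs k"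
proof -
  have kM: "k \<in> M" by (rule ordinal_M[OF k])
  obtain m0 where m0: "cardinal m0" "k \<in> elts m0" using larger_cardinal_ex[OF k] by blast
  have d: "dfn (\<lambda>e. cardinal (e 0) \<and> k \<in> elts (e 0))" by (intro dfn_intros kM)
  obtain m where m: "ordinal m" "cardinal m \<and> k \<in> elts m" "\<And>y. y \<in> elts m \<Longrightarrow> \<not> (cardinal y \<and> k \<in> elts y)"
    by (rule ord_least[where P = "\<lambda>m. cardinal m \<and> k \<in> elts m", OF d]) (use m0 cardinal_def that in auto)
  have cm: "is_card_succ k m"
    unfolding is_card_succ_iff[OF kM ordinal_M[OF m(1)]]
  proof (intro conjI ballI impI)
    fix n assume "cardinal n \<and> k \<in> elts n"
    then show "m = n \<or> m \<in> elts n" using m ordinal_linear[OF m(1)] cardinal_def by blast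
  qed (use m in auto)
  have u: "l = m" if "l \<in> M" "is_card_succ k l" for l
  proof -
    note l = that(2)[unfolded is_card_succ_iff[OF kM that(1)]]
    note m' = cm[unfolded is_card_succ_iff[OF kM ordinal_M[OF m(1)]]]
    have "l = m \<or> l \<in> elts m" using l m(2) ordinal_M[OF m(1)] by blast
    moreover have "m = l \<or> m \<in> elts l" using m' l that(1) by blast
    ultimately show ?thesis using mem_asym by blast
  qed
  have "cs k = m" unfolding cs_def by (rule the1_eq[of m "is_card_succ k", OF ordinal_M[OF m(1)] cm]) (rule u)
  then show "is_card_succ k (cs k)" "l \<in> M \<Longrightarrow> is_card_succ k l \<longleftrightarrow> l = cs k"
    using cm u[of l] by blast+
qed

lemma cs_props:
  assumes "ordinal k"
  shows "cardinal (cs k)" "k \<in> elts (cs k)" "ordinal (cs k)" "elts k \<subseteq> elts (cs k)"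
    "\<And>m. cardinal m \<Longrightarrow> k \<in> elts m \<Longrightarrow> elts (cs k) \<subseteq> elts m"
proof -
  note c = card_succ_cs(1)[OF assms, unfolded is_card_succ_iff[OF ordinal_M[OF assms] cs_in]]
  show "cardinal (cs k)" "k \<in> elts (cs k)" using c by auto
  then show o: "ordinal (cs k)" unfolding cardinal_def by blast
  then show "elts k \<subseteq> elts (cs k)" using c ordinal_trans by blast
  show "elts (cs k) \<subseteq> elts m" if m: "cardinal m" "k \<in> elts m" for m
  proof -
    have om: "ordinal m" using m cardinal_def by blast
    then have "cs k = m \<or> cs k \<in> elts m" using c m ordinal_M by blast
    then show ?thesis using ordinal_subset_iff[OF o om] by blast
  qed
qed

abbreviation iter_cs :: "'a \<Rightarrow> 'a \<Rightarrow> 'a" where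
  "iter_cs \<equiv> it cs"

lemma iter_cs_ordinal: "ordinal z \<Longrightarrow> ordinal b \<Longrightarrow> ordinal (iter_cs z b)"
  by (rule it_ordinal[OF dtm_cs0 ordinal_M]) (auto intro: cs_props)

lemma iter_cs_oadd:
  assumes "ordinal z" "ordinal a" "ordinal b"
  shows "iter_cs z (oadd a b) = iter_cs (iter_cs z a) b"
  by (rule it_oadd[OF dtm_cs0 ordinal_M[OF assms(1)] assms(2,3)])
    (rule cs_props(4)[OF iter_cs_ordinal[OF assms(1)]])

text \<open>With \<open>b\<close> = \<open>l\<close> this places the coding cardinals above
  \<open>l\<close>, whatever the ordinal supplied by CCA is.\<close>

lemma iter_cs_ge:
  assumes "ordinal z" "ordinal b"
  shows "elts b \<subseteq> elts (iter_cs z b)"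
proof (rule ord_induct[where x = b and P = "\<lambda>b. elts b \<subseteq> elts (iter_cs z b)"])
  note zM = ordinal_M[OF assms(1)]
  show "dfn (\<lambda>e. elts (e 0) \<subseteq> elts (iter_cs z (e 0)))"
    by (intro dfn_intros dtm_it0[OF dtm_cs0 zM])
  fix x assume x: "ordinal x" "\<And>y. y \<in> elts x \<Longrightarrow> elts y \<subseteq> elts (iter_cs z y)"
  note ox = iter_cs_ordinal[OF assms(1) x(1)]
  have mem: "y \<in> elts (cs (iter_cs z y))" if "y \<in> elts x" for y
  proof -
    have oy: "ordinal y" by (rule ordinal_mem[OF x(1) that])
    note oz = iter_cs_ordinal[OF assms(1) oy]
    have "y = iter_cs z y \<or> y \<in> elts (iter_cs z y)" using ordinal_subset_iff[OF oy oz] x(2)[OF that] by blast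
    then show ?thesis using cs_props(2,4)[OF oz] by auto
  qed
  from x(1) show "elts x \<subseteq> elts (iter_cs z x)"
  proof (cases rule: ord_cases)
    case (2 y)
    have "x = succ y" "y \<in> elts (iter_cs z x)"
      using mem[OF 2(1)] it_succ[OF dtm_cs0 zM 2(2)] 2(3) by auto
    then show ?thesis using ordinal_trans[OF ox] 2(2) ordinal_M by (auto simp: elts_succ)
  next
    case 3
    show ?thesis
    proof
      fix y assume y: "y \<in> elts x"
      have "y \<in> elts (iter_cs z (succ y))"
        using mem[OF y] it_succ[OF dtm_cs0 zM ordinal_mem[OF x(1) y]] by simp
      then show "y \<in> elts (iter_cs z x)" using it_limit[OF dtm_cs0 zM 3] limit_succ[OF 3 y] by blast
    qed
  qed simp
qed (rule assms(2))

lemma is_ord_add_iff: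
  assumes "ordinal a" "c \<in> M"
  shows "is_ord_add a b c \<longleftrightarrow> ordinal b \<and> c = oadd a b"
  unfolding is_ord_add_def
  by (rule ord_iter_iff[OF dtm_succ0 assms(1) _ _ assms(2)]) (auto intro: ordinal_succ simp: is_succ_iff ordinal_M)

lemma is_aleph_iff:
  assumes "k \<in> M"
  shows "is_aleph x k \<longleftrightarrow> ordinal x \<and> k = iter_cs \<omega> x"
proof -
  have "ord_iter is_card_succ \<omega> x k \<longleftrightarrow> ordinal x \<and> k = iter_cs \<omega> x"
    by (rule ord_iter_iff[OF dtm_cs0 omega_ordinal _ _ assms]) (auto intro: cs_props simp: card_succ_cs)
  then show ?thesis unfolding is_aleph_def is_omega_iff using ordinal_M[OF omega_ordinal] by blast
qed

lemma GCH_at_iff: "GCH_at x \<longleftrightarrow> ordinal x \<and> eqp (pow (iter_cs \<omega> x)) (cs (iter_cs \<omega> x))"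
proof
  assume "GCH_at x"
  then obtain k l where kl: "k \<in> M" "l \<in> M" "is_aleph x k" "is_two_power k l" "is_card_succ k l"
    unfolding GCH_at_def by blast
  then have k: "ordinal x" "k = iter_cs \<omega> x" using is_aleph_iff by auto
  then have "ordinal k" using iter_cs_ordinal[OF omega_ordinal] by simp
  then have l: "l = cs k" using card_succ_cs(2) kl by blast
  obtain p where "p \<in> M" "is_power k p" "is_cardinality p l" using kl(4) unfolding is_two_power_def by blast
  then have "eqp (pow k) l" using is_power_iff[OF kl(1)] equipotent_iff[OF _ kl(2)] unfolding is_cardinality_def by blast
  then show "ordinal x \<and> eqp (pow (iter_cs \<omega> x)) (cs (iter_cs \<omega> x))" using k l by simp
next
  assume a: "ordinal x \<and> eqp (pow (iter_cs \<omega> x)) (cs (iter_cs \<omega> x))"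
  let ?k = "iter_cs \<omega> x"
  have ok: "ordinal ?k" "?k \<in> M" using iter_cs_ordinal[OF omega_ordinal] a ordinal_M by auto
  have "is_aleph x ?k" using is_aleph_iff[OF ok(2)] a by blast
  moreover have "is_two_power ?k (cs ?k)"
    unfolding is_two_power_def is_cardinality_def
    using cs_props(1)[OF ok(1)] is_power_iff[OF ok(2) pow_in] equipotent_iff[OF pow_in cs_in] a pow_in by blast
  ultimately show "GCH_at x" unfolding GCH_at_def using ok(2) cs_in card_succ_cs(1)[OF ok(1)] by blast
qed

subsection \<open>Products\<close>

definition cprod :: "'a \<Rightarrow> 'a \<Rightarrow> 'a" where
  "cprod X Y = mk {z. \<exists>x\<in>elts X. \<exists>y\<in>elts Y. z = pr x y}"

lemma cprod_in [simp]: "cprod X Y \<in> M"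
  by (simp add: cprod_def)

lemma elts_cprod: "X \<in> M \<Longrightarrow> Y \<in> M \<Longrightarrow> elts (cprod X Y) = {z. \<exists>x\<in>elts X. \<exists>y\<in>elts Y. z = pr x y}"
  unfolding cprod_def by (intro elts_mk small_times small_elts)

lemma cprodI: "X \<in> M \<Longrightarrow> Y \<in> M \<Longrightarrow> x \<in> elts X \<Longrightarrow> y \<in> elts Y \<Longrightarrow> pr x y \<in> elts (cprod X Y)"
  by (auto simp: elts_cprod)

lemma cprodE:
  assumes "z \<in> elts (cprod X Y)" "X \<in> M" "Y \<in> M"
  obtains x y where "x \<in> elts X" "y \<in> elts Y" "z = pr x y" "x \<in> M" "y \<in> M"
  using assms elts_M by (auto simp: elts_cprod)

definition p1 :: "'a \<Rightarrow> 'a" where "p1 z = the1 (\<lambda>x. \<exists>y\<in>M. z = pr x y)"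
definition p2 :: "'a \<Rightarrow> 'a" where "p2 z = the1 (\<lambda>y. \<exists>x\<in>M. z = pr x y)"

lemma dtm_p10: "dtm (\<lambda>e. p1 (e 0))" and dtm_p20: "dtm (\<lambda>e. p2 (e 0))"
  unfolding p1_def p2_def by (intro dfn_intros)+

lemmas dtm_p12 [dfn_intros] = dtm_comp1[OF dtm_p10] dtm_comp1[OF dtm_p20]

lemma p1_pr: "x \<in> M \<Longrightarrow> y \<in> M \<Longrightarrow> p1 (pr x y) = x"
  unfolding p1_def by (rule the1_eq) (auto simp: pr_eq_iff)

lemma p2_pr: "x \<in> M \<Longrightarrow> y \<in> M \<Longrightarrow> p2 (pr x y) = y"
  unfolding p2_def by (rule the1_eq) (auto simp: pr_eq_iff)

lemma lep_cprod:
  assumes M: "X \<in> M" "Y \<in> M" "X' \<in> M" "Y' \<in> M" and "lep X X'" "lep Y Y'"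
  shows "lep (cprod X Y) (cprod X' Y')"
proof -
  obtain f where f: "f \<in> M" "\<forall>x\<in>elts X. app f x \<in> elts X'"
    "\<forall>x\<in>elts X. \<forall>y\<in>elts X. app f x = app f y \<longrightarrow> x = y" using assms(5) unfolding lep_def by blast
  obtain g where g: "g \<in> M" "\<forall>x\<in>elts Y. app g x \<in> elts Y'"
    "\<forall>x\<in>elts Y. \<forall>y\<in>elts Y. app g x = app g y \<longrightarrow> x = y" using assms(6) unfolding lep_def by blast
  define F where "F z = pr (app f (p1 z)) (app g (p2 z))" for z
  have F: "F (pr x y) = pr (app f x) (app g y)" if "x \<in> M" "y \<in> M" for x y
    using that by (simp add: F_def p1_pr p2_pr)
  show ?thesis
  proof (rule lepI[of _ F])
    show "dtm (\<lambda>e. F (e 0))" unfolding F_def by (intro dfn_intros f g)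
    show "F z \<in> elts (cprod X' Y')" if "z \<in> elts (cprod X Y)" for z
      using that M(1,2)
    proof (rule cprodE)
      fix x y assume "x \<in> elts X" "y \<in> elts Y" "z = pr x y" "x \<in> M" "y \<in> M"
      then show ?thesis using F cprodI[OF M(3,4)] f(2) g(2) by simp
    qed
    show "inj_on F (elts (cprod X Y))"
    proof (rule inj_onI)
      fix z w assume z: "z \<in> elts (cprod X Y)" and w: "w \<in> elts (cprod X Y)" and eq: "F z = F w"
      obtain x y where xy: "x \<in> elts X" "y \<in> elts Y" "z = pr x y" "x \<in> M" "y \<in> M"
        by (rule cprodE[OF z M(1,2)])
      obtain u v where uv: "u \<in> elts X" "v \<in> elts Y" "w = pr u v" "u \<in> M" "v \<in> M"
        by (rule cprodE[OF w M(1,2)])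
      have "pr (app f x) (app g y) = pr (app f u) (app g v)" using eq F xy uv by simp
      then have "app f x = app f u" "app g y = app g v" by (simp_all add: pr_eq_iff)
      then show "z = w" using f(3) g(3) xy uv by metis
    qed
  qed simp
qed

lemma lex_wf:
  assumes a: "a \<in> M" and l: "l \<in> M" and S: "small S" "S \<subseteq> elts (cprod a l)" "S \<noteq> {}"
  shows "\<exists>m\<in>S. \<forall>u\<in>S. \<not> (p1 u \<in> elts (p1 m) \<or> (p1 u = p1 m \<and> p2 u \<in> elts (p2 m)))"
proof -
  have s1: "small (p1 ` S)" by (rule small_image[OF S(1) dtm_p10])
  have n1: "p1 ` S \<noteq> {}" using S(3) by blast
  obtain v where v: "v \<in> p1 ` S" "elts v \<inter> p1 ` S = {}"
    using small_foundation[OF s1 n1] by blast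
  have vM: "v \<in> M" using v small_M[OF s1] by blast
  let ?T = "{u \<in> S. p1 u = v}"
  have "small ?T" by (intro small_sep S dfn_intros vM)
  then have s2: "small (p2 ` ?T)" by (rule small_image[OF _ dtm_p20])
  have n2: "p2 ` ?T \<noteq> {}" using v by blast
  obtain w where w: "w \<in> p2 ` ?T" "elts w \<inter> p2 ` ?T = {}"
    using small_foundation[OF s2 n2] by blast
  then obtain m where m: "m \<in> S" "p1 m = v" "p2 m = w" by blast
  have "\<not> (p1 u \<in> elts v \<or> (p1 u = v \<and> p2 u \<in> elts w))" if "u \<in> S" for u
    using v(2) w(2) that by blast
  then show ?thesis using m by blast
qed

text \<open>Every proper initial segment of the lexicographic order on \<open>a \<times> l\<close> is smaller than \<open>a\<close>, so the
  order type is at most \<open>a\<close>.\<close>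

lemma lep_cprod_cardinal:
  assumes l: "ordinal l" and two: "zero \<in> elts l" "t \<in> elts l" "t \<noteq> zero"
    and a: "cardinal a" "l \<in> elts a"
    and IH: "\<And>y. y \<in> elts a \<Longrightarrow> elts l \<subseteq> elts y \<Longrightarrow> lep (cprod y l) y"
  shows "lep (cprod a l) a"
proof -
  have oa: "ordinal a" "a \<in> M" using a ordinal_M unfolding cardinal_def by auto
  have lM: "l \<in> M" by (rule ordinal_M[OF l])
  have nosucc: "succ x \<in> elts a" if x: "x \<in> elts a" for x
  proof (rule ccontr)
    assume "succ x \<notin> elts a"
    then have ax: "a = succ x" using ordinal_succ_cases[OF oa(1) x] by blast
    have xM: "x \<in> M" and ox: "ordinal x" using x elts_M ordinal_mem[OF oa(1)] by blast+
    have lx: "elts l \<subseteq> elts x" using a(2) ordinal_subset_iff[OF l ox] unfolding ax elts_succ[OF xM] by blast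
    have zx: "zero \<in> elts x" using lx two by blast
    have tM: "t \<in> M" using two elts_M by blast
    \<comment> \<open>Were \<open>a\<close> the successor of \<open>x\<close>, two elements of
      \<open>l\<close> would give room for the additional point \<open>x\<close>: \<open>a\<close>
      injects into x x l and, by \<open>IH\<close>, into \<open>x\<close>, which contradicts that
      \<open>a\<close> is a cardinal.\<close>
    define F where "F y = (if y = x then pr zero t else pr y zero)" for y
    have "lep a (cprod x l)"
    proof (rule lepI[OF oa(2), of F])
      show "dtm (\<lambda>e. F (e 0))" unfolding F_def by (intro dfn_intros xM tM zero_in)
      show "F y \<in> elts (cprod x l)" if "y \<in> elts a" for y
        using that cprodI[OF xM lM] zx two unfolding F_def ax elts_succ[OF xM] by auto
      show "inj_on F (elts a)"
        using tM two(3) elts_M unfolding F_def inj_on_def by (auto simp: pr_eq_iff split: if_splits)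
    qed
    then have "lep a x" using lep_trans[OF oa(2)] IH[OF x lx] by blast
    then show False using cardinal_not_lep[OF a(1) x] by blast
  qed
  let ?X = "cprod a l"
  let ?R = "\<lambda>u v. p1 u \<in> elts (p1 v) \<or> (p1 u = p1 v \<and> p2 u \<in> elts (p2 v))"
  have R: "dfn (\<lambda>e. ?R (e 0) (e 1))" by (intro dfn_intros)
  have lin: "?R u v \<or> u = v \<or> ?R v u" if u: "u \<in> elts ?X" and v: "v \<in> elts ?X" for u v
  proof -
    obtain x i where x: "x \<in> elts a" "i \<in> elts l" "u = pr x i" "x \<in> M" "i \<in> M" by (rule cprodE[OF u oa(2) lM])
    obtain y j where y: "y \<in> elts a" "j \<in> elts l" "v = pr y j" "y \<in> M" "j \<in> M" by (rule cprodE[OF v oa(2) lM])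
    have "x \<in> elts y \<or> x = y \<or> y \<in> elts x" "i \<in> elts j \<or> i = j \<or> j \<in> elts i"
      using ordinal_linear ordinal_mem[OF oa(1)] ordinal_mem[OF l] x y by blast+
    then show ?thesis using x y by (auto simp: p1_pr p2_pr)
  qed
  obtain \<gamma> c where c: "ordinal \<gamma>" "c \<in> M" "bij_betw (app c) (elts ?X) (elts \<gamma>)"
    "\<And>v. v \<in> elts ?X \<Longrightarrow> elts (app c v) = app c ` {u \<in> elts ?X. ?R u v}"
    by (rule collapse[where R = ?R, OF cprod_in R])
      (rule lex_wf[OF oa(2) lM], assumption+, rule lin, assumption+, rule that)
  have "a \<notin> elts \<gamma>"
  proof
    assume "a \<in> elts \<gamma>"
    then obtain v where v: "v \<in> elts ?X" "app c v = a" using c(3) unfolding bij_betw_iff_ball by metis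
    obtain x i where x: "x \<in> elts a" "i \<in> elts l" "v = pr x i" "x \<in> M" "i \<in> M" by (rule cprodE[OF v(1) oa(2) lM])
    \<comment> \<open>Lexicographic predecessors of the pair (x, i) have first coordinate at most
      \<open>x\<close>.\<close>
    have sub: "{u \<in> elts ?X. ?R u v} \<subseteq> elts (cprod (succ x) l)"
    proof
      fix u assume u: "u \<in> {u \<in> elts ?X. ?R u v}"
      then obtain y j where y: "y \<in> elts a" "j \<in> elts l" "u = pr y j" "y \<in> M" "j \<in> M"
        using cprodE[OF _ oa(2) lM] by blast
      have "y \<in> elts x \<or> y = x" using u x y by (auto simp: p1_pr p2_pr)
      then have "y \<in> elts (succ x)" using elts_succ[OF x(4)] by blast
      then show "u \<in> elts (cprod (succ x) l)" using y cprodI[OF succ_in lM] by blast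
    qed
    have "elts a = app c ` {u \<in> elts ?X. ?R u v}" using c(4)[OF v(1)] v(2) by simp
    then have "elts a \<subseteq> app c ` elts (cprod (succ x) l)" using sub by blast
    moreover have "dtm (\<lambda>e. app c (e 0))" by (intro dfn_intros c)
    ultimately have 1: "lep a (cprod (succ x) l)" using surj_lep[OF cprod_in oa(2)] by blast
    have os: "ordinal (succ x)" "succ x \<in> elts a" using nosucc[OF x(1)] ordinal_mem[OF oa(1)] by blast+
    \<comment> \<open>The larger of \<open>l\<close> and \<open>succ x\<close>: \<open>IH\<close>
      applies only from \<open>l\<close> on.\<close>
    obtain y where y: "y \<in> elts a" "elts l \<subseteq> elts y" "elts (succ x) \<subseteq> elts y"
      using ordinal_linear[OF os(1) l] ordinal_subset_iff[OF os(1) l] ordinal_subset_iff[OF l os(1)] os(2) a(2)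
      by blast
    have yM: "y \<in> M" using y elts_M by blast
    have "lep (cprod (succ x) l) (cprod y l)"
      by (intro lep_cprod succ_in lM yM lep_subset) (use y in auto)
    then have "lep a (cprod y l)" using lep_trans[OF oa(2) 1] by blast
    then have "lep a y" using lep_trans[OF oa(2)] IH[OF y(1,2)] by blast
    then show False using cardinal_not_lep[OF a(1) y(1)] by blast
  qed
  then have sub: "elts \<gamma> \<subseteq> elts a" using ordinal_not_mem[OF oa(1) c(1)] by blast
  have "eqp ?X \<gamma>" unfolding eqp_iff_bij using c by blast
  then show ?thesis using lep_trans[OF cprod_in eqp_lep lep_subset[OF ordinal_M[OF c(1)] sub]] by blast
qed

text \<open>Closing \<open>P\<close> under pairing gives a set \<open>L\<close> containing L x L,
  and a well-ordering of \<open>L\<close> gives \<open>l\<close>, to which \<open>P\<close> injects.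
  Absorption of the factor \<open>l\<close> by larger \<open>a\<close> is proved by induction: the
  lexicographic order settles the case of a cardinal, and any other \<open>a\<close> is equipotent
  to a smaller ordinal.\<close>

theorem absorbing_ordinal_ex:
  assumes P: "P \<in> M"
  obtains l where "ordinal l" "lep P l" "\<And>a. ordinal a \<Longrightarrow> elts l \<subseteq> elts a \<Longrightarrow> lep (cprod a P) a"
proof -
  \<comment> \<open>The two added elements ensure that \<open>l\<close> has a nonzero element, as
    \<open>lep_cprod_cardinal\<close> requires.\<close>
  have s1: "small (elts P \<union> {zero, succ zero})" by (intro small_Un small_pair small_elts P zero_in succ_in)
  define X where "X = mk (elts P \<union> {zero, succ zero})"
  have eX: "elts X = elts P \<union> {zero, succ zero}" unfolding X_def by (rule elts_mk[OF s1])
  define s where "s u = mk (elts u \<union> {z. \<exists>x\<in>elts u. \<exists>y\<in>elts u. z = pr x y})" for u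
  have es: "elts (s u) = elts u \<union> {z. \<exists>x\<in>elts u. \<exists>y\<in>elts u. z = pr x y}" if "u \<in> M" for u
    unfolding s_def by (intro elts_mk small_Un small_times small_elts that)
  have s0: "dtm (\<lambda>e. s (e 0))" unfolding s_def by (intro dfn_intros)
  have XM: "X \<in> M" unfolding X_def by simp
  obtain L where L: "L \<in> M" "elts X \<subseteq> elts L"
    "\<forall>a\<in>elts L. \<forall>b\<in>elts L. \<exists>u\<in>M. a \<in> elts u \<and> b \<in> elts u \<and> elts (s u) \<subseteq> elts L"
    using closure_ex[OF s0 XM] es by blast
  have LL: "elts (cprod L L) \<subseteq> elts L"
  proof
    fix z assume "z \<in> elts (cprod L L)"
    then obtain x y where xy: "x \<in> elts L" "y \<in> elts L" "z = pr x y" using cprodE[OF _ L(1) L(1)] by metis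
    then obtain u where "u \<in> M" "x \<in> elts u" "y \<in> elts u" "elts (s u) \<subseteq> elts L" using L(3) by blast
    then show "z \<in> elts L" using es[of u] xy(3) by blast
  qed
  obtain l h where h: "ordinal l" "h \<in> M" "bij_betw (app h) (elts l) (elts L)" by (rule well_ordering[OF L(1)])
  have lM: "l \<in> M" by (rule ordinal_M[OF h(1)])
  have e1: "eqp l L" unfolding eqp_iff_bij using h by blast
  have e2: "eqp L l" by (rule eqp_sym[OF L(1) lM e1])
  have Pl: "lep P l" using lep_trans[OF P lep_subset[OF P] eqp_lep[OF e2]] L(2) eX by blast
  have "lep (cprod l l) (cprod L L)" by (intro lep_cprod lM L(1) eqp_lep e1)
  then have "lep (cprod l l) L" using lep_trans[OF cprod_in _ lep_subset[OF cprod_in LL]] by blast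
  then have ll: "lep (cprod l l) l" using lep_trans[OF cprod_in _ eqp_lep[OF e2]] by blast
  have "zero \<in> elts L" "succ zero \<in> elts L" "zero \<noteq> succ zero"
    using L(2) eX elts_succ[OF zero_in] elts_zero by auto
  then obtain t1 t2 where t: "t1 \<in> elts l" "t2 \<in> elts l" "t1 \<noteq> t2"
    using h(3) unfolding bij_betw_iff_ball by metis
  have z: "zero \<in> elts l" using zero_mem[OF h(1)] t by blast
  obtain t where t: "t \<in> elts l" "t \<noteq> zero" using t by metis
  have main: "lep (cprod a l) a" if a: "ordinal a" "elts l \<subseteq> elts a" for a
  proof -
    have "elts l \<subseteq> elts a \<longrightarrow> lep (cprod a l) a"
    proof (rule ord_induct[where x = a and P = "\<lambda>a. elts l \<subseteq> elts a \<longrightarrow> lep (cprod a l) a"])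
      have "dtm (\<lambda>e. cprod (e 0) l)" unfolding cprod_def by (intro dfn_intros lM)
      then show "dfn (\<lambda>e. elts l \<subseteq> elts (e 0) \<longrightarrow> lep (cprod (e 0) l) (e 0))" by (intro dfn_intros lM)
      fix a assume a: "ordinal a" and IH: "\<And>y. y \<in> elts a \<Longrightarrow> elts l \<subseteq> elts y \<longrightarrow> lep (cprod y l) y"
      have aM: "a \<in> M" by (rule ordinal_M[OF a])
      show "elts l \<subseteq> elts a \<longrightarrow> lep (cprod a l) a"
      proof
        assume la: "elts l \<subseteq> elts a"
        consider "a = l" | "l \<in> elts a" "cardinal a" | x where "l \<in> elts a" "x \<in> elts a" "eqp x a"
          using la ordinal_subset_iff[OF h(1) a] cardinal_iff a by blast
        then show "lep (cprod a l) a"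
        proof cases
          case 1
          then show ?thesis using ll by simp
        next
          case 2
          then show ?thesis using lep_cprod_cardinal[OF h(1) z t] IH by blast
        next
          case (3 x)
          have ox: "ordinal x" "x \<in> M" using 3 ordinal_mem[OF a] elts_M by blast+
          have ax: "lep a x" by (rule eqp_lep[OF eqp_sym[OF aM ox(2) 3(3)]])
          obtain y where y: "y \<in> elts a" "elts l \<subseteq> elts y" "elts x \<subseteq> elts y"
            using ordinal_linear[OF ox(1) h(1)] ordinal_subset_iff[OF ox(1) h(1)] ordinal_subset_iff[OF h(1) ox(1)] 3
            by blast
          have yM: "y \<in> M" using y elts_M by blast
          have "lep a y" by (rule lep_trans[OF aM ax lep_subset[OF ox(2) y(3)]])
          then have "lep (cprod a l) (cprod y l)" by (rule lep_cprod[OF aM lM yM lM _ lep_subset[OF lM subset_refl]])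
          then have "lep (cprod a l) y" using lep_trans[OF cprod_in] IH[OF y(1)] y(2) by blast
          moreover have "elts y \<subseteq> elts a" using ordinal_trans[OF a y(1)] by blast
          ultimately show ?thesis using lep_trans[OF cprod_in] lep_subset[OF yM] by blast
        qed
      qed
    qed (rule a(1))
    then show ?thesis using a by blast
  qed
  show ?thesis
  proof (rule that[OF h(1) Pl])
    fix a assume a: "ordinal a" "elts l \<subseteq> elts a"
    note aM = ordinal_M[OF a(1)]
    have "lep (cprod a P) (cprod a l)" by (rule lep_cprod[OF aM P aM lM lep_subset[OF aM subset_refl] Pl])
    then show "lep (cprod a P) a" using lep_trans[OF cprod_in] main[OF a] by blast
  qed
qed

section \<open>Power sets, well-foundedness of names and the shifted coding points\<close>

lemma lep_pow:
  assumes X: "X \<in> M" and Y: "Y \<in> M" and "lep X Y"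
  shows "lep (pow X) (pow Y)"
proof -
  obtain f where f: "f \<in> M" "\<forall>x\<in>elts X. app f x \<in> elts Y"
    "\<forall>x\<in>elts X. \<forall>y\<in>elts X. app f x = app f y \<longrightarrow> x = y" using assms(3) unfolding lep_def by blast
  define F where "F S = mk (app f ` elts S)" for S
  have F: "elts (F S) = app f ` elts S" if "S \<in> M" for S
    unfolding F_def by (rule elts_mk, rule small_image[OF small_elts[OF that]]) (intro dfn_intros f)
  show ?thesis
  proof (rule lepI[OF pow_in, of F])
    show "dtm (\<lambda>e. F (e 0))" unfolding F_def by (intro dfn_intros f)
    show "F S \<in> elts (pow Y)" if "S \<in> elts (pow X)" for S
      using that F[of S] f(2) unfolding elts_pow[OF X] elts_pow[OF Y] by (auto simp: F_def)
    show "inj_on F (elts (pow X))"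
    proof (rule inj_onI)
      fix S T assume S: "S \<in> elts (pow X)" and T: "T \<in> elts (pow X)" and eq: "F S = F T"
      have M: "S \<in> M" "T \<in> M" "elts S \<subseteq> elts X" "elts T \<subseteq> elts X" using S T unfolding elts_pow[OF X] by auto
      have "inj_on (app f) (elts X)" using f(3) unfolding inj_on_def by blast
      moreover have "app f ` elts S = app f ` elts T" using F M eq by metis
      ultimately have "elts S = elts T" using inj_on_image_eq_iff M by blast
      then show "S = T" using M elts_ext by blast
    qed
  qed
qed

text \<open>Since \<open>y \<in> {y} \<in> (y, p) \<in> m\<close>, Foundation applies once these singletons and pairs are added to
  \<open>S\<close>.\<close>

lemma name_wf:
  assumes S: "small S" "S \<noteq> {}"
  shows "\<exists>m\<in>S. \<forall>y\<in>S. \<not> (\<exists>p\<in>M. pr y p \<in> elts m)"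
proof -
  obtain S' where S': "S' \<in> M" "elts S' = S" using S unfolding small_def by blast
  let ?P = "{z \<in> (\<Union>m\<in>S. elts m). \<exists>y\<in>elts S'. \<exists>p\<in>M. z = pr y p}"
  let ?Q = "(\<lambda>y. mk {y}) ` S"
  have "small ?P" by (intro small_sep small_Union_elts S dfn_intros S')
  moreover have "small ?Q" by (rule small_image[OF S(1)]) (intro dfn_intros)
  ultimately have sU: "small (S \<union> ?P \<union> ?Q)" using S(1) by (intro small_Un)
  have ne: "S \<union> ?P \<union> ?Q \<noteq> {}" using S(2) by simp
  from small_foundation[OF sU ne] obtain m where m: "m \<in> S \<union> ?P \<union> ?Q" "elts m \<inter> (S \<union> ?P \<union> ?Q) = {}"
    by (rule bexE)
  have no: "y \<notin> S" "y \<notin> ?P" "y \<notin> ?Q" if "y \<in> elts m" for y using m(2) that by blast+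
  have SM: "y \<in> M" if "y \<in> S" for y using small_M[OF S(1)] that by blast
  have "m \<notin> ?Q"
  proof
    assume "m \<in> ?Q"
    then obtain y where y: "y \<in> S" "m = mk {y}" by blast
    then have "y \<in> elts m" using elts_mk[OF small_single[OF SM[OF y(1)]]] by simp
    then show False using no(1) y by blast
  qed
  moreover have "m \<notin> ?P"
  proof
    assume "m \<in> ?P"
    then obtain y p where y: "y \<in> S" "p \<in> M" "m = pr y p" using S'(2) by blast
    then have "mk {y} \<in> elts m" using elts_pr[OF SM[OF y(1)] y(2)] by simp
    then show False using no(3) y(1) by blast
  qed
  ultimately have mS: "m \<in> S" using m(1) by blast
  have "\<not> (\<exists>p\<in>M. pr y p \<in> elts m)" if "y \<in> S" for y
  proof
    assume "\<exists>p\<in>M. pr y p \<in> elts m"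
    then obtain p where p: "p \<in> M" "pr y p \<in> elts m" by blast
    then have "pr y p \<in> ?P" using that mS S'(2) by blast
    then show False using no(2)[OF p(2)] by blast
  qed
  then show ?thesis using mS by blast
qed

text \<open>Cantor's theorem provides the other inequality, so verifying an instance of GCH amounts
  to an upper bound.\<close>

lemma eqp_pow_cs:
  assumes k: "ordinal k" and le: "lep (pow k) (cs k)"
  shows "eqp (pow k) (cs k)"
proof -
  obtain m where m: "cardinal m" "eqp (pow k) m" by (rule cardinal_ex[OF pow_in])
  have om: "ordinal m" "m \<in> M" using m(1) ordinal_M unfolding cardinal_def by auto
  have "lep m (cs k)" using lep_trans[OF om(2) eqp_lep[OF eqp_sym[OF om(2) pow_in m(2)]] le] .
  then have "elts m \<subseteq> elts (cs k)" by (rule cardinal_le[OF m(1) cs_props(3)[OF k]])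
  moreover have "elts (cs k) \<subseteq> elts m" by (rule cs_props(5)[OF k m(1) mem_cardinal_of_pow[OF k m]])
  ultimately have "m = cs k" using elts_ext[OF om(2) cs_in] by blast
  then show ?thesis using m by simp
qed

lemma iter_cs_ge_base:
  assumes z: "ordinal z" and b: "ordinal b"
  shows "elts z \<subseteq> elts (iter_cs z b)"
proof (cases "elts b = {}")
  case True
  then show ?thesis using it_0[OF dtm_cs0 ordinal_M[OF z] b] by simp
next
  case False
  have "elts (iter_cs z zero) \<subseteq> elts (iter_cs z b)"
    by (rule it_mono[OF dtm_cs0 ordinal_M[OF z] _ b zero_mem[OF b False]])
      (rule cs_props(4)[OF iter_cs_ordinal[OF z]])
  then show ?thesis using it_0[OF dtm_cs0 ordinal_M[OF z] ordinal_zero] by simp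
qed

lemma CCA_E:
  assumes CCA and "ordinal \<alpha>" "a \<in> M" "elts a \<subseteq> elts \<alpha>"
  obtains \<theta> where "ordinal \<theta>" "\<And>\<beta>. \<beta> \<in> elts \<alpha> \<Longrightarrow> \<beta> \<in> elts a \<longleftrightarrow> GCH_at (succ (oadd \<theta> \<beta>))"
proof -
  obtain \<theta> where t: "\<theta> \<in> M" "ordinal \<theta>" "\<forall>\<beta>\<in>elts \<alpha>. \<beta> \<in> elts a \<longleftrightarrow>
        (\<exists>\<sigma>\<in>M. \<exists>\<xi>\<in>M. is_ord_add \<theta> \<beta> \<sigma> \<and> is_succ \<sigma> \<xi> \<and> GCH_at \<xi>)"
    using assms ordinal_M[OF assms(2)] unfolding CCA_def by blast
  have "(\<exists>\<sigma>\<in>M. \<exists>\<xi>\<in>M. is_ord_add \<theta> \<beta> \<sigma> \<and> is_succ \<sigma> \<xi> \<and> GCH_at \<xi>) \<longleftrightarrow> GCH_at (succ (oadd \<theta> \<beta>))"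
    if b: "\<beta> \<in> elts \<alpha>" for \<beta>
  proof -
    have ob: "ordinal \<beta>" by (rule ordinal_mem[OF assms(2) b])
    have oM: "oadd \<theta> \<beta> \<in> M" using oadd_ordinal[OF t(2) ob] ordinal_M by blast
    have "is_ord_add \<theta> \<beta> \<sigma> \<longleftrightarrow> \<sigma> = oadd \<theta> \<beta>" if "\<sigma> \<in> M" for \<sigma>
      using is_ord_add_iff[OF t(2) that] ob by blast
    moreover have "is_succ (oadd \<theta> \<beta>) \<xi> \<longleftrightarrow> \<xi> = succ (oadd \<theta> \<beta>)" if "\<xi> \<in> M" for \<xi>
      by (rule is_succ_iff[OF oM that])
    ultimately show ?thesis using oM succ_in[of "oadd \<theta> \<beta>"] by metis
  qed
  then show ?thesis using that[OF t(2)] t(3) by blast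
qed

text \<open>Associates the index as (\<theta> + l) + \<beta> + 1, so that everything concerning
  \<theta> is condensed into the single ordinal \<open>z\<close>.\<close>

lemma GCH_at_shifted:
  assumes "ordinal \<theta>" "ordinal l" "ordinal \<beta>" and z: "z = iter_cs (iter_cs \<omega> \<theta>) l"
    and k: "k = cs (iter_cs z \<beta>)"
  shows "GCH_at (succ (oadd \<theta> (oadd l \<beta>))) \<longleftrightarrow> eqp (pow k) (cs k)"
proof -
  note w = omega_ordinal
  have o: "ordinal (oadd l \<beta>)" "ordinal (oadd \<theta> (oadd l \<beta>))"
    using oadd_ordinal assms by blast+
  have "iter_cs \<omega> (succ (oadd \<theta> (oadd l \<beta>))) = cs (iter_cs \<omega> (oadd \<theta> (oadd l \<beta>)))"
    by (rule it_succ[OF dtm_cs0 ordinal_M[OF w] o(2)])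
  also have "iter_cs \<omega> (oadd \<theta> (oadd l \<beta>)) = iter_cs (iter_cs \<omega> \<theta>) (oadd l \<beta>)"
    by (rule iter_cs_oadd[OF w assms(1) o(1)])
  also have "\<dots> = iter_cs z \<beta>"
    unfolding z by (rule iter_cs_oadd[OF iter_cs_ordinal[OF w assms(1)] assms(2,3)])
  finally have "iter_cs \<omega> (succ (oadd \<theta> (oadd l \<beta>))) = k" using k by simp
  then show ?thesis unfolding GCH_at_iff using ordinal_succ[OF o(2)] by simp
qed

end

subsection \<open>Transitive inner models\<close>

locale inner_models = V: zfc_model M E + W: zfc_model W E
  for M :: "'a set" and W :: "'a set" and E :: "'a \<Rightarrow> 'a \<Rightarrow> bool" +
  assumes sub: "W \<subseteq> M" and tr: "x \<in> W \<Longrightarrow> V.elts x \<subseteq> W" and ords: "V.ordinal x \<Longrightarrow> x \<in> W"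
begin

lemma WM: "x \<in> W \<Longrightarrow> x \<in> M"
  using sub by blast

lemma elts_W: "x \<in> W \<Longrightarrow> W.elts x = V.elts x"
  using sub tr[of x] by (auto simp: V.elts_def W.elts_def)

lemma elts_inW: "x \<in> W \<Longrightarrow> y \<in> V.elts x \<Longrightarrow> y \<in> W"
  using tr by blast

lemma small_W: "W.small X \<Longrightarrow> V.small X"
  unfolding W.small_def V.small_def using elts_W WM by metis

lemma mk_W: "W.small X \<Longrightarrow> W.mk X = V.mk X"
  using V.mk_eq[of "W.mk X" X] W.elts_mk[of X] elts_W[OF W.mk_in] WM[OF W.mk_in] by metis

lemma W_mk: assumes "W.small X" shows "V.mk X \<in> W" "V.elts (V.mk X) = X"
  using mk_W[OF assms] W.mk_in V.elts_mk[OF small_W[OF assms]] by metis+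

lemma the1_W:
  assumes "\<And>y. y \<in> W \<Longrightarrow> Q y \<longleftrightarrow> R y" "\<And>y. y \<in> M \<Longrightarrow> R y \<Longrightarrow> y \<in> W"
  shows "W.the1 Q = V.the1 R"
proof -
  have eq: "(y \<in> W \<and> Q y) \<longleftrightarrow> (y \<in> M \<and> R y)" for y using assms sub by blast
  obtain c where c: "c \<in> W" "W.elts c = {}" using W.empty_ex by blast
  have "(c' \<in> W \<and> W.elts c' = {}) \<longleftrightarrow> (c' \<in> M \<and> V.elts c' = {})" for c'
    using c elts_W WM V.elts_ext by metis
  then show ?thesis unfolding W.the1_def V.the1_def eq by simp
qed

lemma single_W: "x \<in> W \<Longrightarrow> W.mk {x} = V.mk {x}" and pair_W: "x \<in> W \<Longrightarrow> y \<in> W \<Longrightarrow> W.mk {x, y} = V.mk {x, y}"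
  by (auto intro!: mk_W W.small_single W.small_pair)

lemma pr_W: "x \<in> W \<Longrightarrow> y \<in> W \<Longrightarrow> W.pr x y = V.pr x y"
  unfolding W.pr_def V.pr_def
  using mk_W[OF W.small_pair[OF W.mk_in W.mk_in], of "{x}" "{x, y}"] by (simp add: single_W pair_W)

lemma pr_W_parts:
  assumes "V.pr x y \<in> W" "x \<in> M" "y \<in> M"
  shows "x \<in> W" "y \<in> W"
proof -
  have "V.mk {x, y} \<in> V.elts (V.pr x y)" using V.elts_pr assms by blast
  then have "V.mk {x, y} \<in> W" using elts_inW assms(1) by blast
  then have "V.elts (V.mk {x, y}) \<subseteq> W" using tr by blast
  then show "x \<in> W" "y \<in> W" using V.elts_mk[OF V.small_pair[OF assms(2,3)]] by auto
qed

text \<open>Holds also where \<open>f\<close> has no unique value at \<open>x\<close>: by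
  transitivity \<open>M\<close> has no candidates outside \<open>W\<close>, and the default value is
  the same in both models.\<close>

lemma app_W: assumes "f \<in> W" "x \<in> W" shows "W.app f x = V.app f x"
  unfolding W.app_def V.app_def
proof (rule the1_W)
  show "W.pr x y \<in> W.elts f \<longleftrightarrow> V.pr x y \<in> V.elts f" if "y \<in> W" for y
    using assms that by (simp add: pr_W elts_W)
  show "y \<in> W" if "y \<in> M" "V.pr x y \<in> V.elts f" for y
    using pr_W_parts(2) elts_inW[OF assms(1) that(2)] that(1) WM[OF assms(2)] by blast
qed

lemma succ_W: "x \<in> W \<Longrightarrow> W.succ x = V.succ x"
  unfolding W.succ_def V.succ_def
  using mk_W[OF W.small_insert[OF _ W.small_elts], of x x] by (simp add: elts_W)

text \<open>Rules to prove definability over \<open>W\<close> of statements phrased with the operations of \<open>M\<close>.\<close>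

lemma W_env: "W.dtm t \<Longrightarrow> range e \<subseteq> W \<Longrightarrow> t e \<in> W"
  by (rule W.dtm_in)

lemma W_dfn_elts [dfn_intros]: "W.dtm t \<Longrightarrow> W.dtm u \<Longrightarrow> W.dfn (\<lambda>e. t e \<in> V.elts (u e))"
  by (rule W.dfn_cong[OF W.dfn_elts[of t u]]) (auto simp: elts_W W_env)

lemma W_dfn_ball [dfn_intros]:
  "W.dtm t \<Longrightarrow> W.dfn (\<lambda>e. Q (e 0) (\<lambda>n. e (Suc n))) \<Longrightarrow> W.dfn (\<lambda>e. \<forall>x\<in>V.elts (t e). Q x e)"
  by (rule W.dfn_cong[OF W.dfn_ball[of t Q]]) (auto simp: elts_W W_env)

lemma W_dfn_bex [dfn_intros]:
  "W.dtm t \<Longrightarrow> W.dfn (\<lambda>e. Q (e 0) (\<lambda>n. e (Suc n))) \<Longrightarrow> W.dfn (\<lambda>e. \<exists>x\<in>V.elts (t e). Q x e)"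
  by (rule W.dfn_cong[OF W.dfn_bex[of t Q]]) (auto simp: elts_W W_env)

lemma W_dtm_cong: assumes "W.dtm t" "\<And>e. range e \<subseteq> W \<Longrightarrow> t e = u e" shows "W.dtm u"
proof -
  have "W.dfn (\<lambda>e. e 0 = u (\<lambda>n. e (Suc n)))"
  proof (rule W.dfn_cong)
    show "W.dfn (\<lambda>e. e 0 = t (\<lambda>n. e (Suc n)))" using assms(1) unfolding W.dtm_def by blast
    fix e :: "nat \<Rightarrow> 'a" assume "range e \<subseteq> W"
    then have "t (\<lambda>n. e (Suc n)) = u (\<lambda>n. e (Suc n))" by (intro assms(2)) auto
    then show "(e 0 = u (\<lambda>n. e (Suc n))) = (e 0 = t (\<lambda>n. e (Suc n)))" by simp
  qed
  moreover have "u e \<in> W" if "range e \<subseteq> W" for e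
    using W.dtm_in[OF assms(1) that] assms(2)[OF that] by simp
  ultimately show ?thesis unfolding W.dtm_def by blast
qed

lemma W_dtm_pr [dfn_intros]: "W.dtm t \<Longrightarrow> W.dtm u \<Longrightarrow> W.dtm (\<lambda>e. V.pr (t e) (u e))"
  by (rule W_dtm_cong[OF W.dtm_pr[of t u]]) (auto simp: pr_W W_env)

lemma W_dtm_app [dfn_intros]: "W.dtm t \<Longrightarrow> W.dtm u \<Longrightarrow> W.dtm (\<lambda>e. V.app (t e) (u e))"
  by (rule W_dtm_cong[OF W.dtm_app[of t u]]) (auto simp: app_W W_env)

lemma W_small_sep: "X \<in> W \<Longrightarrow> W.dfn (\<lambda>e. Q (e 0)) \<Longrightarrow> W.small {x \<in> V.elts X. Q x}"
  using W.small_sep[OF W.small_elts] by (simp add: elts_W)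

lemma W_small_prod:
  assumes X: "X \<in> W" and Y: "Y \<in> W" and Q: "W.dfn (\<lambda>e. Q (e 0) (e 1))"
  shows "W.small {u. \<exists>x\<in>V.elts X. \<exists>y\<in>V.elts Y. u = V.pr x y \<and> Q x y}"
proof -
  note [dfn_intros] = W.dfn_comp2[where R = Q, OF Q]
  have "W.small {u \<in> V.elts (W.cprod X Y). \<exists>x\<in>V.elts X. \<exists>y\<in>V.elts Y. u = V.pr x y \<and> Q x y}"
    by (intro W_small_sep W.cprod_in dfn_intros X Y)
  moreover have "V.pr x y \<in> V.elts (W.cprod X Y)" if "x \<in> V.elts X" "y \<in> V.elts Y" for x y
    using W.cprodI[OF X Y, of x y] that elts_inW[OF X] elts_inW[OF Y]
    by (simp add: elts_W X Y pr_W)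
  then have "{u \<in> V.elts (W.cprod X Y). \<exists>x\<in>V.elts X. \<exists>y\<in>V.elts Y. u = V.pr x y \<and> Q x y} =
    {u. \<exists>x\<in>V.elts X. \<exists>y\<in>V.elts Y. u = V.pr x y \<and> Q x y}" by blast
  ultimately show ?thesis by simp
qed

lemma pr_mem_prod:
  assumes "X \<in> M" "Y \<in> M" "x \<in> V.elts X" "y \<in> V.elts Y"
  shows "V.pr x y \<in> {u. \<exists>x\<in>V.elts X. \<exists>y\<in>V.elts Y. u = V.pr x y \<and> Q x y} \<longleftrightarrow> Q x y"
proof
  assume "V.pr x y \<in> {u. \<exists>x\<in>V.elts X. \<exists>y\<in>V.elts Y. u = V.pr x y \<and> Q x y}"
  then obtain x' y' where xy: "x' \<in> V.elts X" "y' \<in> V.elts Y" "V.pr x y = V.pr x' y'" "Q x' y'" by blast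
  then have "x = x'" "y = y'" using V.pr_eq_iff assms V.elts_M by metis+
  then show "Q x y" using xy by simp
qed (use assms in blast)

lemma ordinal_W: "W.ordinal x \<longleftrightarrow> V.ordinal x"
proof (cases "x \<in> W")
  case True
  then have "W.elts y = V.elts y" if "y \<in> V.elts x" for y
    using elts_W elts_inW that by blast
  then show ?thesis using True WM unfolding W.ordinal_iff V.ordinal_iff elts_W[OF True] by auto
next
  case False
  then show ?thesis using ords W.ordinal_M by blast
qed

lemma limit_W: "W.limit_ordinal x \<longleftrightarrow> V.limit_ordinal x"
proof (cases "V.ordinal x")
  case True
  then have x: "x \<in> W" by (rule ords)
  have "W.succ y = V.succ y" if "y \<in> V.elts x" for y using succ_W elts_inW[OF x that] by blast
  then show ?thesis unfolding W.limit_ordinal_iff V.limit_ordinal_iff ordinal_W elts_W[OF x] by auto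
next
  case False
  then show ?thesis unfolding W.limit_ordinal_iff V.limit_ordinal_iff ordinal_W by blast
qed

lemma lep_W: assumes "X \<in> W" "Y \<in> W" "W.lep X Y" shows "V.lep X Y"
proof -
  obtain f where f: "f \<in> W" "\<forall>x\<in>V.elts X. W.app f x \<in> V.elts Y"
    "\<forall>x\<in>V.elts X. \<forall>y\<in>V.elts X. W.app f x = W.app f y \<longrightarrow> x = y"
    using assms(3) unfolding W.lep_def elts_W[OF assms(1)] elts_W[OF assms(2)] by blast
  have a: "W.app f x = V.app f x" if "x \<in> V.elts X" for x
    by (rule app_W[OF f(1) elts_inW[OF assms(1) that]])
  show ?thesis unfolding V.lep_def using f WM[OF f(1)] a by (intro bexI[of _ f]) auto
qed

lemma eqp_W: assumes "X \<in> W" "Y \<in> W" "W.eqp X Y" shows "V.eqp X Y"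
proof -
  obtain f where f: "f \<in> W" "bij_betw (W.app f) (V.elts X) (V.elts Y)"
    using assms(3) unfolding W.eqp_iff_bij elts_W[OF assms(1)] elts_W[OF assms(2)] by blast
  have "W.app f x = V.app f x" if "x \<in> V.elts X" for x
    by (rule app_W[OF f(1) elts_inW[OF assms(1) that]])
  then have "bij_betw (V.app f) (V.elts X) (V.elts Y)" using f(2) bij_betw_cong by metis
  then show ?thesis unfolding V.eqp_iff_bij using WM[OF f(1)] by blast
qed

lemma cardinal_down: assumes "V.cardinal k" shows "W.cardinal k"
proof -
  have k: "V.ordinal k" "k \<in> W" using assms ords unfolding V.cardinal_iff by auto
  have "\<not> W.eqp x k" if "x \<in> V.elts k" for x
    using eqp_W[OF elts_inW[OF k(2) that] k(2)] assms that unfolding V.cardinal_iff by blast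
  then show ?thesis unfolding W.cardinal_iff ordinal_W elts_W[OF k(2)] using k by blast
qed

text \<open>Taking \<omega> many unions in \<open>W\<close>. The forcing relation is defined for
  possible values from such a set, so that the elements of a possible value are possible values
  too.\<close>

lemma transitive_superset_ex:
  assumes X: "X \<in> W"
  obtains Y where "Y \<in> W" "V.elts X \<subseteq> V.elts Y" "\<And>y. y \<in> V.elts Y \<Longrightarrow> V.elts y \<subseteq> V.elts Y"
proof -
  define s where "s u = W.mk (W.elts u \<union> (\<Union>x\<in>W.elts u. W.elts x))" for u
  have s0: "W.dtm (\<lambda>e. s (e 0))" unfolding s_def by (intro dfn_intros)
  have es: "W.elts (s u) = W.elts u \<union> (\<Union>x\<in>W.elts u. W.elts x)" if "u \<in> W" for u
    unfolding s_def by (intro W.elts_mk W.small_Un W.small_elts W.small_Union_elts that)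
  obtain Y where Y: "Y \<in> W" "W.elts X \<subseteq> W.elts Y"
    "\<forall>a\<in>W.elts Y. \<forall>b\<in>W.elts Y. \<exists>u\<in>W. a \<in> W.elts u \<and> b \<in> W.elts u \<and> W.elts (s u) \<subseteq> W.elts Y"
    using W.closure_ex[OF s0 X] es by blast
  have "V.elts y \<subseteq> V.elts Y" if y: "y \<in> V.elts Y" for y
  proof -
    have y': "y \<in> W.elts Y" "y \<in> W" using y elts_W[OF Y(1)] elts_inW[OF Y(1)] by auto
    then obtain u where "u \<in> W" "y \<in> W.elts u" "W.elts (s u) \<subseteq> W.elts Y" using Y(3) by blast
    then have "W.elts y \<subseteq> W.elts Y" using es[of u] by blast
    then show ?thesis using elts_W[OF Y(1)] elts_W[OF y'(2)] by simp
  qed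
  then show ?thesis using that[OF Y(1)] Y(2) elts_W[OF Y(1)] elts_W[OF X] by simp
qed

end

subsection \<open>Forcing\<close>

locale forcing_extension = inner_models +
  fixes P L G
  assumes forcing: "W.forcing_notion P L"
    and G_M: "G \<in> M"
    and generic: "generic_filter M E W P L G"
    and ext: "M = generic_extension M E W P G"
begin

definition le :: "'a \<Rightarrow> 'a \<Rightarrow> bool" where
  "le p q \<longleftrightarrow> V.pr p q \<in> V.elts L"

lemma P_W: "P \<in> W" and L_W: "L \<in> W"
  using forcing unfolding W.forcing_notion_def by auto

lemma P_in: "p \<in> V.elts P \<Longrightarrow> p \<in> W"
  by (rule elts_inW[OF P_W])

lemma W_rel_iff: "p \<in> W \<Longrightarrow> q \<in> W \<Longrightarrow> W.rel L p q \<longleftrightarrow> le p q"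
  unfolding le_def by (simp add: W.rel_iff pr_W elts_W L_W)

lemma V_rel_iff: "p \<in> W \<Longrightarrow> q \<in> W \<Longrightarrow> V.rel L p q \<longleftrightarrow> le p q"
  unfolding le_def by (simp add: V.rel_iff WM)

lemma le_refl: "p \<in> V.elts P \<Longrightarrow> le p p"
  using forcing W_rel_iff P_in unfolding W.forcing_notion_def elts_W[OF P_W] by blast

lemma le_trans:
  assumes "p \<in> V.elts P" "q \<in> V.elts P" "r \<in> V.elts P" "le p q" "le q r"
  shows "le p r"
proof -
  have "W.rel L p q" "W.rel L q r" using assms W_rel_iff P_in by auto
  then have "W.rel L p r" using forcing assms(1-3) unfolding W.forcing_notion_def elts_W[OF P_W] by blast
  then show ?thesis using assms W_rel_iff P_in by auto
qed

lemma W_dfn_le [dfn_intros]: "W.dtm t \<Longrightarrow> W.dtm u \<Longrightarrow> W.dfn (\<lambda>e. le (t e) (u e))"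
  unfolding le_def by (intro dfn_intros L_W)

lemma filter: "V.filter_on P L G"
  using generic unfolding generic_filter_def by blast

lemma G_P: "p \<in> V.elts G \<Longrightarrow> p \<in> V.elts P"
  using filter unfolding V.filter_on_def by blast

lemma G_W: "p \<in> V.elts G \<Longrightarrow> p \<in> W"
  using G_P P_in by blast

lemma G_up: "p \<in> V.elts G \<Longrightarrow> q \<in> V.elts P \<Longrightarrow> le p q \<Longrightarrow> q \<in> V.elts G"
  using filter V_rel_iff G_W P_in unfolding V.filter_on_def by metis

lemma G_dir:
  assumes "p \<in> V.elts G" "q \<in> V.elts G"
  obtains r where "r \<in> V.elts G" "le r p" "le r q"
proof -
  have "\<forall>p\<in>V.elts G. \<forall>q\<in>V.elts G. \<exists>r\<in>V.elts G. V.rel L r p \<and> V.rel L r q"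
    using filter unfolding V.filter_on_def by blast
  then obtain r where "r \<in> V.elts G" "V.rel L r p" "V.rel L r q" using assms by blast
  then show ?thesis using that V_rel_iff G_W assms by metis
qed

lemma G_meets:
  assumes "D \<in> W" "V.elts D \<subseteq> V.elts P" "\<And>p. p \<in> V.elts P \<Longrightarrow> \<exists>d\<in>V.elts D. le d p"
  shows "\<exists>d\<in>V.elts D. d \<in> V.elts G"
proof -
  have "W.dense P L D"
    unfolding W.dense_def elts_W[OF P_W] elts_W[OF assms(1)]
  proof (intro conjI ballI assms(2))
    fix p assume p: "p \<in> V.elts P"
    then obtain d where "d \<in> V.elts D" "le d p" using assms(3) by blast
    then show "\<exists>d\<in>V.elts D. W.rel L d p" using W_rel_iff P_in p assms(2) by blast
  qed
  then show ?thesis using generic assms(1) unfolding generic_filter_def by blast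
qed

text \<open>The conditions that have \<open>Q\<close> or have no extension with \<open>Q\<close>
  form a dense set. Definability of \<open>Q\<close> over \<open>W\<close> puts this set into
  \<open>W\<close>, so \<open>G\<close> meets it.\<close>

lemma decide:
  assumes "W.dfn (\<lambda>e. Q (e 0))"
  obtains q where "q \<in> V.elts G" "Q q" | q where "q \<in> V.elts G" "\<And>r. r \<in> V.elts P \<Longrightarrow> le r q \<Longrightarrow> \<not> Q r"
proof -
  note [dfn_intros] = W.dfn_comp1[where R = Q, OF assms]
  define D where "D = {q \<in> V.elts P. Q q \<or> (\<forall>r\<in>V.elts P. le r q \<longrightarrow> \<not> Q r)}"
  have "W.small D" unfolding D_def by (intro W_small_sep P_W dfn_intros)
  note D = W_mk[OF this]
  have "\<exists>d\<in>V.elts (V.mk D). d \<in> V.elts G"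
  proof (rule G_meets[OF D(1)])
    show "V.elts (V.mk D) \<subseteq> V.elts P" unfolding D(2) unfolding D_def by blast
    show "\<exists>d\<in>V.elts (V.mk D). le d p" if p: "p \<in> V.elts P" for p
    proof (cases "\<exists>r\<in>V.elts P. le r p \<and> Q r")
      case True
      then show ?thesis unfolding D(2) unfolding D_def by blast
    next
      case False
      then show ?thesis unfolding D(2) unfolding D_def using p le_refl by blast
    qed
  qed
  then show ?thesis using that unfolding D(2) unfolding D_def by blast
qed

text \<open>Only atomic statements \<open>\<tau> = y\<close> with \<open>y\<close> in the ground model are forced, so that the forcing
  relation \<open>F \<tau> y q\<close> is defined by a single recursion along the name \<open>\<tau>\<close>.\<close>

theorem nice_name:
  assumes X: "X \<in> W" and x: "x \<in> M" "V.elts x \<subseteq> V.elts X"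
  obtains A where "A \<in> W" "\<And>y. y \<in> V.elts X \<Longrightarrow> y \<in> V.elts x \<longleftrightarrow> (\<exists>q\<in>V.elts G. V.pr y q \<in> V.elts A)"
proof -
  obtain Y where Y: "Y \<in> W" "V.elts X \<subseteq> V.elts Y" "\<And>y. y \<in> V.elts Y \<Longrightarrow> V.elts y \<subseteq> V.elts Y"
    by (rule transitive_superset_ex[OF X]) (rule that)
  have "x \<in> generic_extension M E W P G" using x ext by simp
  then obtain \<tau>0 where t0: "\<tau>0 \<in> W" "W.is_name P \<tau>0" "V.is_val G \<tau>0 x"
    unfolding generic_extension_def by blast
  obtain D where D: "D \<in> W" "\<tau>0 \<in> V.elts D"
    "\<And>\<sigma> z. \<sigma> \<in> V.elts D \<Longrightarrow> z \<in> V.elts \<sigma> \<Longrightarrow> \<exists>\<pi>\<in>V.elts D. \<exists>p\<in>V.elts P. z = V.pr \<pi> p"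
  proof -
    obtain D where D: "D \<in> W" "\<tau>0 \<in> W.elts D"
      "\<forall>\<sigma>\<in>W.elts D. \<forall>z\<in>W.elts \<sigma>. \<exists>\<pi>\<in>W.elts D. \<exists>p\<in>W.elts P. W.is_pair \<pi> p z"
      using t0(2) unfolding W.is_name_def by blast
    show ?thesis
    proof (rule that[OF D(1)])
      show "\<tau>0 \<in> V.elts D" using D elts_W by simp
      fix \<sigma> z assume s: "\<sigma> \<in> V.elts D" "z \<in> V.elts \<sigma>"
      have sW: "\<sigma> \<in> W" by (rule elts_inW[OF D(1) s(1)])
      have zW: "z \<in> W" by (rule elts_inW[OF sW s(2)])
      have "\<sigma> \<in> W.elts D" "z \<in> W.elts \<sigma>" using s elts_W D(1) sW by auto
      then obtain \<pi> p where p: "\<pi> \<in> W.elts D" "p \<in> W.elts P" "W.is_pair \<pi> p z"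
        using D(3) by blast
      then have "z = W.pr \<pi> p" using W.is_pair_iff[OF W.elts_M W.elts_M zW] by blast
      then have "z = V.pr \<pi> p" using pr_W W.elts_M[OF p(1)] W.elts_M[OF p(2)] by simp
      then show "\<exists>\<pi>\<in>V.elts D. \<exists>p\<in>V.elts P. z = V.pr \<pi> p"
        using p unfolding elts_W[OF D(1)] elts_W[OF P_W] by blast
    qed
  qed
  \<comment> \<open>The evaluation comes from \<open>M\<close> with a domain of its own, which need
    not be \<open>D\<close>. Both sets are closed under constituents of names, so later arguments
    run over their intersection.\<close>
  obtain D' v where v: "D' \<in> M" "v \<in> M" "\<tau>0 \<in> V.elts D'"
    "\<And>\<sigma> \<pi> p. \<sigma> \<in> V.elts D' \<Longrightarrow> \<pi> \<in> M \<Longrightarrow> p \<in> M \<Longrightarrow> V.pr \<pi> p \<in> V.elts \<sigma> \<Longrightarrow> \<pi> \<in> V.elts D'"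
    "\<And>\<sigma> y. \<sigma> \<in> V.elts D' \<Longrightarrow> y \<in> V.elts (V.app v \<sigma>) \<longleftrightarrow>
        (\<exists>\<pi>\<in>V.elts D'. \<exists>p\<in>V.elts G. V.pr \<pi> p \<in> V.elts \<sigma> \<and> y = V.app v \<pi>)"
    "V.app v \<tau>0 = x"
  proof -
    obtain D' v where v: "D' \<in> M" "v \<in> M" "\<tau>0 \<in> V.elts D'" "V.func v D'"
      and cl: "\<forall>\<sigma>\<in>V.elts D'. \<forall>\<pi>\<in>M. \<forall>p\<in>M. V.rel \<sigma> \<pi> p \<longrightarrow> \<pi> \<in> V.elts D'"
      and ev: "\<forall>\<sigma>\<in>V.elts D'. \<forall>u\<in>M. V.rel v \<sigma> u \<longrightarrow>
        V.elts u = {y \<in> M. \<exists>\<pi>\<in>V.elts D'. \<exists>p\<in>V.elts G. V.rel \<sigma> \<pi> p \<and> V.rel v \<pi> y}"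
      and vx: "V.rel v \<tau>0 x"
      using t0(3) unfolding V.is_val_def by (elim conjE bexE) (rule that)
    note r = V.func_app[OF v(4)]
    show ?thesis
    proof (rule that[OF v(1-3)])
      show "V.app v \<tau>0 = x" using r[OF v(3) x(1)] vx by simp
      show "\<pi> \<in> V.elts D'" if "\<sigma> \<in> V.elts D'" "\<pi> \<in> M" "p \<in> M" "V.pr \<pi> p \<in> V.elts \<sigma>" for \<sigma> \<pi> p
        using cl that V.rel_iff by blast
      fix \<sigma> y assume s: "\<sigma> \<in> V.elts D'"
      have e: "V.elts (V.app v \<sigma>) = {y \<in> M. \<exists>\<pi>\<in>V.elts D'. \<exists>p\<in>V.elts G. V.rel \<sigma> \<pi> p \<and> V.rel v \<pi> y}"
        using bspec[OF bspec[OF ev s] V.app_in] r[OF s V.app_in] by blast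
      have "V.rel \<sigma> \<pi> p \<longleftrightarrow> V.pr \<pi> p \<in> V.elts \<sigma>" if "\<pi> \<in> V.elts D'" "p \<in> V.elts G" for \<pi> p
        by (rule V.rel_iff[OF V.elts_M[OF that(1)] V.elts_M[OF that(2)]])
      moreover have "V.rel v \<pi> y \<longleftrightarrow> y = V.app v \<pi>" if "\<pi> \<in> V.elts D'" "y \<in> M" for \<pi>
        by (rule r[OF that])
      ultimately show "y \<in> V.elts (V.app v \<sigma>) \<longleftrightarrow>
        (\<exists>\<pi>\<in>V.elts D'. \<exists>p\<in>V.elts G. V.pr \<pi> p \<in> V.elts \<sigma> \<and> y = V.app v \<pi>)"
        unfolding e using V.app_in by auto
    qed
  qed
  let ?R = "\<lambda>y x. \<exists>p\<in>W. V.pr y p \<in> V.elts x"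
  \<comment> \<open>Read a pair (z, s) in \<open>g \<pi>\<close> as: s forces \<pi> = z. Then
    \<open>r\<close> is bad if it refutes \<tau> = y directly. Either some \<pi>, put into \<tau> by
    a condition above \<open>r\<close>, is equal to no z in y according to any extension of
    \<open>r\<close>, or some z in y is reached by no constituent below \<open>r\<close>. A
    condition forces \<tau> = y when none of its extensions is bad.\<close>
  define Bad where "Bad g \<tau> y r \<longleftrightarrow>
    (\<exists>\<pi>\<in>V.elts D. \<exists>p\<in>V.elts P. V.pr \<pi> p \<in> V.elts \<tau> \<and> le r p \<and>
       (\<forall>z\<in>V.elts y. \<forall>s\<in>V.elts P. le s r \<longrightarrow> V.pr z s \<notin> V.elts (g \<pi>))) \<or>
    (\<exists>z\<in>V.elts y. \<forall>\<pi>\<in>V.elts D. \<forall>p\<in>V.elts P. V.pr \<pi> p \<in> V.elts \<tau> \<longrightarrow>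
       (\<forall>s\<in>V.elts P. le s r \<longrightarrow> le s p \<longrightarrow> V.pr z s \<notin> V.elts (g \<pi>)))" for g :: "'a \<Rightarrow> 'a" and \<tau> y r
  have Bad_mono: "Bad g \<tau> y r"
    if b: "Bad f \<tau> y r" and fg: "\<And>\<pi> p. \<pi> \<in> V.elts D \<Longrightarrow> p \<in> V.elts P \<Longrightarrow> V.pr \<pi> p \<in> V.elts \<tau> \<Longrightarrow> f \<pi> = g \<pi>"
    for f g \<tau> y r
    using b unfolding Bad_def
  proof (elim disjE bexE conjE, goal_cases)
    case (1 \<pi> p)
    then show ?case using fg[OF 1(1,2,3)] by (intro disjI1 bexI[of _ \<pi>] bexI[of _ p]) auto
  next
    case (2 z)
    then show ?case using fg by (intro disjI2 bexI[of _ z]) auto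
  qed
  define K where "K \<tau> g = W.mk {u. \<exists>y\<in>V.elts Y. \<exists>q\<in>V.elts P. u = V.pr y q \<and>
    (\<forall>r\<in>V.elts P. le r q \<longrightarrow> \<not> Bad g \<tau> y r)}" for \<tau> g
  have K_cong: "K \<tau> f = K \<tau> g"
    if "\<And>\<pi> p. \<pi> \<in> V.elts D \<Longrightarrow> p \<in> V.elts P \<Longrightarrow> V.pr \<pi> p \<in> V.elts \<tau> \<Longrightarrow> f \<pi> = g \<pi>" for f g \<tau>
  proof -
    have "Bad f \<tau> y r \<longleftrightarrow> Bad g \<tau> y r" for y r
      using Bad_mono[of f \<tau> y r g] Bad_mono[of g \<tau> y r f] that by metis
    then show ?thesis unfolding K_def by simp
  qed
  \<comment> \<open>The recursion is carried out inside \<open>W\<close>, along the constituents of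
    names. With \<open>g\<close> in \<open>W\<close> as a parameter, forcing becomes definable over
    \<open>W\<close>, as the uses of \<open>decide\<close> require.\<close>
  have "\<exists>g\<in>W. \<forall>\<tau>\<in>W.elts D. W.app g \<tau> = K \<tau> (W.app g)"
  proof (rule W.wf_rec[where R = ?R, OF D(1)])
    show "W.dfn (\<lambda>e. ?R (e 0) (e 1))" by (intro dfn_intros)
    show "\<exists>m\<in>S. \<forall>y\<in>S. \<not> ?R y m" if S: "W.small S" "S \<subseteq> W.elts D" "S \<noteq> {}" for S
    proof -
      obtain m where m: "m \<in> S" "\<forall>y\<in>S. \<not> (\<exists>p\<in>M. V.pr y p \<in> V.elts m)"
        using V.name_wf[OF small_W[OF S(1)] S(3)] by blast
      then show ?thesis using WM by blast
    qed
    show "W.dtm (\<lambda>e. K (e 0) (W.app (e 1)))"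
      unfolding K_def Bad_def by (intro dfn_intros D(1) Y(1) P_W)
    fix \<tau> f g assume t: "\<tau> \<in> W.elts D" and fg: "\<And>y. y \<in> W.elts D \<Longrightarrow> ?R y \<tau> \<Longrightarrow> (f y :: 'a) = g y"
    show "K \<tau> f = K \<tau> g"
    proof (rule K_cong)
      fix \<pi> p assume "\<pi> \<in> V.elts D" "p \<in> V.elts P" "V.pr \<pi> p \<in> V.elts \<tau>"
      then show "f \<pi> = g \<pi>" using fg[of \<pi>] elts_W[OF D(1)] P_in by blast
    qed
  qed
  then obtain g where g0: "g \<in> W" "\<And>\<tau>. \<tau> \<in> V.elts D \<Longrightarrow> W.app g \<tau> = K \<tau> (W.app g)"
    unfolding elts_W[OF D(1)] by blast
  have gapp: "W.app g \<tau> = V.app g \<tau>" if "\<tau> \<in> V.elts D" for \<tau>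
    by (rule app_W[OF g0(1) elts_inW[OF D(1) that]])
  have g: "V.app g \<tau> = K \<tau> (V.app g)" if "\<tau> \<in> V.elts D" for \<tau>
    using g0(2)[OF that] gapp[OF that] K_cong[of \<tau> "W.app g" "V.app g"] gapp by metis
  define F where "F \<tau> y q \<longleftrightarrow> V.pr y q \<in> V.elts (V.app g \<tau>)" for \<tau> y q
  have F: "F \<tau> y q \<longleftrightarrow> (\<forall>r\<in>V.elts P. le r q \<longrightarrow> \<not> Bad (V.app g) \<tau> y r)"
    if t: "\<tau> \<in> V.elts D" "y \<in> V.elts Y" "q \<in> V.elts P" for \<tau> y q
  proof -
    let ?S = "{u. \<exists>y\<in>V.elts Y. \<exists>q\<in>V.elts P. u = V.pr y q \<and>
      (\<forall>r\<in>V.elts P. le r q \<longrightarrow> \<not> Bad (V.app g) \<tau> y r)}"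
    have "W.small ?S"
      by (rule W_small_prod[OF Y(1) P_W], unfold Bad_def) (intro dfn_intros P_W D(1) elts_inW[OF D(1) t(1)] g0(1))
    then have "V.elts (V.app g \<tau>) = ?S" unfolding g[OF t(1)] K_def using mk_W W_mk(2) by simp
    then show ?thesis unfolding F_def using pr_mem_prod[OF WM[OF Y(1)] WM[OF P_W] t(2,3)] by simp
  qed
  have Fdown: "F \<tau> y s" if t: "\<tau> \<in> V.elts D" "y \<in> V.elts Y" "q \<in> V.elts P" "s \<in> V.elts P" "le s q" "F \<tau> y q" for \<tau> y q s
    using that(6) le_trans[OF _ that(4,3) _ that(5)] unfolding F[OF t(1,2,3)] F[OF t(1,2,4)] by blast
  have FW: "W.dfn (\<lambda>e. F (t e) (u e) (w e))" if "W.dtm t" "W.dtm u" "W.dtm w" for t u w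
    unfolding F_def by (intro dfn_intros that g0(1))
  have FV: "V.dfn (\<lambda>e. F (t e) (u e) (w e))" if "V.dtm t" "V.dtm u" "V.dtm w" for t u w
    unfolding F_def by (intro dfn_intros that WM[OF g0(1)])
  have pr_D: "\<pi> \<in> V.elts D" if "m \<in> V.elts D" "V.pr \<pi> p \<in> V.elts m" "\<pi> \<in> M" "p \<in> M" for m \<pi> p
    using D(3)[OF that(1,2)] V.pr_eq_iff[OF that(3,4)] V.elts_M by metis
  \<comment> \<open>The inductive step of the truth lemma: what \<open>G\<close> forces about
    \<open>m\<close> is correct and complete if this holds for all constituents of
    \<open>m\<close>.\<close>
  have truth: "V.app v m = y \<longleftrightarrow> (\<exists>q\<in>V.elts G. F m y q)"
    if m: "m \<in> V.elts D" "m \<in> V.elts D'" and y: "y \<in> V.elts Y"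
      and IH: "\<And>\<pi> p z. \<pi> \<in> V.elts D \<Longrightarrow> \<pi> \<in> V.elts D' \<Longrightarrow> p \<in> V.elts P \<Longrightarrow> V.pr \<pi> p \<in> V.elts m \<Longrightarrow> z \<in> V.elts Y \<Longrightarrow>
        V.app v \<pi> = z \<longleftrightarrow> (\<exists>q\<in>V.elts G. F \<pi> z q)" for m y
  proof
    have mW: "m \<in> W" and yW: "y \<in> W" using m y elts_inW D(1) Y(1) by blast+
    have clD': "\<pi> \<in> V.elts D'" if "\<pi> \<in> V.elts D" "p \<in> V.elts P" "V.pr \<pi> p \<in> V.elts m" for \<pi> p
      using v(4)[OF m(2) V.elts_M[OF that(1)] V.elts_M[OF that(2)] that(3)] .
    have clD: "\<pi> \<in> V.elts D" if "\<pi> \<in> V.elts D'" "p \<in> V.elts P" "V.pr \<pi> p \<in> V.elts m" for \<pi> p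
      using pr_D[OF m(1) that(3) V.elts_M[OF that(1)] V.elts_M[OF that(2)]] .
    have yY: "z \<in> V.elts Y" if "z \<in> V.elts y" for z using Y(3)[OF y] that by blast
    {
      assume val: "V.app v m = y"
      \<comment> \<open>\<open>G\<close> decides badness. A bad condition in \<open>G\<close>
        contradicts the hypothesis for constituents once it is extended inside \<open>G\<close>; in
        the other case a condition in \<open>G\<close> has no bad extension, so it forces the
        equation.\<close>
      have "W.dfn (\<lambda>e. Bad (V.app g) m y (e 0))"
        unfolding Bad_def by (intro dfn_intros P_W D(1) mW yW g0(1))
      then show "\<exists>q\<in>V.elts G. F m y q"
      proof (cases rule: decide)
        case (1 q)
        note qP = G_P[OF 1(1)]
        from 1(2) show ?thesis unfolding Bad_def F_def[symmetric]
        proof (elim disjE bexE conjE, goal_cases)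
          case (1 \<pi> p)
          have pG: "p \<in> V.elts G" using G_up[OF \<open>q \<in> V.elts G\<close> 1(2,4)] .
          have piD': "\<pi> \<in> V.elts D'" by (rule clD'[OF 1(1,2,3)])
          have zy: "V.app v \<pi> \<in> V.elts y" using v(5)[OF m(2)] val pG piD' 1(3) by blast
          obtain s0 where s0: "s0 \<in> V.elts G" "F \<pi> (V.app v \<pi>) s0"
            using IH[OF 1(1) piD' 1(2,3) yY[OF zy]] by blast
          obtain s where s: "s \<in> V.elts G" "le s q" "le s s0" by (rule G_dir[OF \<open>q \<in> V.elts G\<close> s0(1)])
          have "F \<pi> (V.app v \<pi>) s" by (rule Fdown[OF 1(1) yY[OF zy] G_P[OF s0(1)] G_P[OF s(1)] s(3) s0(2)])
          then show ?case using 1(5) zy G_P[OF s(1)] s(2) by blast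
        next
          case (2 z)
          then obtain \<pi> p where p: "\<pi> \<in> V.elts D'" "p \<in> V.elts G" "V.pr \<pi> p \<in> V.elts m" "z = V.app v \<pi>"
            using v(5)[OF m(2)] val by blast
          have piD: "\<pi> \<in> V.elts D" by (rule clD[OF p(1) G_P[OF p(2)] p(3)])
          obtain s0 where s0: "s0 \<in> V.elts G" "F \<pi> z s0"
            using IH[OF piD p(1) G_P[OF p(2)] p(3) yY[OF 2(1)]] p(4) by blast
          obtain s1 where s1: "s1 \<in> V.elts G" "le s1 q" "le s1 s0" by (rule G_dir[OF \<open>q \<in> V.elts G\<close> s0(1)])
          obtain s where s: "s \<in> V.elts G" "le s s1" "le s p" by (rule G_dir[OF s1(1) p(2)])
          note sP = G_P[OF s(1)]
          have "le s q" "le s s0"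
            using le_trans[OF sP G_P[OF s1(1)] _ s(2)] s1 qP G_P[OF s0(1)] by blast+
          moreover have "F \<pi> z s"
            by (rule Fdown[OF piD yY[OF 2(1)] G_P[OF s0(1)] sP \<open>le s s0\<close> s0(2)])
          ultimately show ?case using 2(2) piD G_P[OF p(2)] p(3) sP s(3) by blast
        qed
      next
        case (2 q)
        then show ?thesis using F[OF m(1) y G_P[OF 2(1)]] by blast
      qed
    }
    {
      assume "\<exists>q\<in>V.elts G. F m y q"
      then obtain q where q: "q \<in> V.elts G" "F m y q" by blast
      note qP = G_P[OF q(1)]
      have noBad: "\<not> Bad (V.app g) m y r" if "r \<in> V.elts P" "le r q" for r
        using q(2) that unfolding F[OF m(1) y qP] by blast
      have "V.elts (V.app v m) = V.elts y"
      proof (intro equalityI subsetI)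
        fix u assume "u \<in> V.elts (V.app v m)"
        then obtain \<pi> p where p: "\<pi> \<in> V.elts D'" "p \<in> V.elts G" "V.pr \<pi> p \<in> V.elts m" "u = V.app v \<pi>"
          using v(5)[OF m(2)] by blast
        note pP = G_P[OF p(2)]
        have piD: "\<pi> \<in> V.elts D" by (rule clD[OF p(1) pP p(3)])
        \<comment> \<open>Either \<open>G\<close> forces \<pi> to equal some z in y, or a common
          extension of \<open>q\<close>, \<open>q1\<close> and \<open>p\<close> is bad by the first
          clause.\<close>
        have "W.dfn (\<lambda>e. \<exists>z\<in>V.elts y. F \<pi> z (e 0))"
          by (intro dfn_intros FW yW elts_inW[OF D(1) piD])
        then show "u \<in> V.elts y"
        proof (cases rule: decide)
          case (1 s)
          then obtain z where z: "z \<in> V.elts y" "F \<pi> z s" by blast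
          then have "V.app v \<pi> = z" using IH[OF piD p(1) pP p(3) yY[OF z(1)]] 1(1) by blast
          then show ?thesis using z p(4) by simp
        next
          case (2 q1)
          obtain r1 where r1: "r1 \<in> V.elts G" "le r1 q" "le r1 q1" by (rule G_dir[OF q(1) 2(1)])
          obtain r where r: "r \<in> V.elts G" "le r r1" "le r p" by (rule G_dir[OF r1(1) p(2)])
          note rP = G_P[OF r(1)]
          have rq: "le r q" "le r q1"
            using le_trans[OF rP G_P[OF r1(1)] _ r(2)] r1 qP G_P[OF 2(1)] by blast+
          have "\<not> F \<pi> z s" if "z \<in> V.elts y" "s \<in> V.elts P" "le s r" for z s
            using 2(2)[OF that(2) le_trans[OF that(2) rP G_P[OF 2(1)] that(3) rq(2)]] that(1) by blast
          then have "Bad (V.app g) m y r"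
            unfolding Bad_def F_def[symmetric] using piD pP p(3) r(3) by blast
          then show ?thesis using noBad[OF rP rq(1)] by blast
        qed
      next
        fix z assume z: "z \<in> V.elts y"
        have zW: "z \<in> W" by (rule elts_inW[OF yW z])
        \<comment> \<open>Either \<open>G\<close> makes some constituent equal to z, or a common
          extension of \<open>q\<close> and \<open>q1\<close> is bad by the second clause.\<close>
        have "W.dfn (\<lambda>e. \<exists>\<pi>\<in>V.elts D. \<exists>p\<in>V.elts P. V.pr \<pi> p \<in> V.elts m \<and> le (e 0) p \<and> F \<pi> z (e 0))"
          by (intro dfn_intros FW D(1) P_W mW zW)
        then show "z \<in> V.elts (V.app v m)"
        proof (cases rule: decide)
          case (1 s)
          then obtain \<pi> p where p: "\<pi> \<in> V.elts D" "p \<in> V.elts P" "V.pr \<pi> p \<in> V.elts m" "le s p" "F \<pi> z s" by blast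
          have pG: "p \<in> V.elts G" by (rule G_up[OF 1(1) p(2,4)])
          have piD': "\<pi> \<in> V.elts D'" by (rule clD'[OF p(1,2,3)])
          have "V.app v \<pi> = z" using IH[OF p(1) piD' p(2,3) yY[OF z]] 1(1) p(5) by blast
          then show ?thesis using v(5)[OF m(2)] piD' pG p(3) by blast
        next
          case (2 q1)
          obtain r where r: "r \<in> V.elts G" "le r q" "le r q1" by (rule G_dir[OF q(1) 2(1)])
          note rP = G_P[OF r(1)]
          have "\<not> F \<pi> z s" if "\<pi> \<in> V.elts D" "p \<in> V.elts P" "V.pr \<pi> p \<in> V.elts m" "s \<in> V.elts P" "le s r" "le s p" for \<pi> p s
            using 2(2)[OF that(4) le_trans[OF that(4) rP G_P[OF 2(1)] that(5) r(3)]] that by blast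
          then have "Bad (V.app g) m y r"
            unfolding Bad_def F_def[symmetric] using z by blast
          then show ?thesis using noBad[OF rP r(2)] by blast
        qed
      qed
      then show "V.app v m = y" by (intro V.elts_ext V.app_in WM[OF yW])
    }
  qed
  have truth: "V.app v \<tau> = y \<longleftrightarrow> (\<exists>q\<in>V.elts G. F \<tau> y q)"
    if t: "\<tau> \<in> V.elts D" "\<tau> \<in> V.elts D'" "y \<in> V.elts Y" for \<tau> y
  proof (rule ccontr)
    assume no: "\<not> ?thesis"
    \<comment> \<open>The counterexamples form a set of \<open>M\<close>, having the parameters
      \<open>v\<close>, \<open>g\<close> and \<open>G\<close>, so \<open>name_wf\<close> yields one
      without counterexamples among its constituents.\<close>
    let ?S = "{\<tau> \<in> V.elts D. \<tau> \<in> V.elts D' \<and> \<not> (\<forall>y\<in>V.elts Y. V.app v \<tau> = y \<longleftrightarrow> (\<exists>q\<in>V.elts G. F \<tau> y q))}"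
    have sS: "V.small ?S"
      by (intro V.small_sep V.small_elts dfn_intros FV WM[OF D(1)] WM[OF Y(1)] v(1,2) G_M)
    have ne: "?S \<noteq> {}" using t no by blast
    obtain m where m: "m \<in> ?S" "\<forall>\<pi>\<in>?S. \<not> (\<exists>p\<in>M. V.pr \<pi> p \<in> V.elts m)"
      using V.name_wf[OF sS ne] by (rule bexE)
    have "V.app v m = y \<longleftrightarrow> (\<exists>q\<in>V.elts G. F m y q)" if y: "y \<in> V.elts Y" for y
    proof (rule truth)
      fix \<pi> p z assume p: "\<pi> \<in> V.elts D" "\<pi> \<in> V.elts D'" "p \<in> V.elts P" "V.pr \<pi> p \<in> V.elts m" "z \<in> V.elts Y"
      have "\<pi> \<notin> ?S" using m(2) p(4) V.elts_M[OF p(3)] by blast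
      then show "V.app v \<pi> = z \<longleftrightarrow> (\<exists>q\<in>V.elts G. F \<pi> z q)" using p by blast
    qed (use m y in auto)
    then show False using m(1) by blast
  qed
  let ?Q = "\<lambda>y q. \<exists>\<pi>\<in>V.elts D. \<exists>p\<in>V.elts P. V.pr \<pi> p \<in> V.elts \<tau>0 \<and> le q p \<and> F \<pi> y q"
  \<comment> \<open>A pair (y, q) is collected if \<open>q\<close> both puts some constituent into
    the name and forces that constituent to equal y; the definition mentions ground model sets
    only.\<close>
  define A where "A = V.mk {u. \<exists>y\<in>V.elts X. \<exists>q\<in>V.elts P. u = V.pr y q \<and> ?Q y q}"
  have "W.small {u. \<exists>y\<in>V.elts X. \<exists>q\<in>V.elts P. u = V.pr y q \<and> ?Q y q}"
    by (rule W_small_prod[OF X P_W]) (intro dfn_intros FW D(1) P_W t0(1))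
  note A0 = W_mk[OF this, folded A_def]
  have A: "V.pr y q \<in> V.elts A \<longleftrightarrow> ?Q y q" if "y \<in> V.elts X" "q \<in> V.elts P" for y q
    unfolding A0(2) by (rule pr_mem_prod[OF WM[OF X] WM[OF P_W] that])
  show ?thesis
  proof (rule that[OF A0(1)])
    fix y assume y: "y \<in> V.elts X"
    then have yY: "y \<in> V.elts Y" using Y(2) by blast
    show "y \<in> V.elts x \<longleftrightarrow> (\<exists>q\<in>V.elts G. V.pr y q \<in> V.elts A)"
    proof
      assume "y \<in> V.elts x"
      then obtain \<pi> p where p: "\<pi> \<in> V.elts D'" "p \<in> V.elts G" "V.pr \<pi> p \<in> V.elts \<tau>0" "y = V.app v \<pi>"
        using v(5)[OF v(3)] v(6) by blast
      have piD: "\<pi> \<in> V.elts D" by (rule pr_D[OF D(2) p(3) V.elts_M[OF p(1)] V.elts_M[OF p(2)]])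
      obtain s0 where s0: "s0 \<in> V.elts G" "F \<pi> y s0" using truth[OF piD p(1) yY] p(4) by blast
      obtain s where s: "s \<in> V.elts G" "le s s0" "le s p" by (rule G_dir[OF s0(1) p(2)])
      have "F \<pi> y s" by (rule Fdown[OF piD yY G_P[OF s0(1)] G_P[OF s(1)] s(2) s0(2)])
      then have "?Q y s" using piD G_P[OF p(2)] p(3) s(3) by blast
      then show "\<exists>q\<in>V.elts G. V.pr y q \<in> V.elts A" using A[OF y G_P[OF s(1)]] s(1) by blast
    next
      assume "\<exists>q\<in>V.elts G. V.pr y q \<in> V.elts A"
      then obtain q where q: "q \<in> V.elts G" "V.pr y q \<in> V.elts A" by blast
      then obtain \<pi> p where p: "\<pi> \<in> V.elts D" "p \<in> V.elts P" "V.pr \<pi> p \<in> V.elts \<tau>0" "le q p" "F \<pi> y q"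
        using A[OF y G_P[OF q(1)]] by blast
      have pG: "p \<in> V.elts G" by (rule G_up[OF q(1) p(2,4)])
      have piD': "\<pi> \<in> V.elts D'" by (rule v(4)[OF v(3) V.elts_M[OF p(1)] V.elts_M[OF p(2)] p(3)])
      have "V.app v \<pi> = y" using truth[OF p(1) piD' yY] q(1) p(5) by blast
      then show "y \<in> V.elts x" using v(5)[OF v(3)] v(6) piD' pG p(3) by blast
    qed
  qed
qed

subsection \<open>Preservation of cardinals and of GCH\<close>

context
  fixes l
  assumes l: "W.ordinal l"
    and absorb: "\<And>a. W.ordinal a \<Longrightarrow> W.elts l \<subseteq> W.elts a \<Longrightarrow> W.lep (W.cprod a P) a"
begin

lemma l_W: "l \<in> W" and l_V: "V.ordinal l"
  using l W.ordinal_M ordinal_W by auto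

text \<open>A bijection in \<open>M\<close> from some x < k onto \<open>k\<close> has a name, which
  \<open>W\<close> can use to cover \<open>k\<close> by x x P: a pair (\<beta>, q) goes to the value
  at \<beta> determined by \<open>q\<close>. Enlarging x to an ordinal y < k with y \<ge> l,
  absorption gives an injection in \<open>W\<close> of \<open>k\<close> into y, which is impossible
  for a cardinal of \<open>W\<close>.\<close>

lemma cardinal_up:
  assumes k: "W.cardinal k" and lk: "l \<in> V.elts k"
  shows "V.cardinal k"
proof (rule ccontr)
  assume nc: "\<not> V.cardinal k"
  have ok: "W.ordinal k" "V.ordinal k" "k \<in> W"
    using k W.ordinal_M ordinal_W unfolding W.cardinal_def by auto
  have kM: "k \<in> M" by (rule WM[OF ok(3)])
  obtain x f where x: "x \<in> V.elts k" and f: "f \<in> M" "bij_betw (V.app f) (V.elts x) (V.elts k)"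
    using nc ok(2) unfolding V.cardinal_iff V.eqp_iff_bij by blast
  have xW: "x \<in> W" by (rule elts_inW[OF ok(3) x])
  have xM: "x \<in> M" by (rule WM[OF xW])
  have prk: "V.pr \<beta> \<gamma> \<in> V.elts (W.cprod x k)" if "\<beta> \<in> V.elts x" "\<gamma> \<in> V.elts k" for \<beta> \<gamma>
    using W.cprodI[OF xW ok(3), of \<beta> \<gamma>] that elts_inW[OF xW] elts_inW[OF ok(3)]
    by (simp add: elts_W xW ok(3) pr_W)
  \<comment> \<open>\<open>nice_name\<close> applies to subsets of sets of \<open>W\<close>, so the
    function is replaced by its graph inside the product formed in \<open>W\<close>.\<close>
  define g where "g = V.mk {u \<in> V.elts (W.cprod x k). \<exists>\<beta>\<in>V.elts x. u = V.pr \<beta> (V.app f \<beta>)}"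
  have "V.small {u \<in> V.elts (W.cprod x k). \<exists>\<beta>\<in>V.elts x. u = V.pr \<beta> (V.app f \<beta>)}"
    by (intro V.small_sep V.small_elts WM[OF W.cprod_in] dfn_intros xM f(1))
  then have eg: "V.elts g = {u \<in> V.elts (W.cprod x k). \<exists>\<beta>\<in>V.elts x. u = V.pr \<beta> (V.app f \<beta>)}"
    unfolding g_def by (rule V.elts_mk)
  have gM: "g \<in> M" unfolding g_def by simp
  have gf: "V.pr \<beta> \<gamma> \<in> V.elts g \<longleftrightarrow> V.app f \<beta> = \<gamma>" if b: "\<beta> \<in> V.elts x" "\<gamma> \<in> V.elts k" for \<beta> \<gamma>
  proof
    assume "V.pr \<beta> \<gamma> \<in> V.elts g"
    then obtain \<beta>' where b': "\<beta>' \<in> V.elts x" "V.pr \<beta> \<gamma> = V.pr \<beta>' (V.app f \<beta>')" unfolding eg by blast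
    then have "\<beta> = \<beta>' \<and> \<gamma> = V.app f \<beta>'"
      using V.pr_eq_iff[OF V.elts_M[OF b(1)] V.elts_M[OF b(2)] V.elts_M[OF b'(1)] V.app_in] by blast
    then show "V.app f \<beta> = \<gamma>" by blast
  next
    assume "V.app f \<beta> = \<gamma>"
    then show "V.pr \<beta> \<gamma> \<in> V.elts g" unfolding eg using prk[OF b] b(1) by blast
  qed
  obtain A where A: "A \<in> W"
    "\<And>u. u \<in> V.elts (W.cprod x k) \<Longrightarrow> u \<in> V.elts g \<longleftrightarrow> (\<exists>q\<in>V.elts G. V.pr u q \<in> V.elts A)"
    by (rule nice_name[OF W.cprod_in gM, of x k]) (use eg that in auto)
  have fA: "V.app f \<beta> = \<gamma> \<longleftrightarrow> (\<exists>q\<in>V.elts G. V.pr (V.pr \<beta> \<gamma>) q \<in> V.elts A)"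
    if b: "\<beta> \<in> V.elts x" "\<gamma> \<in> V.elts k" for \<beta> \<gamma>
    using gf[OF b] A(2)[OF prk[OF b]] by blast
  \<comment> \<open>The name \<open>A\<close> need not be closed under stronger conditions;
    \<open>F\<close> is its downward closure in the condition.\<close>
  define F where "F \<beta> q \<gamma> \<longleftrightarrow> (\<exists>p\<in>V.elts P. le q p \<and> V.pr (V.pr \<beta> \<gamma>) p \<in> V.elts A)" for \<beta> q \<gamma>
  have FW: "W.dfn (\<lambda>e. F (t e) (u e) (w e))" if "W.dtm t" "W.dtm u" "W.dtm w" for t u w
  proof -
    have "W.dfn (\<lambda>e. F (e 0) (e 1) (e 2))" unfolding F_def by (intro dfn_intros P_W A(1))
    then show ?thesis using W.dfn_comp3 that by blast
  qed
  have FG: "V.app f \<beta> = \<gamma>" if "\<beta> \<in> V.elts x" "\<gamma> \<in> V.elts k" "q \<in> V.elts G" "F \<beta> q \<gamma>" for \<beta> \<gamma> q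
    using that fA[OF that(1,2)] G_up[OF that(3)] unfolding F_def by blast
  \<comment> \<open>A condition giving two values at one argument cannot belong to \<open>G\<close>,
    since the function has one value there. Hence some \<open>p0\<close> in \<open>G\<close> has no
    such extension, and below \<open>p0\<close> the value that a condition determines is unique, as
    \<open>the1\<close> in \<open>H\<close> needs.\<close>
  have "W.dfn (\<lambda>e. \<exists>\<beta>\<in>V.elts x. \<exists>\<gamma>\<in>V.elts k. \<exists>\<gamma>'\<in>V.elts k. \<gamma> \<noteq> \<gamma>' \<and> F \<beta> (e 0) \<gamma> \<and> F \<beta> (e 0) \<gamma>')"
    by (intro dfn_intros FW xW ok(3))
  then obtain p0 where p0: "p0 \<in> V.elts G"
    "\<And>r. r \<in> V.elts P \<Longrightarrow> le r p0 \<Longrightarrow> \<not> (\<exists>\<beta>\<in>V.elts x. \<exists>\<gamma>\<in>V.elts k. \<exists>\<gamma>'\<in>V.elts k. \<gamma> \<noteq> \<gamma>' \<and> F \<beta> r \<gamma> \<and> F \<beta> r \<gamma>')"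
  proof (cases rule: decide)
    case (1 r)
    then show ?thesis using FG[OF _ _ 1(1)] by blast
  next
    case (2 q)
    then show ?thesis by (rule that)
  qed
  define H where "H u = W.the1 (\<lambda>\<gamma>. \<gamma> \<in> V.elts k \<and> F (W.p1 u) (W.p2 u) \<gamma>)" for u
  have H0: "W.dtm (\<lambda>e. H (e 0))" unfolding H_def by (intro dfn_intros FW ok(3))
  have "W.elts k \<subseteq> H ` W.elts (W.cprod x P)"
  proof
    fix \<gamma> assume "\<gamma> \<in> W.elts k"
    then have c: "\<gamma> \<in> V.elts k" using elts_W ok(3) by simp
    obtain \<beta> where b: "\<beta> \<in> V.elts x" "V.app f \<beta> = \<gamma>" using f(2) c unfolding bij_betw_iff_ball by metis
    obtain q0 where q0: "q0 \<in> V.elts G" "V.pr (V.pr \<beta> \<gamma>) q0 \<in> V.elts A" using fA[OF b(1) c] b(2) by blast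
    obtain q where q: "q \<in> V.elts G" "le q p0" "le q q0" by (rule G_dir[OF p0(1) q0(1)])
    have qP: "q \<in> V.elts P" by (rule G_P[OF q(1)])
    have Fq: "F \<beta> q \<gamma>" unfolding F_def using q(3) q0 G_P[OF q0(1)] by blast
    have bW: "\<beta> \<in> W" and qW: "q \<in> W" using elts_inW[OF xW b(1)] P_in[OF qP] by auto
    let ?u = "W.pr \<beta> q"
    have pp: "W.p1 ?u = \<beta>" "W.p2 ?u = q" using W.p1_pr W.p2_pr bW qW by auto
    have "H ?u = \<gamma>"
      unfolding H_def pp
    proof (rule W.the1_eq)
      show "\<gamma> \<in> W" by (rule elts_inW[OF ok(3) c])
      show "\<gamma> \<in> V.elts k \<and> F \<beta> q \<gamma>" using c Fq by blast
      show "\<gamma>' = \<gamma>" if "\<gamma>' \<in> V.elts k \<and> F \<beta> q \<gamma>'" for \<gamma>'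
        using p0(2)[OF qP q(2)] b(1) c Fq that by blast
    qed
    moreover have "?u \<in> W.elts (W.cprod x P)"
      using W.cprodI[OF xW P_W] b(1) qP elts_W[OF xW] elts_W[OF P_W] by blast
    ultimately show "\<gamma> \<in> H ` W.elts (W.cprod x P)" by blast
  qed
  then have 1: "W.lep k (W.cprod x P)" by (rule W.surj_lep[OF W.cprod_in ok(3) H0])
  have ox: "V.ordinal x" by (rule V.ordinal_mem[OF ok(2) x])
  obtain y where y: "y \<in> V.elts k" "V.elts l \<subseteq> V.elts y" "V.elts x \<subseteq> V.elts y"
    using V.ordinal_linear[OF ox l_V] V.ordinal_subset_iff[OF ox l_V] V.ordinal_subset_iff[OF l_V ox] x lk by blast
  have yW: "y \<in> W" by (rule elts_inW[OF ok(3) y(1)])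
  have oy: "W.ordinal y" using V.ordinal_mem[OF ok(2) y(1)] ordinal_W by blast
  have "W.lep x y" by (rule W.lep_subset[OF xW]) (use y(3) elts_W xW yW in simp)
  then have "W.lep (W.cprod x P) (W.cprod y P)"
    by (rule W.lep_cprod[OF xW P_W yW P_W _ W.lep_subset[OF P_W subset_refl]])
  then have "W.lep k (W.cprod y P)" by (rule W.lep_trans[OF ok(3) 1])
  moreover have "W.lep (W.cprod y P) y" by (rule absorb[OF oy]) (use y(2) elts_W l_W yW in simp)
  ultimately have "W.lep k y" by (rule W.lep_trans[OF ok(3)])
  then show False using W.cardinal_not_lep[OF k] y(1) elts_W[OF ok(3)] by simp
qed

text \<open>Each of the two successors is a cardinal of the other model: that of \<open>M\<close>
  because cardinals go down to \<open>W\<close>, that of \<open>W\<close> by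
  \<open>cardinal_up\<close>. Minimality in both models makes them equal.\<close>

lemma cs_W:
  assumes k: "V.ordinal k" and lk: "V.elts l \<subseteq> V.elts k"
  shows "W.cs k = V.cs k"
proof -
  have kW: "W.ordinal k" "k \<in> W" using k ordinal_W ords by auto
  have vW: "V.cs k \<in> W" using V.cs_props(3)[OF k] ords by blast
  have "V.elts (W.cs k) \<subseteq> V.elts (V.cs k)"
    using W.cs_props(5)[OF kW(1) cardinal_down[OF V.cs_props(1)[OF k]]] V.cs_props(2)[OF k]
    by (simp add: elts_W vW)
  moreover have km: "k \<in> V.elts (W.cs k)" using W.cs_props(2)[OF kW(1)] by (simp add: elts_W)
  have ow: "V.ordinal (W.cs k)" using W.cs_props(3)[OF kW(1)] ordinal_W by blast
  have "l \<in> V.elts (W.cs k)"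
    using lk V.ordinal_subset_iff[OF l_V k] km V.ordinal_trans[OF ow km] by blast
  then have "V.elts (V.cs k) \<subseteq> V.elts (W.cs k)"
    by (rule V.cs_props(5)[OF k cardinal_up[OF W.cs_props(1)[OF kW(1)]] km])
  ultimately show ?thesis using V.elts_ext[OF WM[OF W.cs_in] V.cs_in] by blast
qed

text \<open>From \<open>W\<close> to \<open>M\<close>: subsets of \<open>k\<close> in
  \<open>M\<close> are decoded from subsets of k x P in \<open>W\<close>, and k x P injects into
  \<open>k\<close> there, so the power set of \<open>k\<close> does not grow beyond the bound of
  \<open>W\<close>. From \<open>M\<close> to \<open>W\<close>: the cardinality of the power set in
  \<open>W\<close> is still a cardinal in \<open>M\<close>, where it is bounded by the common
  successor of \<open>k\<close>.\<close>

lemma gch_W: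
  assumes k: "V.ordinal k" and lk: "V.elts l \<subseteq> V.elts k"
  shows "V.eqp (V.pow k) (V.cs k) \<longleftrightarrow> W.eqp (W.pow k) (W.cs k)"
proof
  have kW: "W.ordinal k" "k \<in> W" using k ordinal_W ords by auto
  have kM: "k \<in> M" by (rule WM[OF kW(2)])
  note cs = cs_W[OF k lk]
  {
    assume "W.eqp (W.pow k) (W.cs k)"
    then have 1: "W.lep (W.pow k) (W.cs k)" by (rule W.eqp_lep)
    let ?B = "W.pow (W.cprod k P)"
    have "W.lep (W.cprod k P) k" by (rule absorb[OF kW(1)]) (use lk elts_W l_W kW in simp)
    then have "W.lep ?B (W.pow k)" by (rule W.lep_pow[OF W.cprod_in kW(2)])
    then have "W.lep ?B (W.cs k)" using 1 by (rule W.lep_trans[OF W.pow_in])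
    then have 2: "V.lep ?B (V.cs k)" unfolding cs[symmetric] by (rule lep_W[OF W.pow_in W.cs_in])
    define H where "H A = V.mk {y. y \<in> V.elts k \<and> (\<exists>q\<in>V.elts G. V.pr y q \<in> V.elts A)}" for A
    have H0: "V.dtm (\<lambda>e. H (e 0))" unfolding H_def by (intro dfn_intros kM G_M)
    have "V.elts (V.pow k) \<subseteq> H ` V.elts ?B"
    proof
      fix S assume "S \<in> V.elts (V.pow k)"
      then have S: "S \<in> M" "V.elts S \<subseteq> V.elts k" unfolding V.elts_pow[OF kM] by auto
      obtain A where A: "A \<in> W" "\<And>y. y \<in> V.elts k \<Longrightarrow> y \<in> V.elts S \<longleftrightarrow> (\<exists>q\<in>V.elts G. V.pr y q \<in> V.elts A)"
        by (rule nice_name[OF kW(2) S]) (rule that)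
      \<comment> \<open>The name is trimmed to k x P, so that it belongs to the power set whose size
        is estimated; trimming leaves the decoded set unchanged.\<close>
      let ?A = "{u. \<exists>y\<in>V.elts k. \<exists>q\<in>V.elts P. u = V.pr y q \<and> V.pr y q \<in> V.elts A}"
      have "W.small ?A" by (rule W_small_prod[OF kW(2) P_W]) (intro dfn_intros A(1))
      note A' = W_mk[OF this]
      have mem: "V.pr y q \<in> V.elts (V.mk ?A) \<longleftrightarrow> V.pr y q \<in> V.elts A" if "y \<in> V.elts k" "q \<in> V.elts G" for y q
        unfolding A'(2) by (rule pr_mem_prod[OF kM WM[OF P_W] that(1) G_P[OF that(2)]])
      have "?A \<subseteq> W.elts (W.cprod k P)"
      proof
        fix u assume "u \<in> ?A"
        then obtain y q where y: "y \<in> V.elts k" "q \<in> V.elts P" "u = V.pr y q" by blast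
        then have "u = W.pr y q" using pr_W elts_inW[OF kW(2)] P_in by simp
        then show "u \<in> W.elts (W.cprod k P)"
          using W.cprodI[OF kW(2) P_W] y elts_W[OF kW(2)] elts_W[OF P_W] by simp
      qed
      then have "W.elts (V.mk ?A) \<subseteq> W.elts (W.cprod k P)" unfolding elts_W[OF A'(1)] A'(2) .
      then have "V.mk ?A \<in> W.elts ?B" unfolding W.elts_pow[OF W.cprod_in] using A'(1) by blast
      then have B: "V.mk ?A \<in> V.elts ?B" unfolding elts_W[OF W.pow_in] .
      have "{y. y \<in> V.elts k \<and> (\<exists>q\<in>V.elts G. V.pr y q \<in> V.elts (V.mk ?A))} = V.elts S"
        using A(2) mem S(2) by blast
      then have "H (V.mk ?A) = S" unfolding H_def using V.mk_elts[OF S(1)] by simp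
      then show "S \<in> H ` V.elts ?B" using B by blast
    qed
    then have "V.lep (V.pow k) ?B" by (rule V.surj_lep[OF WM[OF W.pow_in] V.pow_in H0])
    then have "V.lep (V.pow k) (V.cs k)" using 2 by (rule V.lep_trans[OF V.pow_in])
    then show "V.eqp (V.pow k) (V.cs k)" by (rule V.eqp_pow_cs[OF k])
  }
  {
    assume e: "V.eqp (V.pow k) (V.cs k)"
    have "V.elts (W.pow k) \<subseteq> V.elts (V.pow k)"
    proof
      fix S assume "S \<in> V.elts (W.pow k)"
      then have S: "S \<in> W" "W.elts S \<subseteq> W.elts k" using W.elts_pow[OF kW(2)] elts_W[OF W.pow_in] by auto
      then show "S \<in> V.elts (V.pow k)" unfolding V.elts_pow[OF kM] using elts_W[OF S(1)] elts_W[OF kW(2)] WM by simp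
    qed
    then have 1: "V.lep (W.pow k) (V.cs k)"
      using V.lep_trans[OF WM[OF W.pow_in] V.lep_subset[OF WM[OF W.pow_in]] V.eqp_lep[OF e]] by blast
    obtain m where m: "W.cardinal m" "W.eqp (W.pow k) m" by (rule W.cardinal_ex[OF W.pow_in])
    have om: "V.ordinal m" "m \<in> W" using m(1) ordinal_W W.ordinal_M unfolding W.cardinal_def by auto
    have km: "k \<in> V.elts m" using W.mem_cardinal_of_pow[OF kW(1) m] elts_W[OF om(2)] by simp
    have "l \<in> V.elts m" using lk V.ordinal_subset_iff[OF l_V k] km V.ordinal_trans[OF om(1) km] by blast
    \<comment> \<open>The injection of \<open>m\<close> into the successor exists only in
      \<open>M\<close>. It bounds \<open>m\<close> as an ordinal because \<open>m\<close> is a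
      cardinal of \<open>M\<close> as well, and this bound is absolute.\<close>
    then have cm: "V.cardinal m" by (rule cardinal_up[OF m(1)])
    have "W.lep m (W.pow k)" by (rule W.eqp_lep[OF W.eqp_sym[OF om(2) W.pow_in m(2)]])
    then have "V.lep m (V.cs k)"
      using V.lep_trans[OF WM[OF om(2)] lep_W[OF om(2) W.pow_in] 1] by blast
    then have "V.elts m \<subseteq> V.elts (V.cs k)" by (rule V.cardinal_le[OF cm V.cs_props(3)[OF k]])
    then have "W.elts m \<subseteq> W.elts (W.cs k)" unfolding elts_W[OF om(2)] elts_W[OF W.cs_in] unfolding cs .
    then have "W.lep (W.pow k) (W.cs k)"
      using W.lep_trans[OF W.pow_in W.eqp_lep[OF m(2)] W.lep_subset[OF om(2)]] by blast
    then show "W.eqp (W.pow k) (W.cs k)" by (rule W.eqp_pow_cs[OF kW(1)])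
  }
qed

text \<open>From \<open>z\<close> \<ge> \<open>l\<close> on the two successor operations coincide by
  \<open>cs_W\<close>, and iterates never fall below \<open>z\<close>.\<close>

lemma iter_cs_W:
  assumes z: "V.ordinal z" and lz: "V.elts l \<subseteq> V.elts z" and b: "V.ordinal b"
  shows "W.iter_cs z b = V.iter_cs z b"
proof -
  have zW: "z \<in> W" and bW: "b \<in> W" "W.ordinal b" using ords z b ordinal_W by auto
  have zo: "W.ordinal z" using z ordinal_W by blast
  note Wit = W.it_0[OF W.dtm_cs0 zW] W.it_succ[OF W.dtm_cs0 zW] W.it_limit[OF W.dtm_cs0 zW]
  note zM = WM[OF zW]
  note Vit = V.it_0[OF V.dtm_cs0 zM] V.it_succ[OF V.dtm_cs0 zM] V.it_limit[OF V.dtm_cs0 zM]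
  \<comment> \<open>The iteration of \<open>W\<close> is definable over \<open>W\<close>, while the
    induction in \<open>M\<close> needs a predicate definable over \<open>M\<close>. Up to
    \<open>b\<close> the iteration is captured by a set \<open>g\<close> of \<open>W\<close>, which
    serves as a parameter.\<close>
  obtain g where g: "g \<in> W" "\<And>x. x \<in> W.elts (W.succ b) \<Longrightarrow> W.app g x = W.iter_cs z x"
    using W.ex_fun[OF W.small_elts[OF W.succ_in] W.dtm_it0[OF W.dtm_cs0 zW]] by blast
  have sb: "W.elts (W.succ b) = V.elts (V.succ b)" using elts_W[OF W.succ_in, of b] unfolding succ_W[OF bW(1)] .
  have os: "V.ordinal (V.succ b)" by (rule V.ordinal_succ[OF b])
  have gW: "V.app g x = W.iter_cs z x" if "x \<in> V.elts (V.succ b)" for x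
    using g(2)[unfolded sb, OF that] app_W[OF g(1) elts_inW[OF ords[OF os] that]] by simp
  have "b \<in> V.elts (V.succ b) \<longrightarrow> V.app g b = V.iter_cs z b"
  proof (rule V.ord_induct[where x = b and P = "\<lambda>x. x \<in> V.elts (V.succ b) \<longrightarrow> V.app g x = V.iter_cs z x"])
    show "V.dfn (\<lambda>e. e 0 \<in> V.elts (V.succ b) \<longrightarrow> V.app g (e 0) = V.iter_cs z (e 0))"
      by (intro dfn_intros V.succ_in WM[OF g(1)] V.dtm_it0[OF V.dtm_cs0 zM])
    fix x assume x: "V.ordinal x" and IH: "\<And>y. y \<in> V.elts x \<Longrightarrow> y \<in> V.elts (V.succ b) \<longrightarrow> V.app g y = V.iter_cs z y"
    show "x \<in> V.elts (V.succ b) \<longrightarrow> V.app g x = V.iter_cs z x"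
    proof
      assume xs: "x \<in> V.elts (V.succ b)"
      have xW: "x \<in> W" "W.ordinal x" using ords[OF x] x ordinal_W by auto
      have ys: "y \<in> V.elts (V.succ b)" if "y \<in> V.elts x" for y by (rule V.ordinal_trans[OF os xs that])
      have eq: "W.iter_cs z y = V.iter_cs z y" if "y \<in> V.elts x" for y
        using IH[OF that] ys[OF that] gW[OF ys[OF that]] by simp
      have "W.iter_cs z x = V.iter_cs z x"
        using x
      proof (cases rule: V.ord_cases)
        case 1
        then show ?thesis using Wit(1)[OF xW(2)] Vit(1)[OF x] elts_W[OF xW(1)] by simp
      next
        case (2 y)
        have yW: "W.ordinal y" "y \<in> W" using 2(2) ordinal_W ords by auto
        have "W.iter_cs z x = W.cs (W.iter_cs z y)" using Wit(2)[OF yW(1)] succ_W[OF yW(2)] 2(3) by simp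
        also have "\<dots> = W.cs (V.iter_cs z y)" using eq[OF 2(1)] by simp
        also have "\<dots> = V.cs (V.iter_cs z y)"
          by (rule cs_W[OF V.iter_cs_ordinal[OF z 2(2)]]) (use lz V.iter_cs_ge_base[OF z 2(2)] in blast)
        also have "\<dots> = V.iter_cs z x" using Vit(2)[OF 2(2)] 2(3) by simp
        finally show ?thesis .
      next
        case 3
        have M: "W.iter_cs z x \<in> W" "V.iter_cs z x \<in> M"
          using W.it_M[OF W.dtm_cs0 zW xW(1)] V.it_M[OF V.dtm_cs0 zM WM[OF xW(1)]] by auto
        have "W.limit_ordinal x" using 3 limit_W by blast
        then have "V.elts (W.iter_cs z x) = (\<Union>y\<in>V.elts x. W.elts (W.iter_cs z y))"
          using Wit(3) elts_W[OF M(1)] elts_W[OF xW(1)] by simp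
        also have "\<dots> = (\<Union>y\<in>V.elts x. V.elts (V.iter_cs z y))"
        proof (rule SUP_cong[OF refl])
          fix y assume y: "y \<in> V.elts x"
          have "W.iter_cs z y \<in> W" by (rule W.it_M[OF W.dtm_cs0 zW elts_inW[OF xW(1) y]])
          then show "W.elts (W.iter_cs z y) = V.elts (V.iter_cs z y)" using elts_W eq[OF y] by metis
        qed
        also have "\<dots> = V.elts (V.iter_cs z x)" using Vit(3)[OF 3] by simp
        finally show ?thesis using V.elts_ext[OF WM[OF M(1)] M(2)] by blast
      qed
      then show "V.app g x = V.iter_cs z x" using gW[OF xs] by simp
    qed
  qed (rule b)
  moreover have bs: "b \<in> V.elts (V.succ b)" using V.elts_succ[OF WM[OF bW(1)]] by blast
  ultimately show ?thesis using gW[OF bs] by simp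
qed

end

section \<open>Decoding the generic filter in the ground model\<close>

theorem CCA_imp_G_in_W:
  assumes "V.CCA"
  shows "G \<in> W"
proof -
  obtain l where l: "W.ordinal l"
    and absorb: "\<And>a. W.ordinal a \<Longrightarrow> W.elts l \<subseteq> W.elts a \<Longrightarrow> W.lep (W.cprod a P) a"
    using W.absorbing_ordinal_ex[OF P_W] by metis
  have lV: "V.ordinal l" "l \<in> M" using l ordinal_W V.ordinal_M by auto
  obtain \<mu> h where h: "W.ordinal \<mu>" "h \<in> W" "bij_betw (W.app h) (W.elts \<mu>) (W.elts P)"
    by (rule W.well_ordering[OF P_W])
  have m: "V.ordinal \<mu>" "\<mu> \<in> W" using h(1) ordinal_W W.ordinal_M by auto
  have mM: "\<mu> \<in> M" by (rule WM[OF m(2)])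
  let ?\<alpha> = "V.oadd l \<mu>"
  have oa: "V.ordinal ?\<alpha>" by (rule V.oadd_ordinal[OF lV(1) m(1)])
  \<comment> \<open>Only the ordinals l + \<beta> carry information about \<open>G\<close>; those
    below \<open>l\<close> stay outside the coded set and serve as padding.\<close>
  let ?A = "{u \<in> V.elts ?\<alpha>. \<exists>\<beta>\<in>V.elts \<mu>. u = V.oadd l \<beta> \<and> V.app h \<beta> \<in> V.elts G}"
  have "V.small ?A"
    by (intro V.small_sep V.small_elts V.ordinal_M[OF oa] dfn_intros V.dtm_comp1[OF V.dtm_it0[OF V.dtm_succ0 lV(2)]] mM WM[OF h(2)] G_M)
  then have eA: "V.elts (V.mk ?A) = ?A" by (rule V.elts_mk)
  have "V.elts (V.mk ?A) \<subseteq> V.elts ?\<alpha>" unfolding eA by blast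
  then obtain \<theta> where t: "V.ordinal \<theta>"
    "\<And>\<beta>. \<beta> \<in> V.elts ?\<alpha> \<Longrightarrow> \<beta> \<in> V.elts (V.mk ?A) \<longleftrightarrow> V.GCH_at (V.succ (V.oadd \<theta> \<beta>))"
    by (rule V.CCA_E[OF assms oa V.mk_in]) (rule that)
  \<comment> \<open>The aleph of index \<theta> + l as computed in \<open>M\<close>. The alephs of
    \<open>W\<close> may differ from those of \<open>M\<close>, but \<open>z\<close> is an ordinal
    and so is available to \<open>W\<close> as a parameter.\<close>
  define z where "z = V.iter_cs (V.iter_cs V.\<omega> \<theta>) l"
  have oz0: "V.ordinal (V.iter_cs V.\<omega> \<theta>)" by (rule V.iter_cs_ordinal[OF V.omega_ordinal t(1)])
  have oz: "V.ordinal z" unfolding z_def by (rule V.iter_cs_ordinal[OF oz0 lV(1)])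
  have lz: "V.elts l \<subseteq> V.elts z" unfolding z_def by (rule V.iter_cs_ge[OF oz0 lV(1)])
  have zW: "z \<in> W" by (rule ords[OF oz])
  let ?k = "\<lambda>\<beta>. W.cs (W.iter_cs z \<beta>)"
  have key: "V.app h \<beta> \<in> V.elts G \<longleftrightarrow> W.eqp (W.pow (?k \<beta>)) (W.cs (?k \<beta>))" if b: "\<beta> \<in> V.elts \<mu>" for \<beta>
  proof -
    have ob: "V.ordinal \<beta>" by (rule V.ordinal_mem[OF m(1) b])
    have oi: "V.ordinal (V.iter_cs z \<beta>)" by (rule V.iter_cs_ordinal[OF oz ob])
    have li: "V.elts l \<subseteq> V.elts (V.iter_cs z \<beta>)" using lz V.iter_cs_ge_base[OF oz ob] by blast
    have k: "?k \<beta> = V.cs (V.iter_cs z \<beta>)"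
      using iter_cs_W[OF l absorb oz lz ob] cs_W[OF l absorb oi li] by simp
    have ok: "V.ordinal (V.cs (V.iter_cs z \<beta>))" "V.elts l \<subseteq> V.elts (V.cs (V.iter_cs z \<beta>))"
      using V.cs_props(3,4)[OF oi] li by auto
    have mem: "V.oadd l \<beta> \<in> V.elts ?\<alpha>" by (rule V.oadd_strict_mono[OF lV(1) m(1) b])
    have inj: "\<beta>' = \<beta>" if "\<beta>' \<in> V.elts \<mu>" "V.oadd l \<beta> = V.oadd l \<beta>'" for \<beta>'
      using V.oadd_inj[OF lV(1) ob V.ordinal_mem[OF m(1) that(1)] that(2)] by simp
    have "V.app h \<beta> \<in> V.elts G \<longleftrightarrow> V.oadd l \<beta> \<in> V.elts (V.mk ?A)"
      unfolding eA using mem b inj by blast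
    also have "\<dots> \<longleftrightarrow> V.GCH_at (V.succ (V.oadd \<theta> (V.oadd l \<beta>)))" by (rule t(2)[OF mem])
    also have "\<dots> \<longleftrightarrow> V.eqp (V.pow (?k \<beta>)) (V.cs (?k \<beta>))"
      by (rule V.GCH_at_shifted[OF t(1) lV(1) ob z_def k])
    also have "\<dots> \<longleftrightarrow> W.eqp (W.pow (?k \<beta>)) (W.cs (?k \<beta>))"
      unfolding k by (rule gch_W[OF l absorb ok])
    finally show ?thesis .
  qed
  \<comment> \<open>The definition uses only operations of \<open>W\<close> with the parameters
    \<open>h\<close>, \<mu>, \<open>z\<close> and \<open>P\<close>, so Separation in
    \<open>W\<close> applies to it.\<close>
  let ?G = "{p \<in> V.elts P. \<exists>\<beta>\<in>V.elts \<mu>. W.app h \<beta> = p \<and> W.eqp (W.pow (?k \<beta>)) (W.cs (?k \<beta>))}"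
  have "W.small ?G"
    by (intro W_small_sep P_W dfn_intros m(2) h(2) W.dtm_comp1[OF W.dtm_it0[OF W.dtm_cs0 zW]])
  moreover have "?G = V.elts G"
  proof (intro equalityI subsetI)
    fix p assume "p \<in> ?G"
    then obtain \<beta> where b: "\<beta> \<in> V.elts \<mu>" "W.app h \<beta> = p" "W.eqp (W.pow (?k \<beta>)) (W.cs (?k \<beta>))" by blast
    then show "p \<in> V.elts G" using key[OF b(1)] app_W[OF h(2) elts_inW[OF m(2) b(1)]] by simp
  next
    fix p assume p: "p \<in> V.elts G"
    have "p \<in> W.elts P" using G_P[OF p] elts_W[OF P_W] by simp
    then obtain \<beta> where "\<beta> \<in> W.elts \<mu>" "W.app h \<beta> = p" using h(3) unfolding bij_betw_iff_ball by blast
    then have b: "\<beta> \<in> V.elts \<mu>" "W.app h \<beta> = p" using elts_W[OF m(2)] by auto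
    then have "W.eqp (W.pow (?k \<beta>)) (W.cs (?k \<beta>))"
      using key[OF b(1)] app_W[OF h(2) elts_inW[OF m(2) b(1)]] p by simp
    then show "p \<in> ?G" using b G_P[OF p] by blast
  qed
  ultimately have "W.small (V.elts G)" by simp
  then show ?thesis using W_mk(1)[of "V.elts G"] V.mk_elts[OF G_M] by simp
qed

text \<open>Of two incompatible extensions of a condition at most one is in \<open>G\<close>, so the
  complement of \<open>G\<close> in \<open>P\<close> is dense. If \<open>G\<close> were in
  \<open>W\<close>, this complement would be too, and \<open>G\<close> would have to meet
  it.\<close>

lemma G_notin_W:
  assumes "W.nontrivial P L"
  shows "G \<notin> W"
proof
  assume GW: "G \<in> W"
  have "W.small {p \<in> V.elts P. p \<notin> V.elts G}" by (intro W_small_sep P_W dfn_intros GW)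
  note D = W_mk[OF this]
  have "\<exists>d\<in>V.elts (V.mk {p \<in> V.elts P. p \<notin> V.elts G}). d \<in> V.elts G"
  proof (rule G_meets[OF D(1)])
    show "V.elts (V.mk {p \<in> V.elts P. p \<notin> V.elts G}) \<subseteq> V.elts P" unfolding D(2) by blast
    fix p assume p: "p \<in> V.elts P"
    obtain q r where q: "q \<in> V.elts P" "r \<in> V.elts P" "W.rel L q p" "W.rel L r p" "\<not> W.compatible P L q r"
      using assms p unfolding W.nontrivial_def elts_W[OF P_W] by blast
    have le: "le q p" "le r p" using q p W_rel_iff P_in by auto
    have "q \<notin> V.elts G \<or> r \<notin> V.elts G"
    proof (rule ccontr)
      assume "\<not> ?thesis"
      then obtain s where "s \<in> V.elts G" "le s q" "le s r" using G_dir by blast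
      then have "W.compatible P L q r"
        unfolding W.compatible_def elts_W[OF P_W] using W_rel_iff P_in G_P q by blast
      then show False using q(5) by blast
    qed
    then show "\<exists>d\<in>V.elts (V.mk {p \<in> V.elts P. p \<notin> V.elts G}). le d p"
      unfolding D(2) using q le by blast
  qed
  then show False unfolding D(2) by blast
qed

end

theorem theoremT:
  fixes M :: "'a set" and E :: "'a \<Rightarrow> 'a \<Rightarrow> bool"
  assumes "set_structure.ZFC M E"
    and "set_structure.CCA M E"
  shows "GA M E"
  unfolding GA_def
proof
  assume "\<exists>W P L G. inner_model M E W \<and> set_structure.forcing_notion W E P L \<and>
    set_structure.nontrivial W E P L \<and> G \<in> M \<and> generic_filter M E W P L G \<and> M = generic_extension M E W P G"
  then obtain W P L G where i: "inner_model M E W" and f: "set_structure.forcing_notion W E P L"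
    and n: "set_structure.nontrivial W E P L" and g: "G \<in> M" "generic_filter M E W P L G" "M = generic_extension M E W P G"
    by blast
  \<comment> \<open>A definable class is by definition cut out of \<open>M\<close>.\<close>
  have W: "W \<subseteq> M" using i unfolding inner_model_def set_structure.definable_class_def by blast
  interpret forcing_extension M W E P L G
  proof
    show "set_structure.ZFC M E" "set_structure.ZFC W E" using assms(1) i unfolding inner_model_def by auto
  qed (use W i f g in \<open>auto simp: inner_model_def\<close>)
  show False using CCA_imp_G_in_W[OF assms(2)] G_notin_W[OF n] by blast
qed

end
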